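(* Every locally optimal control $\mathbf{u}^*\in U_{ad}$ satisfies the variational inequality $$\sum_{k=1}^{\ell}\left(\alpha\mathbf{u}^*_k+\omega^2\,\mathfrak{Re}\left\{\int_{\Omega_k}\varepsilon_\sigma\,\boldsymbol{y}^*\cdot\boldsymbol{p}^*\right\}\right)(\mathbf{u}_k-\mathbf{u}^*_k)\ge 0\qquad\forall\,\mathbf{u}\in U_{ad},$$ where $\boldsymbol{y}^*=\mathcal{S}\mathbf{u}^*$ and $\boldsymbol{p}^*\in\mathbf{H}_0(\mathbf{curl},\Omega)$ is the unique solution of $$(\mu^{-1}\mathbf{curl}\,\boldsymbol{p}^*,\mathbf{curl}\,\boldsymbol{w})_\Omega-\omega^2((\varepsilon_\sigma\cdot\mathbf{u}^* )\boldsymbol{p}^*,\boldsymbol{w})_\Omega=(\overline{\boldsymbol{y}^*-\boldsymbol{y}_\Omega},\boldsymbol{w})_\Omega+(\overline{\mathbf{curl}\,\boldsymbol{y}^*-\boldsymbol{E}_\Omega},\mathbf{curl}\,\boldsymbol{w})_\Omega\quad\forall\boldsymbol{w}\in\mathbf{H}_0(\mathbf{curl},\Omega).$$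
   Context: $\Omega\subset\mathbb{R}^3$ is an open, bounded, simply connected polyhedral domain with Lipschitz boundary $\Gamma$ and outward unit normal $\boldsymbol{n}$. $\mathbf{L}^2(\Omega;\mathbb{C})$ is the space of $\mathbb{C}^3$-valued square integrable fields; $(\boldsymbol v,\boldsymbol w)_\Omega=\int_\Omega \boldsymbol v\cdot\overline{\boldsymbol w}$ and $\|\cdot\|_\Omega$ are its inner product and norm, where $\boldsymbol v\cdot\boldsymbol w=\sum_i v_iw_i$ (no conjugation). $\mathbf{H}(\mathbf{curl},\Omega)=\{\boldsymbol{w}\in\mathbf{L}^2(\Omega;\mathbb{C}):\mathbf{curl}\,\boldsymbol{w}\in\mathbf{L}^2(\Omega;\mathbb{C})\}$ with its graph norm, and $\mathbf{H}_0(\mathbf{curl},\Omega)=\{\boldsymbol{w}\in\mathbf{H}(\mathbf{curl},\Omega):\boldsymbol{w}\times\boldsymbol{n}=\mathbf{0}\text{ on }\Gamma\}$. Data: $\omega>0$; $\mu\in L^\infty(\Omega)$ real with $\mu\ge\mu_0>0$; $\varepsilon,\sigma\in L^\infty(\Omega)$ real with $0<\varepsilon_+\le\varepsilon\le\varepsilon^+$ and $0<\sigma_+\le\sigma\le\sigma^+$ (constants); $\varepsilon_\sigma:=\varepsilon+i\sigma\omega^{-1}$; $\ell\in\mathbb{N}$; $\mathcal{P}=\{\Omega_k\}_{k=1}^\ell$ is a partition of $\Omega$ into pairwise disjoint subdomains with $\overline\Omega=\cup_k\overline{\Omega}_k$. For $\mathbf{u}\in\mathbb{R}^\ell$, $\varepsilon_\sigma\cdot\mathbf{u}$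 denotes the function equal to $\mathbf{u}_k\varepsilon_\sigma$ on $\Omega_k$. $\boldsymbol{f},\boldsymbol{y}_\Omega,\boldsymbol{E}_\Omega\in\mathbf{L}^2(\Omega;\mathbb{C})$ and $\alpha>0$. Vector inequalities are componentwise; $\mathbf{a},\mathbf{b}\in\mathbb{R}^\ell$ with $\mathbf{0}<\mathbf{a}<\mathbf{b}$ and $U_{ad}:=\{\mathbf{v}\in\mathbb{R}^\ell:\mathbf{a}\le\mathbf{v}\le\mathbf{b}\}$. For $\mathbf{u}\in\mathbb{R}^\ell$ with $\mathbf{u}>\mathbf{0}$, $\mathcal{S}\mathbf{u}:=\boldsymbol{y}\in\mathbf{H}_0(\mathbf{curl},\Omega)$ is the unique solution of the state equation $(\mu^{-1}\mathbf{curl}\,\boldsymbol{y},\mathbf{curl}\,\boldsymbol{w})_\Omega-\omega^2((\varepsilon_\sigma\cdot\mathbf{u})\boldsymbol{y},\boldsymbol{w})_\Omega=(\boldsymbol{f},\boldsymbol{w})_\Omega$ for all $\boldsymbol{w}\in\mathbf{H}_0(\mathbf{curl},\Omega)$. Cost: $\mathcal{J}(\boldsymbol{y},\mathbf{u})=\tfrac12\|\boldsymbol{y}-\boldsymbol{y}_\Omega\|_\Omega^2+\tfrac12\|\mathbf{curl}\,\boldsymbol{y}-\boldsymbol{E}_\Omega\|_\Omega^2+\tfrac{\alpha}{2}\|\mathbf{u}\|_{\mathbb{R}^\ell}^2$. A control $\mathbf{u}^*\in U_{ad}$ is locally optimal if there is $\delta>0$ such that $\mathcal{J}(\mathcal{S}\mathbf{u}^*,\mathbf{u}^*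 )\le\mathcal{J}(\mathcal{S}\mathbf{u},\mathbf{u})$ for all $\mathbf{u}\in U_{ad}$ with $\|\mathbf{u}-\mathbf{u}^*\|_{\mathbb{R}^\ell}\le\delta$. *)

theory Defs
  imports "HOL-Analysis.Analysis"
begin

type_synonym field = "real^3 \<Rightarrow> complex^3"

section \<open>The domain\<close>

definition polyhedral :: "(real^3) set \<Rightarrow> bool" where
  "polyhedral \<Omega> \<longleftrightarrow> (\<exists>F. finite F \<and> (\<forall>T\<in>F. polytope T) \<and> closure \<Omega> = \<Union>F)"

text \<open>Near each boundary point and in suitable Cartesian coordinates, the set is the strict
  epigraph of a Lipschitz function.\<close>

definition lipschitz_boundary :: "(real^3) set \<Rightarrow> bool" where
  "lipschitz_boundary \<Omega> \<longleftrightarrow>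
     (\<forall>p\<in>frontier \<Omega>. \<exists>U (T :: real^3 \<Rightarrow> real^3) (g :: real^2 \<Rightarrow> real) L.
        open U \<and> p \<in> U \<and> orthogonal_transformation T \<and> L-lipschitz_on UNIV g \<and>
        (\<forall>x\<in>U. x \<in> \<Omega> \<longleftrightarrow> g (vector [T x $ 1, T x $ 2]) < T x $ 3))"

definition lipschitz_polyhedral_domain :: "(real^3) set \<Rightarrow> bool" where
  "lipschitz_polyhedral_domain \<Omega> \<longleftrightarrow>
     \<Omega> \<noteq> {} \<and> open \<Omega> \<and> connected \<Omega> \<and> bounded \<Omega> \<and> simply_connected \<Omega> \<and>
     polyhedral \<Omega> \<and> lipschitz_boundary \<Omega>"

text \<open>The subdomains cover the domain up to a Lebesgue null set. This does not follow from the
  condition on the closures, and without it a function prescribed on each subdomain would not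
  be an element of \<open>L\<^sup>\<infinity>(\<Omega>)\<close>.\<close>

definition domain_partition :: "(real^3) set \<Rightarrow> ('l::finite \<Rightarrow> (real^3) set) \<Rightarrow> bool" where
  "domain_partition \<Omega> P \<longleftrightarrow>
     (\<forall>k. P k \<noteq> {} \<and> open (P k) \<and> connected (P k) \<and> P k \<subseteq> \<Omega>) \<and>
     (\<forall>j k. j \<noteq> k \<longrightarrow> P j \<inter> P k = {}) \<and>
     closure \<Omega> = (\<Union>k. closure (P k)) \<and> negligible (\<Omega> - (\<Union>k. P k))"

section \<open>Complex vectors and Lebesgue spaces\<close>

definition cdot :: "complex^3 \<Rightarrow> complex^3 \<Rightarrow> complex" (infixl "\<odot>" 70) where
  "v \<odot> w = (\<Sum>i\<in>UNIV. v $ i * w $ i)"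

definition cnjv :: "complex^3 \<Rightarrow> complex^3" where
  "cnjv v = (\<chi> i. cnj (v $ i))"

text \<open>Elements of \<open>L\<^sup>2\<close> and \<open>L\<^sup>\<infinity>\<close> are represented by functions; equality is
  equality almost everywhere and is written out where it matters.\<close>

definition L2 :: "(real^3) set \<Rightarrow> field set" where
  "L2 \<Omega> = {v. v \<in> borel_measurable (lebesgue_on \<Omega>) \<and>
              integrable (lebesgue_on \<Omega>) (\<lambda>x. (norm (v x))\<^sup>2)}"

definition Linf :: "(real^3) set \<Rightarrow> (real^3 \<Rightarrow> real) set" where
  "Linf \<Omega> = {g. g \<in> borel_measurable (lebesgue_on \<Omega>) \<and>
                (\<exists>C. AE x in lebesgue_on \<Omega>. \<bar>g x\<bar> \<le> C)}"

definition l2_inner :: "(real^3) set \<Rightarrow> field \<Rightarrow> field \<Rightarrow> complex" where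
  "l2_inner \<Omega> v w = (LINT x|lebesgue_on \<Omega>. v x \<odot> cnjv (w x))"

definition l2_norm :: "(real^3) set \<Rightarrow> field \<Rightarrow> real" where
  "l2_norm \<Omega> v = sqrt (LINT x|lebesgue_on \<Omega>. (norm (v x))\<^sup>2)"

section \<open>Smooth fields and the weak curl\<close>

primrec Ck :: "nat \<Rightarrow> (real^3 \<Rightarrow> 'b::real_normed_vector) \<Rightarrow> bool" where
  "Ck 0 f \<longleftrightarrow> continuous_on UNIV f"
| "Ck (Suc n) f \<longleftrightarrow> (\<forall>x. f differentiable (at x)) \<and>
                    (\<forall>v. Ck n (\<lambda>x. frechet_derivative f (at x) v))"

definition smooth :: "(real^3 \<Rightarrow> 'b::real_normed_vector) \<Rightarrow> bool" where
  "smooth f \<longleftrightarrow> (\<forall>n. Ck n f)"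

definition test_fields :: "(real^3) set \<Rightarrow> field set" where
  "test_fields \<Omega> =
     {\<phi>. smooth \<phi> \<and> compact (closure {x. \<phi> x \<noteq> 0}) \<and> closure {x. \<phi> x \<noteq> 0} \<subseteq> \<Omega>}"

definition partial :: "3 \<Rightarrow> field \<Rightarrow> field" where
  "partial j \<phi> x = frechet_derivative \<phi> (at x) (axis j 1)"

definition classical_curl :: "field \<Rightarrow> field" where
  "classical_curl \<phi> x = vector
     [partial 2 \<phi> x $ 3 - partial 3 \<phi> x $ 2,
      partial 3 \<phi> x $ 1 - partial 1 \<phi> x $ 3,
      partial 1 \<phi> x $ 2 - partial 2 \<phi> x $ 1]"

definition has_weak_curl :: "(real^3) set \<Rightarrow> field \<Rightarrow> field \<Rightarrow> bool" where
  "has_weak_curl \<Omega> v c \<longleftrightarrow> c \<in> L2 \<Omega> \<and>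
     (\<forall>\<phi>\<in>test_fields \<Omega>.
        (LINT x|lebesgue_on \<Omega>. c x \<odot> \<phi> x) =
        (LINT x|lebesgue_on \<Omega>. v x \<odot> classical_curl \<phi> x))"

definition Hcurl :: "(real^3) set \<Rightarrow> field set" where
  "Hcurl \<Omega> = {v \<in> L2 \<Omega>. \<exists>c. has_weak_curl \<Omega> v c}"

text \<open>A representative of the weak curl, which is unique almost everywhere.\<close>

definition curl :: "(real^3) set \<Rightarrow> field \<Rightarrow> field" where
  "curl \<Omega> v = (SOME c. has_weak_curl \<Omega> v c)"

text \<open>The tangential trace \<open>v \<times> n\<close> of a field in \<open>H(curl)\<close> is the functional on the boundary
  given by Green's formula: for \<open>v\<close> smooth up to the boundary, the right-hand side below is
  the surface integral of \<open>(v \<times> n) \<cdot> \<phi>\<close>. On a bounded Lipschitz domain the restrictions of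
  smooth fields are dense in \<open>H\<^sup>1(\<Omega>)\<close>, so these values determine the trace as an
  element of \<open>H\<^sup>-\<^sup>1\<^sup>/\<^sup>2(\<Gamma>)\<close>.\<close>

definition tangential_trace :: "(real^3) set \<Rightarrow> field \<Rightarrow> field \<Rightarrow> complex" where
  "tangential_trace \<Omega> v \<phi> =
     (LINT x|lebesgue_on \<Omega>. v x \<odot> classical_curl \<phi> x - curl \<Omega> v x \<odot> \<phi> x)"

definition H0curl :: "(real^3) set \<Rightarrow> field set" where
  "H0curl \<Omega> = {v \<in> Hcurl \<Omega>. \<forall>\<phi>. smooth \<phi> \<longrightarrow> tangential_trace \<Omega> v \<phi> = 0}"

section \<open>State equation, adjoint equation and optimal control\<close>

definition eps_sigma ::
    "real \<Rightarrow> (real^3 \<Rightarrow> real) \<Rightarrow> (real^3 \<Rightarrow> real) \<Rightarrow> real^3 \<Rightarrow> complex" where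
  "eps_sigma \<omega> \<epsilon> \<sigma> x = complex_of_real (\<epsilon> x) + \<i> * complex_of_real (\<sigma> x / \<omega>)"

definition ctrl_mult ::
    "('l::finite \<Rightarrow> (real^3) set) \<Rightarrow> (real^3 \<Rightarrow> complex) \<Rightarrow> real^'l \<Rightarrow> real^3 \<Rightarrow> complex" where
  "ctrl_mult P e u x = (\<Sum>k\<in>UNIV. if x \<in> P k then complex_of_real (u $ k) * e x else 0)"

definition maxwell_form ::
    "(real^3) set \<Rightarrow> (real^3 \<Rightarrow> real) \<Rightarrow> real \<Rightarrow> (real^3 \<Rightarrow> complex) \<Rightarrow> field \<Rightarrow> field \<Rightarrow> complex" where
  "maxwell_form \<Omega> \<mu> \<omega> \<kappa> y w =
     l2_inner \<Omega> (\<lambda>x. inverse (\<mu> x) *\<^sub>R curl \<Omega> y x) (curl \<Omega> w)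
     - complex_of_real (\<omega>\<^sup>2) * l2_inner \<Omega> (\<lambda>x. \<kappa> x *s y x) w"

definition solves_state ::
    "(real^3) set \<Rightarrow> (real^3 \<Rightarrow> real) \<Rightarrow> real \<Rightarrow> (real^3 \<Rightarrow> complex) \<Rightarrow> field \<Rightarrow> field \<Rightarrow> bool" where
  "solves_state \<Omega> \<mu> \<omega> \<kappa> f y \<longleftrightarrow> y \<in> H0curl \<Omega> \<and>
     (\<forall>w\<in>H0curl \<Omega>. maxwell_form \<Omega> \<mu> \<omega> \<kappa> y w = l2_inner \<Omega> f w)"

definition solves_adjoint ::
    "(real^3) set \<Rightarrow> (real^3 \<Rightarrow> real) \<Rightarrow> real \<Rightarrow> (real^3 \<Rightarrow> complex) \<Rightarrow>
     field \<Rightarrow> field \<Rightarrow> field \<Rightarrow> field \<Rightarrow> bool" where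
  "solves_adjoint \<Omega> \<mu> \<omega> \<kappa> yd Ed y p \<longleftrightarrow> p \<in> H0curl \<Omega> \<and>
     (\<forall>w\<in>H0curl \<Omega>. maxwell_form \<Omega> \<mu> \<omega> \<kappa> p w =
        l2_inner \<Omega> (\<lambda>x. cnjv (y x - yd x)) w
        + l2_inner \<Omega> (\<lambda>x. cnjv (curl \<Omega> y x - Ed x)) (curl \<Omega> w))"

definition unique_ae :: "(real^3) set \<Rightarrow> (field \<Rightarrow> bool) \<Rightarrow> field \<Rightarrow> bool" where
  "unique_ae \<Omega> Q v \<longleftrightarrow> Q v \<and> (\<forall>w. Q w \<longrightarrow> (AE x in lebesgue_on \<Omega>. w x = v x))"

text \<open>The control-to-state map, returning a representative of the unique solution.\<close>

definition state_map ::
    "(real^3) set \<Rightarrow> ('l::finite \<Rightarrow> (real^3) set) \<Rightarrow> (real^3 \<Rightarrow> real) \<Rightarrow> real \<Rightarrow>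
     (real^3 \<Rightarrow> complex) \<Rightarrow> field \<Rightarrow> real^'l \<Rightarrow> field" where
  "state_map \<Omega> P \<mu> \<omega> e f u =
     (SOME y. unique_ae \<Omega> (solves_state \<Omega> \<mu> \<omega> (ctrl_mult P e u) f) y)"

definition cost ::
    "(real^3) set \<Rightarrow> real \<Rightarrow> field \<Rightarrow> field \<Rightarrow> field \<Rightarrow> real^'l::finite \<Rightarrow> real" where
  "cost \<Omega> \<alpha> yd Ed y u =
     1/2 * (l2_norm \<Omega> (\<lambda>x. y x - yd x))\<^sup>2
     + 1/2 * (l2_norm \<Omega> (\<lambda>x. curl \<Omega> y x - Ed x))\<^sup>2
     + \<alpha>/2 * (norm u)\<^sup>2"

definition Uad :: "real^'l::finite \<Rightarrow> real^'l \<Rightarrow> (real^'l) set" where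
  "Uad a b = {v. \<forall>k. a $ k \<le> v $ k \<and> v $ k \<le> b $ k}"

text \<open>Here \<open>j\<close> is the reduced cost.\<close>

definition locally_optimal :: "(real^'l::finite) set \<Rightarrow> (real^'l \<Rightarrow> real) \<Rightarrow> real^'l \<Rightarrow> bool" where
  "locally_optimal U j us \<longleftrightarrow>
     us \<in> U \<and> (\<exists>\<delta>>0. \<forall>u\<in>U. norm (u - us) \<le> \<delta> \<longrightarrow> j us \<le> j u)"

end

theory Submission
  imports Defs "HOL-Library.Function_Algebras"
begin

text \<open>With \<open>u\<^sub>t = u* + t h\<close> and \<open>z\<^sub>t = S u\<^sub>t - S u*\<close>, subtracting the two state equations gives
  \<open>B(z\<^sub>t, w) = \<omega>\<^sup>2 t ((\<epsilon>\<^sub>\<sigma> \<cdot> h) S u\<^sub>t, w)\<close>. The form \<open>B\<close> is symmetric under exchanging its arguments up to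
  complex conjugation, so testing the adjoint equation with the conjugate of \<open>z\<^sub>t\<close> turns the first
  order part of the change in cost into \<open>\<omega>\<^sup>2 t Re \<integral> (\<epsilon>\<^sub>\<sigma> \<cdot> h) S u\<^sub>t \<cdot> p\<close>. Coercivity of \<open>B\<close> gives
  \<open>\<parallel>z\<^sub>t\<parallel> = O(t)\<close>, hence the remainder is \<open>O(t\<^sup>2)\<close>, and dividing by \<open>t\<close> yields the inequality without
  differentiating the control-to-state map. Existence for both equations is the Lax-Milgram theorem,
  applicable because the conductivity makes a rotated form coercive. The spaces consist of functions
  rather than classes modulo null sets, so Lax-Milgram is proved for a complete semi-norm.\<close>

section \<open>Semi-inner product spaces and the Lax-Milgram theorem\<close>

text \<open>The obstacle that shapes the setting: \<open>curl\<close> selects a representative by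
  choice, so \<open>curl \<Omega> (v + w)\<close> agrees with the sum of the curls only almost
  everywhere. The forms are therefore built on pairs of a field and any representative of its curl,
  where addition is exact, and are transferred to \<open>curl\<close> by almost everywhere equality.
  That transfer needs uniqueness of the weak curl, hence the fundamental lemma of the calculus of
  variations; the smooth bump functions serve only this purpose. The bound on z_t is not immediate
  from coercivity, because the perturbed state S u_t, and not S u*, stands on the right of its
  equation. Its norm is at most that of S u* plus that of z_t, and for small t the second part is
  absorbed on the left. The same splitting replaces S u_t by S u* in the first order term at the
  price of t times O(t). States along the segment exist because every admissible control has
  components above the smallest component of \<open>a\<close>.\<close>

instantiation "fun" :: (type, real_vector) real_vector
begin

text \<open>Fields are plain functions, so speaking of a \<open>subspace\<close> of fields, or of
  pairs of fields, requires a pointwise real vector space structure on function types.\<close>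

definition scaleR_fun :: "real \<Rightarrow> ('a \<Rightarrow> 'b) \<Rightarrow> 'a \<Rightarrow> 'b" where
  "scaleR_fun r f = (\<lambda>x. r *\<^sub>R f x)"

instance
  by standard (auto simp: scaleR_fun_def fun_eq_iff algebra_simps)

end

text \<open>The laws are asked for on \<open>V\<close> only: for non-integrable functions the
  Bochner integral has the default value 0, so additivity can fail outside the square integrable
  fields. Definiteness is absent because fields that agree almost everywhere remain different
  functions.\<close>

locale semi_inner =
  fixes V :: "'a::real_vector set" and ip :: "'a \<Rightarrow> 'a \<Rightarrow> real"
  assumes sub: "subspace V"
    and ip_commute: "x \<in> V \<Longrightarrow> y \<in> V \<Longrightarrow> ip x y = ip y x"
    and ip_add: "x \<in> V \<Longrightarrow> y \<in> V \<Longrightarrow> z \<in> V \<Longrightarrow> ip (x + y) z = ip x z + ip y z"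
    and ip_scale: "x \<in> V \<Longrightarrow> y \<in> V \<Longrightarrow> ip (r *\<^sub>R x) y = r * ip x y"
    and ip_nonneg: "x \<in> V \<Longrightarrow> 0 \<le> ip x x"
begin

definition nrm :: "'a \<Rightarrow> real" where "nrm x = sqrt (ip x x)"

lemma mem [simp, intro]:
  "x \<in> V \<Longrightarrow> y \<in> V \<Longrightarrow> x + y \<in> V" "x \<in> V \<Longrightarrow> r *\<^sub>R x \<in> V"
  "x \<in> V \<Longrightarrow> y \<in> V \<Longrightarrow> x - y \<in> V" "0 \<in> V"
  using sub by (auto simp: subspace_add subspace_scale subspace_diff subspace_0)

lemma ip_diff: "x \<in> V \<Longrightarrow> y \<in> V \<Longrightarrow> z \<in> V \<Longrightarrow> ip (x - y) z = ip x z - ip y z"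
  using ip_add[of "x - y" y z] by simp

lemma ip_add_right: "x \<in> V \<Longrightarrow> y \<in> V \<Longrightarrow> z \<in> V \<Longrightarrow> ip z (x + y) = ip z x + ip z y"
  by (simp add: ip_commute[of z] ip_add)

lemma ip_diff_right: "x \<in> V \<Longrightarrow> y \<in> V \<Longrightarrow> z \<in> V \<Longrightarrow> ip z (x - y) = ip z x - ip z y"
  by (simp add: ip_commute[of z] ip_diff)

lemma ip_scale_right: "x \<in> V \<Longrightarrow> z \<in> V \<Longrightarrow> ip z (r *\<^sub>R x) = r * ip z x"
  by (simp add: ip_commute[of z] ip_scale)

lemmas ip_simps = ip_add ip_diff ip_scale ip_add_right ip_diff_right ip_scale_right

lemma nrm_nonneg [simp]: "x \<in> V \<Longrightarrow> 0 \<le> nrm x"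
  by (simp add: nrm_def ip_nonneg)

lemma nrm_sq: "x \<in> V \<Longrightarrow> (nrm x)\<^sup>2 = ip x x"
  by (simp add: nrm_def ip_nonneg)

lemma cauchy_schwarz:
  assumes x: "x \<in> V" and y: "y \<in> V"
  shows "\<bar>ip x y\<bar> \<le> nrm x * nrm y"
proof -
  have q: "0 \<le> ip x x + 2 * t * ip x y + t\<^sup>2 * ip y y" for t
  proof -
    have "0 \<le> ip (x + t *\<^sub>R y) (x + t *\<^sub>R y)" using x y by (intro ip_nonneg) auto
    also have "\<dots> = ip x x + 2 * t * ip x y + t\<^sup>2 * ip y y"
      using x y by (simp add: ip_simps ip_commute[of y x] power2_eq_square algebra_simps)
    finally show ?thesis .
  qed
  have "(ip x y)\<^sup>2 \<le> ip x x * ip y y"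
  proof (cases "ip y y = 0")
    case True
    have "ip x y = 0"
    proof (rule ccontr)
      assume n: "ip x y \<noteq> 0"
      \<comment> \<open>For a null vector \<open>y\<close> the quadratic in \<open>t\<close>
        degenerates to an affine function, which is unbounded below unless its slope vanishes; this
        \<open>t\<close> gives it the value -1.\<close>
      have "0 \<le> ip x x + 2 * (- (ip x x + 1) / (2 * ip x y)) * ip x y"
        using q[of "- (ip x x + 1) / (2 * ip x y)"] True by simp
      also have "\<dots> = -1" using n by (simp add: field_simps)
      finally show False by simp
    qed
    then show ?thesis using True by simp
  next
    case False
    then have p: "ip y y > 0" using ip_nonneg[OF y] by simp
    \<comment> \<open>The value of the quadratic at its minimiser
      \<open>t = - ip x y / ip y y\<close>.\<close>
    have "0 \<le> ip x x - (ip x y)\<^sup>2 / ip y y"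
      using q[of "- ip x y / ip y y"] p by (simp add: power2_eq_square field_simps)
    then show ?thesis using p by (simp add: field_simps)
  qed
  then have "sqrt ((ip x y)\<^sup>2) \<le> sqrt (ip x x * ip y y)" by (rule real_sqrt_le_mono)
  then show ?thesis by (simp add: nrm_def real_sqrt_mult)
qed

lemma nrm_triangle:
  assumes x: "x \<in> V" and y: "y \<in> V"
  shows "nrm (x + y) \<le> nrm x + nrm y"
proof (rule power2_le_imp_le)
  have "(nrm (x + y))\<^sup>2 = (nrm x)\<^sup>2 + 2 * ip x y + (nrm y)\<^sup>2"
    using x y by (simp add: nrm_sq ip_simps ip_commute[of y x])
  also have "\<dots> \<le> (nrm x)\<^sup>2 + 2 * (nrm x * nrm y) + (nrm y)\<^sup>2"
    using cauchy_schwarz[OF x y] by simp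
  finally show "(nrm (x + y))\<^sup>2 \<le> (nrm x + nrm y)\<^sup>2"
    by (simp add: power2_sum)
qed (use x y in auto)

lemma nrm_scale: "x \<in> V \<Longrightarrow> nrm (r *\<^sub>R x) = \<bar>r\<bar> * nrm x"
  by (simp add: nrm_def ip_simps real_sqrt_mult flip: mult.assoc)

lemma nrm_minus_commute: "x \<in> V \<Longrightarrow> y \<in> V \<Longrightarrow> nrm (x - y) = nrm (y - x)"
  using nrm_scale[of "x - y" "-1"] by simp

lemma nrm_triangle_sub:
  assumes "x \<in> V" "y \<in> V"
  shows "nrm x \<le> nrm y + nrm (x - y)"
  using nrm_triangle[of y "x - y"] assms by auto

end

text \<open>A limit is determined only up to null vectors, so completeness asserts the existence of
  some limit in \<open>V\<close>.\<close>

locale semi_hilbert = semi_inner +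
  assumes complete_seq:
    "(\<And>n. s n \<in> V) \<Longrightarrow> (\<And>e. e > 0 \<Longrightarrow> \<exists>N::nat. \<forall>m\<ge>N. \<forall>n\<ge>N. nrm (s m - s n) < e) \<Longrightarrow>
     \<exists>l\<in>V. (\<lambda>n. nrm (s n - l)) \<longlonglongrightarrow> 0"
begin

lemma continuous_functional:
  assumes F_diff: "\<And>x y. x \<in> V \<Longrightarrow> y \<in> V \<Longrightarrow> F (x - y) = F x - F y"
    and F_bound: "\<And>x. x \<in> V \<Longrightarrow> \<bar>F x\<bar> \<le> K * nrm x"
    and s: "\<And>n. s n \<in> V" and l: "l \<in> V" and lim: "(\<lambda>n. nrm (s n - l)) \<longlonglongrightarrow> 0"
  shows "(\<lambda>n. F (s n) :: real) \<longlonglongrightarrow> F l"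
proof -
  have "(\<lambda>n. F (s n) - F l) \<longlonglongrightarrow> 0"
  proof (rule Lim_null_comparison)
    show "\<forall>\<^sub>F n in sequentially. norm (F (s n) - F l) \<le> K * nrm (s n - l)"
      using F_bound[of "s _ - l"] s l by (intro always_eventually allI) (simp add: F_diff)
    show "(\<lambda>n. K * nrm (s n - l)) \<longlonglongrightarrow> 0"
      using tendsto_mult_right_zero[OF lim] by simp
  qed
  then show ?thesis by (simp add: LIM_zero_iff)
qed

lemma nrm_continuous:
  assumes s: "\<And>n. s n \<in> V" and l: "l \<in> V" and lim: "(\<lambda>n. nrm (s n - l)) \<longlonglongrightarrow> 0"
  shows "(\<lambda>n. nrm (s n)) \<longlonglongrightarrow> nrm l"
proof -
  have "(\<lambda>n. nrm (s n) - nrm l) \<longlonglongrightarrow> 0"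
  proof (rule Lim_null_comparison[OF _ lim], intro always_eventually allI)
    fix n
    show "norm (nrm (s n) - nrm l) \<le> nrm (s n - l)"
      using nrm_triangle_sub[of "s n" l] nrm_triangle_sub[of l "s n"] nrm_minus_commute[of l "s n"] s l
      by auto
  qed
  then show ?thesis by (simp add: LIM_zero_iff)
qed

text \<open>The representing vector is a minimiser of the energy \<open>ip x x - 2 * F x\<close>:
  the parallelogram law makes a minimising sequence Cauchy, and the first order condition at the
  limit is the representation. No orthogonal complement is used, so null vectors cause no
  trouble.\<close>

theorem riesz:
  assumes F_add: "\<And>x y. x \<in> V \<Longrightarrow> y \<in> V \<Longrightarrow> F (x + y) = F x + F y"
    and F_scale: "\<And>x r. x \<in> V \<Longrightarrow> F (r *\<^sub>R x) = r * F x"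
    and F_bound: "\<And>x. x \<in> V \<Longrightarrow> \<bar>F x\<bar> \<le> K * nrm x"
  shows "\<exists>r\<in>V. \<forall>x\<in>V. ip r x = F x"
proof -
  have F_diff: "F (x - y) = F x - F y" if "x \<in> V" "y \<in> V" for x y
    using F_add[of "x - y" y] that by simp
  define q where "q x = ip x x - 2 * F x" for x
  \<comment> \<open>Completing the square in \<open>nrm x\<close> bounds the energy from below, so
    its infimum is finite.\<close>
  have q_lower: "- K\<^sup>2 \<le> q x" if x: "x \<in> V" for x
  proof -
    have "0 \<le> (nrm x - K)\<^sup>2" by simp
    also have "\<dots> = ip x x - 2 * (K * nrm x) + K\<^sup>2"
      using x by (simp add: power2_diff nrm_sq)
    also have "\<dots> \<le> q x + K\<^sup>2" using F_bound[OF x] by (simp add: q_def)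
    finally show ?thesis by simp
  qed
  define m where "m = (INF x\<in>V. q x)"
  have bdd: "bdd_below (q ` V)" using q_lower by (intro bdd_belowI2)
  have m_le: "m \<le> q x" if "x \<in> V" for x
    unfolding m_def using bdd that by (rule cINF_lower)
  have "\<exists>x\<in>V. q x < m + 1 / real (Suc n)" for n
  proof -
    have "V \<noteq> {}" using mem(4) by blast
    from cINF_less_iff[OF this bdd, of "m + 1 / real (Suc n)"] show ?thesis by (simp add: m_def)
  qed
  then obtain s where sV: "\<And>n. s n \<in> V" and s: "\<And>n. q (s n) < m + 1 / real (Suc n)"
    by metis
  \<comment> \<open>The midpoint has energy at least \<open>m\<close>. By the parallelogram law the
    mean energy of the two points exceeds that of the midpoint by a quarter of the squared
    distance.\<close>
  have gap: "(nrm (s i - s j))\<^sup>2 < 2 / real (Suc i) + 2 / real (Suc j)" for i j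
  proof -
    have "4 * m \<le> 4 * q ((1/2) *\<^sub>R (s i + s j))" using m_le[of "(1/2) *\<^sub>R (s i + s j)"] sV by simp
    also have "\<dots> = 2 * q (s i) + 2 * q (s j) - (nrm (s i - s j))\<^sup>2"
      using sV by (simp add: q_def nrm_sq ip_simps F_add F_scale ip_commute[of "s j" "s i"]
          del: scaleR_add_right) (simp add: field_simps)
    finally show ?thesis using s[of i] s[of j] by (simp add: algebra_simps)
  qed
  have "\<exists>N::nat. \<forall>i\<ge>N. \<forall>j\<ge>N. nrm (s i - s j) < e" if e: "e > 0" for e
  proof -
    obtain N :: nat where N: "4 / e\<^sup>2 < N" using reals_Archimedean2 by blast
    have "4 < N * e\<^sup>2" using N e by (simp add: field_simps)
    also have "\<dots> \<le> real (Suc N) * e\<^sup>2" by (intro mult_right_mono) auto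
    finally have e2: "4 / real (Suc N) < e\<^sup>2" by (simp add: pos_divide_less_eq mult.commute)
    show ?thesis
    proof (intro exI allI impI)
      fix i j assume ij: "N \<le> i" "N \<le> j"
      have le: "2 / real (Suc k) \<le> 2 / real (Suc N)" if "N \<le> k" for k
        using that by (simp add: frac_le)
      have "(nrm (s i - s j))\<^sup>2 < e\<^sup>2" using gap[of i j] le[OF ij(1)] le[OF ij(2)] e2 by linarith
      then show "nrm (s i - s j) < e" using e by (simp add: power2_less_imp_less)
    qed
  qed
  from complete_seq[OF sV this] obtain l
    where l: "l \<in> V" and lim: "(\<lambda>n. nrm (s n - l)) \<longlonglongrightarrow> 0" by blast
  have "(\<lambda>n. (nrm (s n))\<^sup>2 - 2 * F (s n)) \<longlonglongrightarrow> (nrm l)\<^sup>2 - 2 * F l"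
    by (intro tendsto_intros nrm_continuous continuous_functional[OF F_diff F_bound] sV l lim)
  then have "(\<lambda>n. q (s n)) \<longlonglongrightarrow> q l" using sV l by (simp add: q_def nrm_sq)
  moreover have "(\<lambda>n. m + 1 / real (Suc n)) \<longlonglongrightarrow> m + 0"
    by (intro tendsto_intros LIMSEQ_Suc[OF lim_1_over_n])
  ultimately have "q l \<le> m + 0"
    by (rule LIMSEQ_le) (use s less_imp_le in blast)
  then have ql: "q l \<le> m" by simp
  have "ip l x = F x" if x: "x \<in> V" for x
  proof -
    define d where "d = ip l x - F x"
    have "q l \<le> q (l + t *\<^sub>R x)" for t using m_le[of "l + t *\<^sub>R x"] ql x l by auto
    then have nn: "0 \<le> 2 * t * d + t\<^sup>2 * ip x x" for t
      using x l by (simp add: d_def q_def ip_simps F_add F_scale ip_commute[of x l] algebra_simps power2_eq_square)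
    \<comment> \<open>Testing with \<open>t = - d / c\<close> makes the linear term beat the
      quadratic one; the summand 1 keeps the division legitimate when \<open>x\<close> is a null
      vector.\<close>
    define c where "c = ip x x + 1"
    have c: "c > 0" using ip_nonneg[OF x] by (simp add: c_def)
    have "0 \<le> 2 * (- d / c) * d + (- d / c)\<^sup>2 * ip x x" by (rule nn)
    also have "\<dots> \<le> 2 * (- d / c) * d + (- d / c)\<^sup>2 * c"
      by (intro add_left_mono mult_left_mono) (auto simp: c_def)
    also have "\<dots> = - (d\<^sup>2 / c)" using c by (simp add: power2_eq_square field_simps)
    finally have "d\<^sup>2 / c \<le> 0" by simp
    then have "d = 0" using c by (simp add: divide_le_0_iff)
    then show ?thesis by (simp add: d_def)
  qed
  with l show ?thesis by blast
qed

text \<open>With \<open>R\<close> representing the form through \<open>riesz\<close>, a solution is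
  a fixed point of \<open>T x = x - \<rho> *\<^sub>R (R x - f)\<close>, a contraction for suitable
  \<rho>. The Banach iteration is carried out by hand since \<open>nrm\<close> is not a metric, and
  a fixed point up to a null vector is enough.\<close>

theorem lax_milgram:
  assumes B_add: "\<And>x y z. x \<in> V \<Longrightarrow> y \<in> V \<Longrightarrow> z \<in> V \<Longrightarrow> B (x + y) z = B x z + B y z"
    and B_add_right: "\<And>x y z. x \<in> V \<Longrightarrow> y \<in> V \<Longrightarrow> z \<in> V \<Longrightarrow> B z (x + y) = B z x + B z y"
    and B_scale_right: "\<And>x z r. x \<in> V \<Longrightarrow> z \<in> V \<Longrightarrow> B z (r *\<^sub>R x) = r * B z x"
    and B_bound: "\<And>x y. x \<in> V \<Longrightarrow> y \<in> V \<Longrightarrow> \<bar>B x y\<bar> \<le> K * nrm x * nrm y"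
    and c: "c > 0" and coercive: "\<And>x. x \<in> V \<Longrightarrow> c * (nrm x)\<^sup>2 \<le> B x x"
    and F_add: "\<And>x y. x \<in> V \<Longrightarrow> y \<in> V \<Longrightarrow> F (x + y) = F x + F y"
    and F_scale: "\<And>x r. x \<in> V \<Longrightarrow> F (r *\<^sub>R x) = r * F x"
    and F_bound: "\<And>x. x \<in> V \<Longrightarrow> \<bar>F x\<bar> \<le> L * nrm x"
  shows "\<exists>u\<in>V. \<forall>w\<in>V. B u w = F w"
proof -
  \<comment> \<open>Enlarging the bound \<open>K\<close> to a positive number above \<open>c\<close>
    keeps the quotient \<open>c / k\<close> strictly between 0 and 1.\<close>
  define k where "k = \<bar>K\<bar> + c + 1"
  have k: "k > 0" "c < k" "K \<le> k" using c by (auto simp: k_def)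
  have B_diff: "B (x - y) z = B x z - B y z" if "x \<in> V" "y \<in> V" "z \<in> V" for x y z
    using B_add[of "x - y" y z] that by simp
  obtain f where f: "f \<in> V" "\<And>w. w \<in> V \<Longrightarrow> ip f w = F w"
    using riesz[of F L, OF F_add F_scale F_bound] by blast
  have "\<exists>r\<in>V. \<forall>w\<in>V. ip r w = B x w" if "x \<in> V" for x
    by (rule riesz[where K = "K * nrm x"]) (use that in \<open>simp_all add: B_add_right B_scale_right B_bound\<close>)
  then obtain R where R: "\<And>x. x \<in> V \<Longrightarrow> R x \<in> V"
      and ipR: "\<And>x w. x \<in> V \<Longrightarrow> w \<in> V \<Longrightarrow> ip (R x) w = B x w" by metis
  \<comment> \<open>This \<rho> minimises
    \<open>1 - 2 * \<rho> * c + \<rho>\<^sup>2 * k\<^sup>2\<close>, the squared contraction factor;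
    the minimum \<open>1 - (c / k)\<^sup>2\<close> is the square of \<theta> below.\<close>
  define \<rho> where "\<rho> = c / k\<^sup>2"
  define T where "T x = x - \<rho> *\<^sub>R (R x - f)" for x
  define \<theta> where "\<theta> = sqrt (1 - (c / k)\<^sup>2)"
  have ck: "0 < c / k" "c / k < 1" using c k by auto
  then have ck2: "(c/k)\<^sup>2 < 1" by (simp add: abs_square_less_1)
  have \<theta>: "0 \<le> \<theta>" "\<theta> < 1" using ck ck2 by (auto simp: \<theta>_def)
  have TV: "T x \<in> V" if "x \<in> V" for x using that R f by (auto simp: T_def)
  have R_le: "nrm (R x - R y) \<le> k * nrm (x - y)" if x: "x \<in> V" and y: "y \<in> V" for x y
  proof -
    let ?r = "R x - R y"
    have rV: "?r \<in> V" using R x y by auto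
    have "(nrm ?r)\<^sup>2 = B (x - y) ?r"
      unfolding nrm_sq[OF rV] ip_diff[OF R[OF x] R[OF y] rV] ipR[OF x rV] ipR[OF y rV] B_diff[OF x y rV] ..
    also have "\<dots> \<le> K * nrm (x - y) * nrm ?r"
      using B_bound[OF mem(3)[OF x y] rV] by linarith
    also have "\<dots> \<le> k * nrm (x - y) * nrm ?r"
      using k x y rV by (intro mult_right_mono) auto
    finally have "nrm ?r * nrm ?r \<le> k * nrm (x - y) * nrm ?r" by (simp add: power2_eq_square)
    moreover have "0 \<le> nrm ?r" "0 \<le> k * nrm (x - y)" using k x y rV by auto
    ultimately show ?thesis by (cases "nrm ?r = 0") simp_all
  qed
  have T_contr: "nrm (T x - T y) \<le> \<theta> * nrm (x - y)" if x: "x \<in> V" and y: "y \<in> V" for x y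
  proof (rule power2_le_imp_le)
    let ?d = "x - y" and ?r = "R x - R y"
    have dV: "?d \<in> V" and rV: "?r \<in> V" using R x y by auto
    have Rd: "ip ?r w = B ?d w" if "w \<in> V" for w
      unfolding ip_diff[OF R[OF x] R[OF y] that] ipR[OF x that] ipR[OF y that] B_diff[OF x y that] ..
    have exp: "ip (d - \<rho> *\<^sub>R r) (d - \<rho> *\<^sub>R r) = ip d d - 2 * \<rho> * ip r d + \<rho>\<^sup>2 * ip r r"
      if "d \<in> V" "r \<in> V" for d r
      using that by (simp add: ip_simps ip_commute[of d r] power2_eq_square algebra_simps)
    have "T x - T y = ?d - \<rho> *\<^sub>R ?r" by (simp add: T_def algebra_simps)
    then have "(nrm (T x - T y))\<^sup>2 = (nrm (?d - \<rho> *\<^sub>R ?r))\<^sup>2" by simp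
    also have "\<dots> = ip (?d - \<rho> *\<^sub>R ?r) (?d - \<rho> *\<^sub>R ?r)"
      by (rule nrm_sq) (use dV rV in blast)
    also have "\<dots> = ip ?d ?d - 2 * \<rho> * ip ?r ?d + \<rho>\<^sup>2 * ip ?r ?r"
      by (rule exp[OF dV rV])
    also have "\<dots> = (nrm ?d)\<^sup>2 - 2 * \<rho> * B ?d ?d + \<rho>\<^sup>2 * (nrm ?r)\<^sup>2"
      by (simp only: nrm_sq[OF dV] nrm_sq[OF rV] Rd[OF dV])
    also have "\<dots> \<le> (nrm ?d)\<^sup>2 - 2 * \<rho> * (c * (nrm ?d)\<^sup>2) + \<rho>\<^sup>2 * (k * nrm ?d)\<^sup>2"
    proof -
      have "(nrm ?r)\<^sup>2 \<le> (k * nrm ?d)\<^sup>2"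
        using R_le[OF x y] nrm_nonneg[OF rV] by (rule power_mono)
      then have "\<rho>\<^sup>2 * (nrm ?r)\<^sup>2 \<le> \<rho>\<^sup>2 * (k * nrm ?d)\<^sup>2" by (rule mult_left_mono) simp
      moreover have "2 * \<rho> * (c * (nrm ?d)\<^sup>2) \<le> 2 * \<rho> * B ?d ?d"
        using coercive[OF dV] by (rule mult_left_mono) (use c in \<open>simp add: \<rho>_def\<close>)
      ultimately show ?thesis by linarith
    qed
    also have "\<dots> = (1 - 2 * \<rho> * c + \<rho>\<^sup>2 * k\<^sup>2) * (nrm ?d)\<^sup>2"
      by (simp add: algebra_simps)
    also have "1 - 2 * \<rho> * c + \<rho>\<^sup>2 * k\<^sup>2 = 1 - (c/k)\<^sup>2"
      using k by (simp add: \<rho>_def power2_eq_square)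
    also have "1 - (c/k)\<^sup>2 = \<theta>\<^sup>2"
      unfolding \<theta>_def by (rule real_sqrt_pow2[symmetric]) (use ck2 in linarith)
    also have "\<theta>\<^sup>2 * (nrm ?d)\<^sup>2 = (\<theta> * nrm ?d)\<^sup>2" by (simp add: power_mult_distrib)
    finally show "(nrm (T x - T y))\<^sup>2 \<le> (\<theta> * nrm ?d)\<^sup>2" .
    show "0 \<le> \<theta> * nrm ?d" using \<theta> nrm_nonneg[OF dV] by simp
  qed
  define s where "s n = (T ^^ n) 0" for n
  have s_Suc: "s (Suc n) = T (s n)" for n by (simp add: s_def)
  have sV: "s n \<in> V" for n
  proof (induction n)
    case 0 show ?case by (simp add: s_def)
  qed (simp add: s_Suc TV)
  have step: "nrm (s (Suc n) - s n) \<le> \<theta> ^ n * nrm (s 1 - s 0)" for n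
  proof (induction n)
    case (Suc n)
    have "nrm (s (Suc (Suc n)) - s (Suc n)) \<le> \<theta> * nrm (s (Suc n) - s n)"
      using T_contr[OF sV[of "Suc n"] sV[of n]] by (simp only: s_Suc)
    also have "\<dots> \<le> \<theta> * (\<theta> ^ n * nrm (s 1 - s 0))" using Suc \<theta> by (intro mult_left_mono) auto
    finally show ?case by simp
  qed simp
  \<comment> \<open>The sum of the geometric series of step lengths. The factor
    \<open>1 - \<theta> ^ j\<close> in the next claim is the exact partial sum, which lets the
    induction close.\<close>
  define D where "D = nrm (s 1 - s 0) / (1 - \<theta>)"
  have dist_le: "nrm (s (n + j) - s n) \<le> \<theta> ^ n * (1 - \<theta> ^ j) * D" for n j
  proof (induction j)
    case 0
    have "nrm 0 = 0" using nrm_scale[of 0 0] by auto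
    then show ?case by simp
  next
    case (Suc j)
    have "nrm (s (n + Suc j) - s n) \<le> nrm (s (Suc (n + j)) - s (n + j)) + nrm (s (n + j) - s n)"
      using nrm_triangle[of "s (Suc (n + j)) - s (n + j)" "s (n + j) - s n"] sV by simp
    also have "\<dots> \<le> \<theta> ^ (n + j) * nrm (s 1 - s 0) + \<theta> ^ n * (1 - \<theta> ^ j) * D"
      using step[of "n + j"] Suc by linarith
    also have "nrm (s 1 - s 0) = (1 - \<theta>) * D" using \<theta> by (simp add: D_def)
    also have "\<theta> ^ (n + j) * ((1 - \<theta>) * D) + \<theta> ^ n * (1 - \<theta> ^ j) * D = \<theta> ^ n * (1 - \<theta> ^ Suc j) * D"
      by (simp add: power_add algebra_simps)
    finally show ?case .
  qed
  have D: "0 \<le> D" using \<theta> nrm_nonneg[of "s 1 - s 0"] sV by (auto simp: D_def)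
  have dist_le': "nrm (s i - s n) \<le> \<theta> ^ n * D" if "n \<le> i" for i n
  proof -
    have "nrm (s i - s n) \<le> \<theta> ^ n * (1 - \<theta> ^ (i - n)) * D" using dist_le[of n "i - n"] that by simp
    also have "\<dots> \<le> \<theta> ^ n * 1 * D" using \<theta> D by (intro mult_right_mono mult_left_mono) auto
    finally show ?thesis by simp
  qed
  have "\<exists>N::nat. \<forall>i\<ge>N. \<forall>j\<ge>N. nrm (s i - s j) < e" if e: "e > 0" for e
  proof -
    have "(\<lambda>n. \<theta> ^ n * D) \<longlonglongrightarrow> 0" using \<theta> by (intro tendsto_mult_left_zero LIMSEQ_realpow_zero)
    then have "\<forall>\<^sub>F n in sequentially. \<theta> ^ n * D < e / 2" using e by (intro order_tendstoD) auto
    then obtain N where N: "\<theta> ^ N * D < e / 2" by (auto simp: eventually_sequentially)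
    show ?thesis
    proof (intro exI allI impI)
      fix i j assume "N \<le> i" "N \<le> j"
      then have "nrm (s i - s N) < e / 2" "nrm (s N - s j) < e / 2"
        using dist_le'[of N i] dist_le'[of N j] N nrm_minus_commute[of "s N" "s j"] sV by auto
      then show "nrm (s i - s j) < e"
        using nrm_triangle[of "s i - s N" "s N - s j"] sV by auto
    qed
  qed
  from complete_seq[OF sV this] obtain u
    where u: "u \<in> V" and lim: "(\<lambda>n. nrm (s n - u)) \<longlonglongrightarrow> 0" by blast
  \<comment> \<open>The limit is compared with its image through the next iterate; both terms on the
    right tend to 0.\<close>
  have "nrm (u - T u) \<le> nrm (s (Suc n) - u) + \<theta> * nrm (s n - u)" for n
  proof -
    have "nrm (u - T u) \<le> nrm (u - s (Suc n)) + nrm (s (Suc n) - T u)"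
      using nrm_triangle[of "u - s (Suc n)" "s (Suc n) - T u"] sV u TV[OF u] by auto
    also have "nrm (u - s (Suc n)) = nrm (s (Suc n) - u)" by (rule nrm_minus_commute[OF u sV])
    also have "nrm (s (Suc n) - T u) \<le> \<theta> * nrm (s n - u)"
      unfolding s_Suc by (rule T_contr[OF sV u])
    finally show ?thesis by simp
  qed
  moreover have "(\<lambda>n. nrm (s (Suc n) - u) + \<theta> * nrm (s n - u)) \<longlonglongrightarrow> 0 + \<theta> * 0"
    using lim by (intro tendsto_intros LIMSEQ_Suc)
  ultimately have "nrm (u - T u) \<le> 0" by (intro LIMSEQ_le_const) auto
  moreover have "u - T u = \<rho> *\<^sub>R (R u - f)" by (simp add: T_def)
  moreover have "R u - f \<in> V" using R u f by auto
  moreover have "\<rho> > 0" using c k by (simp add: \<rho>_def)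
  ultimately have n0: "nrm (R u - f) = 0"
    using nrm_scale[of "R u - f" \<rho>] nrm_nonneg[of "R u - f"]
    by (auto simp: mult_le_0_iff intro: antisym)
  \<comment> \<open>\<open>R u - f\<close> may be a nonzero null vector, but by Cauchy-Schwarz it
    pairs to 0 with every \<open>w\<close>.\<close>
  have "B u w = F w" if w: "w \<in> V" for w
    using cauchy_schwarz[of "R u - f" w] n0 R u f w by (simp add: ip_diff ipR)
  with u show ?thesis by blast
qed

end

section \<open>Square integrable fields\<close>

lemma cdot_commute: "v \<odot> w = w \<odot> v"
  by (simp add: cdot_def mult.commute)

lemma cdot_add_left: "(u + v) \<odot> w = u \<odot> w + v \<odot> w"
  by (simp add: cdot_def sum.distrib algebra_simps)

lemma cdot_diff_left: "(u - v) \<odot> w = u \<odot> w - v \<odot> w"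
  by (simp add: cdot_def sum_subtractf algebra_simps)

lemma cdot_scale_left: "(a *s v) \<odot> w = a * (v \<odot> w)"
  by (simp add: cdot_def sum_distrib_left mult.assoc)

lemma cdot_add_right: "u \<odot> (v + w) = u \<odot> v + u \<odot> w"
  by (metis cdot_add_left cdot_commute)

lemma cdot_scale_right: "v \<odot> (a *s w) = a * (v \<odot> w)"
  by (metis cdot_scale_left cdot_commute)

text \<open>Links the real scaling of the abstract locales to the complex scaling in the Maxwell
  form.\<close>

lemma scaleR_eq_vector_smult: "r *\<^sub>R (v :: complex^'n) = complex_of_real r *s v"
  by (simp add: vec_eq_iff complex_eq_iff)

lemma norm_vector_smult: "norm (a *s (v :: complex^'n)) = norm a * norm v"
  by (simp add: norm_vec_def L2_set_def norm_mult power_mult_distrib real_sqrt_mult flip: sum_distrib_left)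

lemma norm_cdot_le: "norm (v \<odot> w) \<le> norm v * norm w"
proof -
  have "norm (v \<odot> w) \<le> (\<Sum>i\<in>UNIV. \<bar>norm (v $ i)\<bar> * \<bar>norm (w $ i)\<bar>)"
    unfolding cdot_def by (rule order_trans[OF norm_sum]) (simp add: norm_mult)
  also have "\<dots> \<le> norm v * norm w"
    unfolding norm_vec_def by (rule L2_set_mult_ineq)
  finally show ?thesis .
qed

lemma bounded_bilinear_cdot: "bounded_bilinear (\<odot>)"
  by standard (auto simp: cdot_add_left cdot_add_right scaleR_eq_vector_smult cdot_scale_left
      cdot_scale_right scaleR_conv_of_real norm_cdot_le intro!: exI[of _ 1])

lemma bounded_bilinear_vector_smult: "bounded_bilinear ((*s) :: complex \<Rightarrow> complex^'n \<Rightarrow> _)"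
  by standard (auto simp: vec_eq_iff algebra_simps norm_vector_smult intro!: exI[of _ 1])

lemma cnjv_nth [simp]: "cnjv v $ i = cnj (v $ i)"
  by (simp add: cnjv_def)

lemma cnjv_cnjv [simp]: "cnjv (cnjv v) = v"
  by (simp add: vec_eq_iff)

lemma cnjv_add: "cnjv (v + w) = cnjv v + cnjv w"
  by (simp add: vec_eq_iff)

lemma norm_cnjv [simp]: "norm (cnjv v) = norm v"
  by (simp add: norm_vec_def)

lemma bounded_linear_cnjv: "bounded_linear cnjv"
  by standard (auto simp: cnjv_add vec_eq_iff intro!: exI[of _ 1])

lemma cnj_cdot: "cnj (v \<odot> w) = cnjv v \<odot> cnjv w"
  by (simp add: cdot_def)

lemma cdot_cnjv_self: "v \<odot> cnjv v = complex_of_real ((norm v)\<^sup>2)"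
proof -
  have "(norm v)\<^sup>2 = (\<Sum>i\<in>UNIV. (norm (v $ i))\<^sup>2)"
    by (simp add: norm_vec_def L2_set_def sum_nonneg)
  then show ?thesis
    by (simp only: cdot_def cnjv_nth complex_norm_square[symmetric] of_real_sum)
qed

lemma borel_measurable_bilinear:
  fixes f :: "'a \<Rightarrow> 'b::euclidean_space" and g :: "'a \<Rightarrow> 'c::euclidean_space"
    and h :: "'b \<Rightarrow> 'c \<Rightarrow> 'd::real_normed_vector"
  assumes "bounded_bilinear h" and [measurable]: "f \<in> borel_measurable M" "g \<in> borel_measurable M"
  shows "(\<lambda>x. h (f x) (g x)) \<in> borel_measurable M"
  by (rule borel_measurable_continuous_Pair[OF assms(2,3)])
     (intro bounded_bilinear.continuous_on[OF assms(1)] continuous_intros)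

lemmas borel_measurable_cdot [measurable (raw)] = borel_measurable_bilinear[OF bounded_bilinear_cdot]
lemmas borel_measurable_vector_smult [measurable (raw)] =
  borel_measurable_bilinear[OF bounded_bilinear_vector_smult]

lemma borel_measurable_cnjv [measurable (raw)]:
  "f \<in> borel_measurable M \<Longrightarrow> (\<lambda>x. cnjv (f x)) \<in> borel_measurable M"
  by (rule measurable_compose[OF _ borel_measurable_continuous_onI[OF linear_continuous_on[OF bounded_linear_cnjv]]])

section \<open>Membership in the space of square integrable fields\<close>

lemma L2_measurable [measurable_dest]: "v \<in> L2 \<Omega> \<Longrightarrow> v \<in> borel_measurable (lebesgue_on \<Omega>)"
  by (simp add: L2_def)

lemma L2_integrable: "v \<in> L2 \<Omega> \<Longrightarrow> integrable (lebesgue_on \<Omega>) (\<lambda>x. (norm (v x))\<^sup>2)"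
  by (simp add: L2_def)

lemma L2_dominated:
  assumes [measurable]: "w \<in> borel_measurable (lebesgue_on \<Omega>)" and v: "v \<in> L2 \<Omega>"
    and le: "AE x in lebesgue_on \<Omega>. norm (w x) \<le> C * norm (v x)"
  shows "w \<in> L2 \<Omega>"
proof -
  have "integrable (lebesgue_on \<Omega>) (\<lambda>x. (norm (w x))\<^sup>2)"
  proof (rule Bochner_Integration.integrable_bound)
    show "integrable (lebesgue_on \<Omega>) (\<lambda>x. C\<^sup>2 * (norm (v x))\<^sup>2)"
      using L2_integrable[OF v] by simp
    show "AE x in lebesgue_on \<Omega>. norm ((norm (w x))\<^sup>2) \<le> norm (C\<^sup>2 * (norm (v x))\<^sup>2)"
      using le by eventually_elim (auto simp flip: power_mult_distrib intro!: power_mono)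
  qed measurable
  then show ?thesis by (simp add: L2_def)
qed

lemma L2_bounded:
  assumes "\<Omega> \<in> lmeasurable" and [measurable]: "w \<in> borel_measurable (lebesgue_on \<Omega>)"
    and le: "AE x in lebesgue_on \<Omega>. norm (w x) \<le> C"
  shows "w \<in> L2 \<Omega>"
proof -
  interpret finite_measure "lebesgue_on \<Omega>"
    using assms(1) by (rule finite_measure_lebesgue_on)
  have "integrable (lebesgue_on \<Omega>) (\<lambda>x. (norm (w x))\<^sup>2)"
    by (rule integrable_const_bound[of _ "C\<^sup>2"]) (use le in \<open>auto elim!: eventually_mono intro!: power_mono\<close>)
  then show ?thesis by (simp add: L2_def)
qed

text \<open>On a set of finite measure \<open>1 + (norm (v x))\<^sup>2\<close> is an integrable
  majorant. Both the extraction of convergent subsequences and the fundamental lemma operate on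
  integrable fields.\<close>

lemma L2_imp_integrable:
  assumes "\<Omega> \<in> lmeasurable" and v: "v \<in> L2 \<Omega>"
  shows "integrable (lebesgue_on \<Omega>) v"
proof (rule Bochner_Integration.integrable_bound)
  interpret finite_measure "lebesgue_on \<Omega>"
    using assms(1) by (rule finite_measure_lebesgue_on)
  show "integrable (lebesgue_on \<Omega>) (\<lambda>x. 1 + (norm (v x))\<^sup>2)"
    by (simp add: L2_integrable[OF v])
  show "v \<in> borel_measurable (lebesgue_on \<Omega>)" by (rule L2_measurable[OF v])
  have "norm (v x) \<le> 1 + (norm (v x))\<^sup>2" for x
    using sum_squares_bound[of 1 "norm (v x)"] norm_ge_zero[of "v x"] unfolding power_one by linarith
  then show "AE x in lebesgue_on \<Omega>. norm (v x) \<le> norm (1 + (norm (v x))\<^sup>2)"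
    by (intro AE_I2) simp
qed

lemma L2_integrable_cdot:
  assumes v: "v \<in> L2 \<Omega>" and w: "w \<in> L2 \<Omega>"
  shows "integrable (lebesgue_on \<Omega>) (\<lambda>x. v x \<odot> w x)"
proof (rule Bochner_Integration.integrable_bound)
  show "integrable (lebesgue_on \<Omega>) (\<lambda>x. (norm (v x))\<^sup>2 + (norm (w x))\<^sup>2)"
    using L2_integrable[OF v] L2_integrable[OF w] by simp
  show "(\<lambda>x. v x \<odot> w x) \<in> borel_measurable (lebesgue_on \<Omega>)" using v w by measurable
  have "norm (v x \<odot> w x) \<le> (norm (v x))\<^sup>2 + (norm (w x))\<^sup>2" for x
    using norm_cdot_le[of "v x" "w x"] sum_squares_bound[of "norm (v x)" "norm (w x)"]
      mult_nonneg_nonneg[OF norm_ge_zero norm_ge_zero, of "v x" "w x"] by linarith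
  then show "AE x in lebesgue_on \<Omega>. norm (v x \<odot> w x) \<le> norm ((norm (v x))\<^sup>2 + (norm (w x))\<^sup>2)"
    by simp
qed

lemma L2_cnjv: "v \<in> L2 \<Omega> \<Longrightarrow> (\<lambda>x. cnjv (v x)) \<in> L2 \<Omega>"
  by (rule L2_dominated[of _ _ v 1]) auto

lemma L2_mult:
  assumes [measurable]: "\<kappa> \<in> borel_measurable (lebesgue_on \<Omega>)" "v \<in> L2 \<Omega>"
    and "AE x in lebesgue_on \<Omega>. norm (\<kappa> x) \<le> C"
  shows "(\<lambda>x. \<kappa> x *s v x) \<in> L2 \<Omega>"
  by (rule L2_dominated[of _ _ v C]) (use assms in \<open>auto simp: norm_vector_smult elim!: eventually_mono intro!: mult_right_mono\<close>)

lemma L2_smult: "v \<in> L2 \<Omega> \<Longrightarrow> (\<lambda>x. a *s v x) \<in> L2 \<Omega>"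
  by (rule L2_mult[of "\<lambda>_. a" _ _ "norm a"]) auto

lemma L2_add:
  assumes v: "v \<in> L2 \<Omega>" and w: "w \<in> L2 \<Omega>"
  shows "(\<lambda>x. v x + w x) \<in> L2 \<Omega>"
proof -
  have "integrable (lebesgue_on \<Omega>) (\<lambda>x. (norm (v x + w x))\<^sup>2)"
  proof (rule Bochner_Integration.integrable_bound)
    show "integrable (lebesgue_on \<Omega>) (\<lambda>x. 2 * (norm (v x))\<^sup>2 + 2 * (norm (w x))\<^sup>2)"
      using L2_integrable[OF v] L2_integrable[OF w] by simp
    show "(\<lambda>x. (norm (v x + w x))\<^sup>2) \<in> borel_measurable (lebesgue_on \<Omega>)" using v w by measurable
    have "(norm (v x + w x))\<^sup>2 \<le> 2 * (norm (v x))\<^sup>2 + 2 * (norm (w x))\<^sup>2" for x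
    proof -
      have "(norm (v x + w x))\<^sup>2 \<le> (norm (v x) + norm (w x))\<^sup>2"
        by (intro power_mono norm_triangle_ineq) auto
      then show ?thesis
        using sum_squares_bound[of "norm (v x)" "norm (w x)"] by (simp add: power2_sum)
    qed
    then show "AE x in lebesgue_on \<Omega>. norm ((norm (v x + w x))\<^sup>2) \<le> norm (2 * (norm (v x))\<^sup>2 + 2 * (norm (w x))\<^sup>2)"
      by simp
  qed
  then show ?thesis using L2_measurable[OF v] L2_measurable[OF w] by (simp add: L2_def)
qed

lemma L2_diff: "v \<in> L2 \<Omega> \<Longrightarrow> w \<in> L2 \<Omega> \<Longrightarrow> (\<lambda>x. v x - w x) \<in> L2 \<Omega>"
  using L2_add[of v \<Omega> "\<lambda>x. (-1) *s w x"] L2_smult[of w \<Omega> "-1"]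
  by (simp add: vector_sneg_minus1[symmetric])

lemma subspace_L2: "subspace (L2 \<Omega>)"
proof -
  have "(\<lambda>x. 0) \<in> L2 \<Omega>" by (simp add: L2_def)
  then show ?thesis
    by (auto simp: subspace_def func_zero func_plus scaleR_fun_def scaleR_eq_vector_smult L2_add L2_smult)
qed

section \<open>The inner product and the semi-norm of square integrable fields\<close>

lemma l2_inner_commute: "l2_inner \<Omega> v w = cnj (l2_inner \<Omega> w v)"
  unfolding l2_inner_def Bochner_Integration.integral_cnj[symmetric]
  by (simp add: cnj_cdot cdot_commute)

lemma l2_inner_add_left:
  "u \<in> L2 \<Omega> \<Longrightarrow> v \<in> L2 \<Omega> \<Longrightarrow> w \<in> L2 \<Omega> \<Longrightarrow>
   l2_inner \<Omega> (\<lambda>x. u x + v x) w = l2_inner \<Omega> u w + l2_inner \<Omega> v w"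
  by (simp add: l2_inner_def cdot_add_left L2_integrable_cdot L2_cnjv)

lemma l2_inner_diff_left:
  "u \<in> L2 \<Omega> \<Longrightarrow> v \<in> L2 \<Omega> \<Longrightarrow> w \<in> L2 \<Omega> \<Longrightarrow>
   l2_inner \<Omega> (\<lambda>x. u x - v x) w = l2_inner \<Omega> u w - l2_inner \<Omega> v w"
  by (simp add: l2_inner_def cdot_diff_left L2_integrable_cdot L2_cnjv)

lemma l2_inner_smult_left: "l2_inner \<Omega> (\<lambda>x. a *s v x) w = a * l2_inner \<Omega> v w"
  by (simp add: l2_inner_def cdot_scale_left)

lemma l2_inner_add_right:
  "u \<in> L2 \<Omega> \<Longrightarrow> v \<in> L2 \<Omega> \<Longrightarrow> w \<in> L2 \<Omega> \<Longrightarrow>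
   l2_inner \<Omega> w (\<lambda>x. u x + v x) = l2_inner \<Omega> w u + l2_inner \<Omega> w v"
  by (simp add: l2_inner_commute[of _ w] l2_inner_add_left)

lemma l2_inner_smult_right: "l2_inner \<Omega> v (\<lambda>x. a *s w x) = cnj a * l2_inner \<Omega> v w"
  by (simp add: l2_inner_commute[of _ v] l2_inner_smult_left)

lemma l2_inner_cong_AE:
  assumes "AE x in lebesgue_on \<Omega>. v x = v' x" "AE x in lebesgue_on \<Omega>. w x = w' x"
    and [measurable]: "v \<in> borel_measurable (lebesgue_on \<Omega>)" "v' \<in> borel_measurable (lebesgue_on \<Omega>)"
    "w \<in> borel_measurable (lebesgue_on \<Omega>)" "w' \<in> borel_measurable (lebesgue_on \<Omega>)"
  shows "l2_inner \<Omega> v w = l2_inner \<Omega> v' w'"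
  unfolding l2_inner_def by (rule integral_cong_AE) (use assms(1,2) in auto)

lemma l2_norm_nonneg [simp]: "0 \<le> l2_norm \<Omega> v"
  by (simp add: l2_norm_def integral_nonneg)

lemma l2_inner_self: "l2_inner \<Omega> v v = complex_of_real ((l2_norm \<Omega> v)\<^sup>2)"
  by (simp add: l2_inner_def l2_norm_def cdot_cnjv_self integral_nonneg flip: integral_complex_of_real of_real_power)

text \<open>The real part of the complex inner product gives the real structure to which the locale
  applies, and it induces the same semi-norm.\<close>

lemma semi_inner_L2: "semi_inner (L2 \<Omega>) (\<lambda>v w. Re (l2_inner \<Omega> v w))"
proof
  show "Re (l2_inner \<Omega> v w) = Re (l2_inner \<Omega> w v)" for v w
    using l2_inner_commute[of \<Omega> v w] by simp
qed (auto simp: subspace_L2 func_plus scaleR_fun_def scaleR_eq_vector_smult l2_inner_add_left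
    l2_inner_smult_left l2_inner_self)

lemma nrm_L2: "semi_inner.nrm (\<lambda>v w. Re (l2_inner \<Omega> v w)) = l2_norm \<Omega>"
  by (intro ext, subst semi_inner.nrm_def[OF semi_inner_L2])
     (simp only: l2_inner_self Re_complex_of_real real_sqrt_abs abs_of_nonneg l2_norm_nonneg)

interpretation l2: semi_inner "L2 \<Omega>" "\<lambda>v w. Re (l2_inner \<Omega> v w)"
  rewrites "semi_inner.nrm (\<lambda>v w. Re (l2_inner \<Omega> v w)) = l2_norm \<Omega>"
  by ((rule semi_inner_L2 nrm_L2)+)

lemma l2_norm_smult: "l2_norm \<Omega> (\<lambda>x. a *s v x) = norm a * l2_norm \<Omega> v"
  by (simp add: l2_norm_def norm_vector_smult power_mult_distrib real_sqrt_mult)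

text \<open>The real Cauchy-Schwarz inequality controls only the real part. Multiplying
  \<open>v\<close> by a unimodular \<open>u\<close> that turns the product into its modulus makes
  the real part the whole.\<close>

lemma norm_l2_inner_le:
  assumes "v \<in> L2 \<Omega>" "w \<in> L2 \<Omega>"
  shows "norm (l2_inner \<Omega> v w) \<le> l2_norm \<Omega> v * l2_norm \<Omega> w"
proof -
  obtain u where u: "norm u = 1" "u * l2_inner \<Omega> v w = norm (l2_inner \<Omega> v w)"
  proof (cases "l2_inner \<Omega> v w = 0")
    case False
    then show ?thesis
      by (intro that[of "cnj (l2_inner \<Omega> v w) / norm (l2_inner \<Omega> v w)"])
         (auto simp: norm_divide field_simps complex_norm_square[symmetric] power2_eq_square)
  qed (use that[of 1] in auto)
  have "norm (l2_inner \<Omega> v w) = Re (l2_inner \<Omega> (\<lambda>x. u *s v x) w)"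
    using u by (simp add: l2_inner_smult_left)
  also have "\<dots> \<le> l2_norm \<Omega> (\<lambda>x. u *s v x) * l2_norm \<Omega> w"
    using l2.cauchy_schwarz[OF L2_smult[OF assms(1), of u] assms(2)] by simp
  finally show ?thesis using u by (simp add: l2_norm_smult)
qed

lemma l2_norm_zero_AE:
  assumes "v \<in> L2 \<Omega>" "l2_norm \<Omega> v = 0"
  shows "AE x in lebesgue_on \<Omega>. v x = 0"
proof -
  have "AE x in lebesgue_on \<Omega>. (norm (v x))\<^sup>2 = 0"
    using assms integral_nonneg_eq_0_iff_AE[OF L2_integrable[OF assms(1)]] by (simp add: l2_norm_def)
  then show ?thesis by simp
qed

lemma l2_norm_mono_AE:
  assumes "v \<in> L2 \<Omega>" "w \<in> L2 \<Omega>" "0 \<le> C" "AE x in lebesgue_on \<Omega>. norm (w x) \<le> C * norm (v x)"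
  shows "l2_norm \<Omega> w \<le> C * l2_norm \<Omega> v"
proof -
  have "(LINT x|lebesgue_on \<Omega>. (norm (w x))\<^sup>2) \<le> (LINT x|lebesgue_on \<Omega>. C\<^sup>2 * (norm (v x))\<^sup>2)"
  proof (rule integral_mono_AE)
    show "AE x in lebesgue_on \<Omega>. (norm (w x))\<^sup>2 \<le> C\<^sup>2 * (norm (v x))\<^sup>2"
      using assms(4) by eventually_elim (simp add: power_mono flip: power_mult_distrib)
  qed (simp_all add: L2_integrable assms(1,2))
  then have "l2_norm \<Omega> w \<le> sqrt (C\<^sup>2 * (LINT x|lebesgue_on \<Omega>. (norm (v x))\<^sup>2))"
    unfolding l2_norm_def by (intro real_sqrt_le_mono) simp
  then show ?thesis using assms(3) by (simp add: l2_norm_def real_sqrt_mult)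
qed

text \<open>The Riesz-Fischer argument: finite measure turns a Cauchy sequence in the square mean
  into one in the mean, a subsequence then converges almost everywhere, and Fatou's lemma makes the
  whole sequence converge in the square mean.\<close>

theorem semi_hilbert_L2:
  assumes \<Omega>: "\<Omega> \<in> lmeasurable"
  shows "semi_hilbert (L2 \<Omega>) (\<lambda>v w. Re (l2_inner \<Omega> v w))"
proof (intro semi_hilbert.intro semi_inner_L2 semi_hilbert_axioms.intro, unfold nrm_L2)
  let ?M = "lebesgue_on \<Omega>"
  interpret finite_measure ?M
    using \<Omega> by (rule finite_measure_lebesgue_on)
  fix s :: "nat \<Rightarrow> field"
  assume s: "\<And>n. s n \<in> L2 \<Omega>"
  assume C: "\<And>e. e > 0 \<Longrightarrow> \<exists>N. \<forall>m\<ge>N. \<forall>n\<ge>N. l2_norm \<Omega> (s m - s n) < e"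
  have sm [measurable]: "\<And>n. s n \<in> borel_measurable ?M" using s by (rule L2_measurable)
  have sq: "(LINT x|?M. (norm (s i x - s j x))\<^sup>2) = (l2_norm \<Omega> (s i - s j))\<^sup>2" for i j
    by (simp add: l2_norm_def integral_nonneg)
  have int: "integrable ?M (\<lambda>x. norm (v x))" "integrable ?M v" if "v \<in> L2 \<Omega>" for v
    using L2_imp_integrable[OF \<Omega> that] by auto
  obtain r where r: "strict_mono r" and AEC: "AE x in ?M. Cauchy (\<lambda>i. s (r i) x)"
  proof (rule cauchy_L1_AE_cauchy_subseq[of ?M s])
    show "integrable ?M (s n)" for n using int s by blast
    fix e :: real assume e: "e > 0"
    define m where "m = measure ?M (space ?M)"
    have m: "0 \<le> m" by (simp add: m_def)
    \<comment> \<open>The parameter of Young's inequality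
      \<open>s \<le> d / 2 + s\<^sup>2 / (2 * d)\<close>: the constant term integrates to at most
      \<open>e / 2\<close>, and squared distances below \<open>e * d\<close> make the other term
      less than \<open>e / 2\<close>. The 1 in the denominator allows \<open>m = 0\<close>.\<close>
    define d where "d = e / (m + 1)"
    have d: "d > 0" using e m by (simp add: d_def)
    obtain N where N: "\<And>i j. i \<ge> N \<Longrightarrow> j \<ge> N \<Longrightarrow> l2_norm \<Omega> (s i - s j) < sqrt (e * d)"
      using C[of "sqrt (e * d)"] e d by auto
    show "\<exists>N. \<forall>i\<ge>N. \<forall>j\<ge>N. LINT x|?M. norm (s i x - s j x) < e"
    proof (intro exI allI impI)
      fix i j assume ij: "N \<le> i" "N \<le> j"
      have D: "(\<lambda>x. s i x - s j x) \<in> L2 \<Omega>" using s by (intro L2_diff)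
      have "(l2_norm \<Omega> (s i - s j))\<^sup>2 < (sqrt (e * d))\<^sup>2"
        using N[OF ij] by (intro power_strict_mono) (auto simp: l2_norm_def integral_nonneg)
      then have l: "(l2_norm \<Omega> (s i - s j))\<^sup>2 < e * d" using e d by simp
      have "(LINT x|?M. norm (s i x - s j x)) \<le> (LINT x|?M. d / 2 + (norm (s i x - s j x))\<^sup>2 / (2 * d))"
      proof (rule integral_mono)
        fix x
        have "0 \<le> (norm (s i x - s j x) - d)\<^sup>2" by simp
        then show "norm (s i x - s j x) \<le> d / 2 + (norm (s i x - s j x))\<^sup>2 / (2 * d)"
          using d by (simp add: field_simps power2_eq_square)
      qed (use int[OF D] L2_integrable[OF D] in auto)
      also have "\<dots> = d / 2 * m + (l2_norm \<Omega> (s i - s j))\<^sup>2 / (2 * d)"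
        using L2_integrable[OF D] by (simp add: sq m_def)
      also have "\<dots> < d / 2 * m + e * d / (2 * d)"
        using l d by (intro add_strict_left_mono divide_strict_right_mono) auto
      also have "\<dots> = d / 2 * m + e / 2" using d by simp
      also have "d / 2 * m \<le> e / 2" using e m by (simp add: d_def field_simps)
      finally show "LINT x|?M. norm (s i x - s j x) < e" by simp
    qed
  qed
  define l where "l x = lim (\<lambda>i. s (r i) x)" for x
  have l_meas [measurable]: "l \<in> borel_measurable ?M"
    unfolding l_def by measurable
  have lim: "AE x in ?M. (\<lambda>i. s (r i) x) \<longlonglongrightarrow> l x"
    using AEC by eventually_elim (simp add: l_def Cauchy_convergent convergent_LIMSEQ_iff[symmetric])
  \<comment> \<open>For fixed \<open>n\<close>, Fatou is applied along the subsequence index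
    \<open>i\<close>. Integrability of the squared difference comes out together with its
    bound.\<close>
  have close: "\<exists>N. \<forall>n\<ge>N. (\<lambda>x. s n x - l x) \<in> L2 \<Omega> \<and> l2_norm \<Omega> (s n - l) \<le> e" if e: "e > 0" for e
  proof -
    obtain N where N: "\<And>i j. i \<ge> N \<Longrightarrow> j \<ge> N \<Longrightarrow> l2_norm \<Omega> (s i - s j) < e"
      using C[OF e] by blast
    show ?thesis
    proof (intro exI allI impI)
      fix n assume n: "N \<le> n"
      have "(\<integral>\<^sup>+x. ennreal ((norm (s n x - l x))\<^sup>2) \<partial>?M)
          = (\<integral>\<^sup>+x. liminf (\<lambda>i. ennreal ((norm (s n x - s (r i) x))\<^sup>2)) \<partial>?M)"
      proof (rule nn_integral_cong_AE, use lim in eventually_elim)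
        fix x assume "(\<lambda>i. s (r i) x) \<longlonglongrightarrow> l x"
        then have "(\<lambda>i. ennreal ((norm (s n x - s (r i) x))\<^sup>2)) \<longlonglongrightarrow> ennreal ((norm (s n x - l x))\<^sup>2)"
          by (intro tendsto_intros)
        then show "ennreal ((norm (s n x - l x))\<^sup>2) = liminf (\<lambda>i. ennreal ((norm (s n x - s (r i) x))\<^sup>2))"
          by (rule lim_imp_Liminf[OF sequentially_bot, symmetric])
      qed
      also have "\<dots> \<le> liminf (\<lambda>i. \<integral>\<^sup>+x. ennreal ((norm (s n x - s (r i) x))\<^sup>2) \<partial>?M)"
        by (rule nn_integral_liminf) measurable
      also have "\<dots> \<le> ennreal (e\<^sup>2)"
      proof (rule Liminf_le)
        show "\<forall>\<^sub>F i in sequentially. (\<integral>\<^sup>+x. ennreal ((norm (s n x - s (r i) x))\<^sup>2) \<partial>?M) \<le> ennreal (e\<^sup>2)"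
          using eventually_ge_at_top[of N]
        proof eventually_elim
          fix i assume i: "N \<le> i"
          then have "N \<le> r i" using seq_suble[OF r, of i] by simp
          then have le: "(l2_norm \<Omega> (s n - s (r i)))\<^sup>2 \<le> e\<^sup>2"
            using N[OF n, of "r i"] by (intro power_mono) (auto simp: l2_norm_def integral_nonneg)
          have "(\<integral>\<^sup>+x. ennreal ((norm (s n x - s (r i) x))\<^sup>2) \<partial>?M)
              = ennreal (LINT x|?M. (norm (s n x - s (r i) x))\<^sup>2)"
            using L2_integrable[OF L2_diff[OF s s]] by (intro nn_integral_eq_integral) auto
          then show "(\<integral>\<^sup>+x. ennreal ((norm (s n x - s (r i) x))\<^sup>2) \<partial>?M) \<le> ennreal (e\<^sup>2)"
            using le by (simp add: sq ennreal_leI)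
        qed
      qed simp
      finally have fin: "(\<integral>\<^sup>+x. ennreal ((norm (s n x - l x))\<^sup>2) \<partial>?M) \<le> ennreal (e\<^sup>2)" .
      then have I: "integrable ?M (\<lambda>x. (norm (s n x - l x))\<^sup>2)"
        by (intro integrableI_nonneg) (auto simp: le_less_trans[OF _ ennreal_less_top])
      then have "ennreal (LINT x|?M. (norm (s n x - l x))\<^sup>2) \<le> ennreal (e\<^sup>2)"
        using fin by (subst (asm) nn_integral_eq_integral) auto
      then have "(LINT x|?M. (norm (s n x - l x))\<^sup>2) \<le> e\<^sup>2" by simp
      then have "l2_norm \<Omega> (s n - l) \<le> sqrt (e\<^sup>2)"
        unfolding l2_norm_def by (intro real_sqrt_le_mono) simp
      then show "(\<lambda>x. s n x - l x) \<in> L2 \<Omega> \<and> l2_norm \<Omega> (s n - l) \<le> e"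
        using I e by (simp add: L2_def)
    qed
  qed
  obtain N where "(\<lambda>x. s N x - l x) \<in> L2 \<Omega>" using close[of 1] by auto
  then have "(\<lambda>x. s N x - (s N x - l x)) \<in> L2 \<Omega>" by (rule L2_diff[OF s])
  then have lL2: "l \<in> L2 \<Omega>" by simp
  have "(\<lambda>n. l2_norm \<Omega> (s n - l)) \<longlonglongrightarrow> 0"
  proof (rule LIMSEQ_I)
    fix e :: real assume "e > 0"
    then obtain N where "\<forall>n\<ge>N. l2_norm \<Omega> (s n - l) \<le> e / 2" using close[of "e / 2"] by auto
    then show "\<exists>N. \<forall>n\<ge>N. norm (l2_norm \<Omega> (s n - l) - 0) < e"
      using \<open>e > 0\<close> by (intro exI[of _ N]) (auto simp: l2_norm_def integral_nonneg intro: le_less_trans)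
  qed
  with lL2 show "\<exists>l\<in>L2 \<Omega>. (\<lambda>n. l2_norm \<Omega> (s n - l)) \<longlonglongrightarrow> 0" by auto
qed

section \<open>Smooth bump functions and the fundamental lemma\<close>

lemma Ck_SucI:
  assumes "\<And>x. (f has_derivative D x) (at x)" "\<And>v. Ck n (\<lambda>x. D x v)"
  shows "Ck (Suc n) f"
proof -
  have "frechet_derivative f (at x) = D x" for x
    using frechet_derivative_at[OF assms(1)] by simp
  then show ?thesis using assms by (auto simp: differentiable_def)
qed

lemma Ck_SucE:
  assumes "Ck (Suc n) f"
  obtains D where "\<And>x. (f has_derivative D x) (at x)" "\<And>v. Ck n (\<lambda>x. D x v)"
  using assms that[of "\<lambda>x. frechet_derivative f (at x)"] by (auto simp: frechet_derivative_works)

lemma Ck_pred: "Ck (Suc n) f \<Longrightarrow> Ck n f"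
proof (induction n arbitrary: f)
  case 0
  then show ?case
    by (auto intro!: differentiable_imp_continuous_within continuous_at_imp_continuous_on)
next
  case (Suc n)
  from Suc.prems obtain D where "\<And>x. (f has_derivative D x) (at x)" "\<And>v. Ck (Suc n) (\<lambda>x. D x v)"
    by (rule Ck_SucE) blast
  then show ?case by (intro Ck_SucI[of f D n] Suc.IH)
qed

lemma Ck_bounded_linear: "bounded_linear L \<Longrightarrow> Ck n f \<Longrightarrow> Ck n (\<lambda>x. L (f x))"
proof (induction n arbitrary: f)
  case 0
  then show ?case by (simp add: bounded_linear.continuous_on)
next
  case (Suc n)
  from Suc.prems(2) obtain D where D: "\<And>x. (f has_derivative D x) (at x)" "\<And>v. Ck n (\<lambda>x. D x v)"
    by (rule Ck_SucE) blast
  show ?case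
    by (rule Ck_SucI[of _ "\<lambda>x v. L (D x v)"])
       (intro bounded_linear.has_derivative[OF Suc.prems(1) D(1)] Suc.IH[OF Suc.prems(1) D(2)])+
qed

lemma Ck_add: "Ck n f \<Longrightarrow> Ck n g \<Longrightarrow> Ck n (\<lambda>x. f x + g x)"
proof (induction n arbitrary: f g)
  case 0
  then show ?case by (simp add: continuous_on_add)
next
  case (Suc n)
  from Suc.prems(1) obtain D where D: "\<And>x. (f has_derivative D x) (at x)" "\<And>v. Ck n (\<lambda>x. D x v)"
    by (rule Ck_SucE) blast
  from Suc.prems(2) obtain E where E: "\<And>x. (g has_derivative E x) (at x)" "\<And>v. Ck n (\<lambda>x. E x v)"
    by (rule Ck_SucE) blast
  show ?case
    by (rule Ck_SucI[of _ "\<lambda>x v. D x v + E x v"]) (use D E Suc.IH in \<open>auto intro: has_derivative_add\<close>)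
qed

lemma Ck_mult:
  fixes f g :: "real^3 \<Rightarrow> real"
  shows "Ck n f \<Longrightarrow> Ck n g \<Longrightarrow> Ck n (\<lambda>x. f x * g x)"
proof (induction n arbitrary: f g)
  case 0
  then show ?case by (simp add: continuous_on_mult)
next
  case (Suc n)
  from Suc.prems(1) obtain D where D: "\<And>x. (f has_derivative D x) (at x)" "\<And>v. Ck n (\<lambda>x. D x v)"
    by (rule Ck_SucE) blast
  from Suc.prems(2) obtain E where E: "\<And>x. (g has_derivative E x) (at x)" "\<And>v. Ck n (\<lambda>x. E x v)"
    by (rule Ck_SucE) blast
  show ?case
  proof (rule Ck_SucI)
    show "((\<lambda>x. f x * g x) has_derivative (\<lambda>v. f x * E x v + D x v * g x)) (at x)" for x
      using D(1) E(1) by (rule has_derivative_mult)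
    \<comment> \<open>The product rule leaves undifferentiated factors, which have one order more
      than required; \<open>Ck_pred\<close> lowers them.\<close>
    show "Ck n (\<lambda>x. f x * E x v + D x v * g x)" for v
      using D(2) E(2) Suc.prems[THEN Ck_pred] by (intro Ck_add Suc.IH)
  qed
qed

lemma Ck_const: "Ck n (\<lambda>x. c)"
proof (induction n arbitrary: c)
  case (Suc n)
  show ?case by (rule Ck_SucI[of _ "\<lambda>x v. 0"]) (use Suc in auto)
qed simp

lemma Ck_prod:
  fixes f :: "'i \<Rightarrow> real^3 \<Rightarrow> real"
  shows "finite A \<Longrightarrow> (\<And>i. i \<in> A \<Longrightarrow> Ck n (f i)) \<Longrightarrow> Ck n (\<lambda>x. \<Prod>i\<in>A. f i x)"
  by (induction A rule: finite_induct) (auto simp: Ck_const Ck_mult)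

text \<open>Closed under differentiation, which makes the smoothness of \<open>exp (-1/t)\<close> an induction.\<close>

definition flat_exp :: "real poly \<Rightarrow> real \<Rightarrow> real" where
  "flat_exp q t = (if t > 0 then poly q (1 / t) * exp (- (1 / t)) else 0)"

lemma poly_times_exp_tendsto_0: "((\<lambda>s::real. poly q s * exp (- s)) \<longlongrightarrow> 0) at_top"
proof -
  have "((\<lambda>s. \<Sum>i\<le>degree q. coeff q i * (s ^ i / exp s)) \<longlongrightarrow> (\<Sum>i\<le>degree q. coeff q i * 0)) at_top"
    by (intro tendsto_intros tendsto_power_div_exp_0)
  then show ?thesis
    by (simp add: poly_altdef sum_distrib_right exp_minus divide_inverse mult.assoc)
qed

text \<open>With s = 1/t the chain rule gives the factor -1/t^2, so q(s) exp(-s) has derivative s^2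
  (q - q')(s) exp(-s) with respect to t; \<open>[:0, 0, 1:]\<close> is the polynomial s^2. At 0 both
  one-sided difference quotients tend to 0.\<close>

lemma flat_exp_derivative:
  "(flat_exp q has_real_derivative flat_exp ([:0, 0, 1:] * (q - pderiv q)) t) (at t)"
proof -
  consider "t > 0" | "t < 0" | "t = 0" by linarith
  then show ?thesis
  proof cases
    case 1
    have "((\<lambda>t. poly q (1 / t) * exp (- (1 / t))) has_real_derivative
        flat_exp ([:0, 0, 1:] * (q - pderiv q)) t) (at t)"
      using 1 by (auto intro!: derivative_eq_intros DERIV_chain2[OF poly_DERIV]
          simp: flat_exp_def field_simps power2_eq_square)
    then show ?thesis
      by (rule has_field_derivative_transform_within_open[where S = "{0<..}"])
         (use 1 in \<open>auto simp: flat_exp_def\<close>)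
  next
    case 2
    have "((\<lambda>t. 0) has_real_derivative flat_exp ([:0, 0, 1:] * (q - pderiv q)) t) (at t)"
      using 2 by (simp add: flat_exp_def)
    then show ?thesis
      by (rule has_field_derivative_transform_within_open[where S = "{..<0}"])
         (use 2 in \<open>auto simp: flat_exp_def\<close>)
  next
    case 3
    have "((\<lambda>h. flat_exp q h / h) \<longlongrightarrow> 0) (at_right 0)"
    proof -
      \<comment> \<open>Dividing by \<open>h\<close> multiplies the polynomial by its variable 1/h,
        which is the effect of \<open>pCons 0\<close>.\<close>
      have "((\<lambda>h::real. poly (pCons 0 q) (inverse h) * exp (- inverse h)) \<longlongrightarrow> 0) (at_right 0)"
        by (rule filterlim_compose[OF poly_times_exp_tendsto_0 filterlim_inverse_at_top_right])
      then show ?thesis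
        by (rule Lim_transform_eventually)
           (auto simp: eventually_at_filter flat_exp_def divide_inverse)
    qed
    moreover have "((\<lambda>h. flat_exp q h / h) \<longlongrightarrow> 0) (at_left 0)"
      by (rule tendsto_eventually) (auto simp: eventually_at_filter flat_exp_def)
    ultimately have "((\<lambda>h. flat_exp q h / h) \<longlongrightarrow> 0) (at 0)"
      by (simp add: filterlim_split_at)
    then show ?thesis using 3 by (simp add: DERIV_def flat_exp_def)
  qed
qed

text \<open>The inner derivative \<open>c * v $ i\<close> is constant in \<open>x\<close> and can be
  moved into the polynomial, so every directional derivative has again the form covered by the
  induction hypothesis for arbitrary \<open>q\<close>.\<close>

lemma Ck_flat_exp: "Ck n (\<lambda>x::real^3. flat_exp q (c * x $ i + d))"
proof (induction n arbitrary: q)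
  case 0
  have "continuous_on UNIV (flat_exp q)"
    using flat_exp_derivative DERIV_continuous_on by (metis DERIV_isCont continuous_at_imp_continuous_on)
  then show ?case
    by (auto intro!: continuous_on_compose2[of UNIV "flat_exp q"] continuous_intros)
next
  case (Suc n)
  let ?q = "[:0, 0, 1:] * (q - pderiv q)"
  show ?case
  proof (rule Ck_SucI)
    fix x :: "real^3"
    have "((\<lambda>x. c * x $ i + d) has_derivative (\<lambda>v. c * v $ i)) (at x)"
      by (auto intro!: derivative_eq_intros bounded_linear.has_derivative[OF bounded_linear_vec_nth])
    from DERIV_compose_FDERIV[OF flat_exp_derivative this]
    show "((\<lambda>x. flat_exp q (c * x $ i + d)) has_derivative
        (\<lambda>v. flat_exp (smult (c * v $ i) ?q) (c * x $ i + d))) (at x)"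
      by (rule has_derivative_eq_rhs) (auto simp: flat_exp_def fun_eq_iff)
  qed (rule Suc)
qed

text \<open>Each factor is exp(-1/(n s)), with s the distance of a coordinate to an end of its
  interval. Letting n grow drives the factors to 1 inside the box, while outside the product
  vanishes for every n: a smooth approximation of the indicator of the open box.\<close>

definition bump :: "real^3 \<Rightarrow> real^3 \<Rightarrow> nat \<Rightarrow> real^3 \<Rightarrow> real" where
  "bump a b n x = (\<Prod>i\<in>UNIV. flat_exp 1 (real n * x $ i + - (real n * a $ i)) *
                               flat_exp 1 (- real n * x $ i + real n * b $ i))"

lemma Ck_bump: "Ck k (bump a b n)"
  unfolding bump_def[abs_def] by (intro Ck_prod Ck_mult Ck_flat_exp) auto

lemma flat_exp_1_bounds: "0 \<le> flat_exp 1 t" "flat_exp 1 t \<le> 1"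
  by (auto simp: flat_exp_def)

lemma bump_bounds: "0 \<le> bump a b n x" "bump a b n x \<le> 1"
  unfolding bump_def
  by (auto intro!: prod_nonneg prod_le_1 mult_le_one simp: flat_exp_1_bounds)

lemma bump_outside:
  assumes "x \<notin> box a b"
  shows "bump a b n x = 0"
proof -
  from assms obtain i where "x $ i \<le> a $ i \<or> b $ i \<le> x $ i"
    by (auto simp: mem_box_cart not_less)
  then have "real n * x $ i \<le> real n * a $ i \<or> real n * b $ i \<le> real n * x $ i"
    by (metis mult_left_mono of_nat_0_le_iff)
  then have "flat_exp 1 (real n * x $ i + - (real n * a $ i)) = 0 \<or>
      flat_exp 1 (- real n * x $ i + real n * b $ i) = 0"
    by (auto simp: flat_exp_def)
  then show ?thesis unfolding bump_def by (intro prod_zero) auto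
qed

lemma bump_tendsto: "(\<lambda>n. bump a b n x) \<longlonglongrightarrow> indicator (box a b) x"
proof (cases "x \<in> box a b")
  case True
  have f: "(\<lambda>n. flat_exp 1 (real n * s)) \<longlonglongrightarrow> 1" if "s > 0" for s
  proof -
    have "(\<lambda>n. exp (- (1 / real n / s))) \<longlonglongrightarrow> exp (- (0 / s))"
      by (intro tendsto_intros lim_1_over_n) (use that in auto)
    then have "(\<lambda>n. exp (- (1 / (real n * s)))) \<longlonglongrightarrow> 1" by simp
    then show ?thesis
      by (rule Lim_transform_eventually)
         (use that in \<open>auto simp: flat_exp_def intro!: eventually_mono[OF eventually_gt_at_top[of 0]]\<close>)
  qed
  have "(\<lambda>n. bump a b n x) \<longlonglongrightarrow> (\<Prod>i\<in>(UNIV :: 3 set). 1 * 1)"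
    unfolding bump_def
  proof (intro tendsto_intros)
    fix i :: 3
    show "(\<lambda>n. flat_exp 1 (real n * x $ i + - (real n * a $ i))) \<longlonglongrightarrow> 1"
      using f[of "x $ i - a $ i"] True by (simp add: mem_box_cart algebra_simps)
    show "(\<lambda>n. flat_exp 1 (- real n * x $ i + real n * b $ i)) \<longlonglongrightarrow> 1"
      using f[of "b $ i - x $ i"] True by (simp add: mem_box_cart algebra_simps)
  qed
  then show ?thesis using True by simp
qed (simp add: bump_outside)

lemma bump_test_field:
  assumes "cbox a b \<subseteq> \<Omega>"
  shows "(\<lambda>x. bump a b n x *\<^sub>R v) \<in> test_fields \<Omega>"
proof -
  have "closure {x. bump a b n x *\<^sub>R v \<noteq> 0} \<subseteq> cbox a b"
    using bump_outside[of _ a b n] box_subset_cbox[of a b] by (intro closure_minimal) auto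
  moreover have "smooth (\<lambda>x. bump a b n x *\<^sub>R v)"
    unfolding smooth_def by (intro allI Ck_bounded_linear[OF bounded_linear_scaleR_left] Ck_bump)
  ultimately show ?thesis
    using assms bounded_subset[OF bounded_cbox, of "closure {x. bump a b n x *\<^sub>R v \<noteq> 0}" a b]
    by (simp add: test_fields_def compact_eq_bounded_closed del: scaleR_eq_0_iff)
qed

text \<open>Lebesgue differentiation: outside a null set the value at a point is the limit of
  averages over small cubes with that point as corner, and all such averages inside the open set
  vanish.\<close>

lemma integrable_zero_on_boxes_AE:
  fixes f :: "real^3 \<Rightarrow> 'b::euclidean_space"
  assumes \<Omega>: "open \<Omega>" and f: "integrable (lebesgue_on \<Omega>) f"
    and zero: "\<And>a b. cbox a b \<subseteq> \<Omega> \<Longrightarrow> (LINT x|lebesgue_on \<Omega>. indicator (box a b) x *\<^sub>R f x) = 0"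
  shows "AE x in lebesgue_on \<Omega>. f x = 0"
proof -
  have \<Omega>S [simp]: "\<Omega> \<in> sets lebesgue" using \<Omega> by auto
  \<comment> \<open>Extension by zero, since the differentiation theorem concerns cubes in the whole
    space.\<close>
  define g where "g x = (if x \<in> \<Omega> then f x else 0)" for x
  have g: "integrable lebesgue g"
    using f Lebesgue_Measure.integrable_restrict_UNIV[OF \<Omega>S, of f] by (simp add: g_def[abs_def])
  then have gabs: "g absolutely_integrable_on UNIV"
    by (simp add: set_integrable_def)
  have gS: "g absolutely_integrable_on S" if "S \<in> sets lebesgue" for S
    using set_integrable_subset[OF gabs that] by simp
  have int0: "integral (cbox a b) g = 0" if ab: "cbox a b \<subseteq> \<Omega>" for a b
  proof -
    have "integral (cbox a b) g = integral (box a b) g" by (simp add: integral_open_interval)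
    also have "\<dots> = (LINT x:box a b|lebesgue. g x)"
      by (rule set_lebesgue_integral_eq_integral(2)[symmetric]) (rule gS, simp)
    also have "\<dots> = (LINT x|lebesgue. (if x \<in> \<Omega> then indicator (box a b) x *\<^sub>R f x else 0))"
      unfolding set_lebesgue_integral_def
      by (intro Bochner_Integration.integral_cong) (auto simp: g_def)
    also have "\<dots> = (LINT x|lebesgue_on \<Omega>. indicator (box a b) x *\<^sub>R f x)"
      by (rule Lebesgue_Measure.integral_restrict_UNIV) simp
    also have "\<dots> = 0" by (rule zero[OF ab])
    finally show ?thesis .
  qed
  have "g integrable_on cbox a b" for a b
    by (rule set_lebesgue_integral_eq_integral(1)) (rule gS, simp)
  from integrable_ccontinuous_explicit[OF this] obtain N where N: "negligible N"
    and leb: "\<And>x e. x \<notin> N \<Longrightarrow> 0 < e \<Longrightarrow> \<exists>d>0. \<forall>h. 0 < h \<and> h < d \<longrightarrow>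
        norm (integral (cbox x (x + h *\<^sub>R One)) g /\<^sub>R h ^ DIM(real^3) - g x) < e"
    by blast
  have "f x = 0" if x: "x \<in> \<Omega>" "x \<notin> N" for x
  proof -
    have "norm (g x) < e" if e: "e > 0" for e
    proof -
      obtain d where d: "d > 0" "\<And>h. 0 < h \<Longrightarrow> h < d \<Longrightarrow>
          norm (integral (cbox x (x + h *\<^sub>R One)) g /\<^sub>R h ^ DIM(real^3) - g x) < e"
        using leb[OF x(2) e] by blast
      obtain r where r: "r > 0" "cball x r \<subseteq> \<Omega>" using \<Omega> x open_contains_cball by blast
      \<comment> \<open>A cube with corner \<open>x\<close> and side \<open>h\<close> lies within
        distance \<open>3 * h\<close> of \<open>x\<close>, by summing the three coordinates; hence
        the division of \<open>r\<close> by 3.\<close>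
      define h where "h = min (d / 2) (r / 3)"
      have h: "0 < h" "h < d" "3 * h \<le> r" using d(1) r(1) by (auto simp: h_def)
      have "cbox x (x + h *\<^sub>R One) \<subseteq> cball x r"
      proof
        fix y assume "y \<in> cbox x (x + h *\<^sub>R One)"
        then have "\<bar>(y - x) \<bullet> b\<bar> \<le> h" if "b \<in> Basis" for b
          using that by (auto simp: mem_box inner_simps)
        then have "(\<Sum>b\<in>Basis. \<bar>(y - x) \<bullet> b\<bar>) \<le> (\<Sum>b\<in>(Basis :: (real^3) set). h)"
          by (intro sum_mono)
        then have "norm (y - x) \<le> 3 * h" using norm_le_l1[of "y - x"] by simp
        then show "y \<in> cball x r" using h by (simp add: dist_norm norm_minus_commute)
      qed
      then have "cbox x (x + h *\<^sub>R One) \<subseteq> \<Omega>" using r by blast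
      from int0[OF this] d(2)[OF h(1,2)] show ?thesis by simp
    qed
    from this[of "norm (g x)"] show ?thesis using x by (auto simp: g_def)
  qed
  then have "{x \<in> \<Omega>. f x \<noteq> 0} \<subseteq> N" by blast
  then have "negligible {x \<in> \<Omega>. f x \<noteq> 0}" using N negligible_subset by blast
  then have "AE x in lebesgue. x \<notin> {x \<in> \<Omega>. f x \<noteq> 0}"
    by (intro AE_not_in) (simp add: negligible_iff_null_sets)
  then show ?thesis
    by (subst AE_restrict_space_iff) (auto elim: eventually_mono)
qed

text \<open>Bump functions times a coordinate vector isolate one component of \<open>c\<close>. They
  are bounded by 1, so dominated convergence turns the test integrals into integrals over open
  boxes.\<close>

theorem fundamental_lemma_test_fields:
  assumes \<Omega>: "open \<Omega>" and c: "integrable (lebesgue_on \<Omega>) c"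
    and zero: "\<And>\<phi>. \<phi> \<in> test_fields \<Omega> \<Longrightarrow> (LINT x|lebesgue_on \<Omega>. c x \<odot> \<phi> x) = 0"
  shows "AE x in lebesgue_on \<Omega>. c x = 0"
proof -
  let ?M = "lebesgue_on \<Omega>"
  have "AE x in ?M. c x $ i = 0" for i
  proof (rule integrable_zero_on_boxes_AE[OF \<Omega>])
    show ci: "integrable ?M (\<lambda>x. c x $ i)"
      by (rule integrable_bounded_linear[OF bounded_linear_vec_nth c])
    fix a b assume ab: "cbox a b \<subseteq> \<Omega>"
    have eq: "c x \<odot> (bump a b n x *\<^sub>R axis i 1) = bump a b n x *\<^sub>R c x $ i" for n x
    proof -
      have "c x \<odot> (bump a b n x *\<^sub>R axis i 1) = (\<Sum>j\<in>UNIV. if j = i then bump a b n x *\<^sub>R c x $ i else 0)"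
        unfolding cdot_def by (intro sum.cong) (auto simp: axis_def)
      then show ?thesis by simp
    qed
    have [measurable]: "bump a b n \<in> borel_measurable ?M" for n
      using Ck_bump[of 0 a b n] by (simp add: continuous_imp_measurable_on_sets_lebesgue \<Omega> continuous_on_subset borel_open)
    have "(\<lambda>n. LINT x|?M. bump a b n x *\<^sub>R c x $ i) \<longlonglongrightarrow> (LINT x|?M. indicator (box a b) x *\<^sub>R c x $ i)"
    proof (rule integral_dominated_convergence)
      show "integrable ?M (\<lambda>x. norm (c x $ i))" using ci by simp
      show "AE x in ?M. (\<lambda>n. bump a b n x *\<^sub>R c x $ i) \<longlonglongrightarrow> indicator (box a b) x *\<^sub>R c x $ i"
        by (intro AE_I2 tendsto_intros bump_tendsto)
      show "AE x in ?M. norm (bump a b n x *\<^sub>R c x $ i) \<le> norm (c x $ i)" for n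
        by (intro AE_I2) (auto simp: bump_bounds intro!: mult_left_le_one_le)
    qed (use ci \<Omega> in \<open>auto intro!: borel_measurable_scaleR
           simp: borel_measurable_indicator_iff sets_restrict_space_iff\<close>)
    moreover have "(LINT x|?M. bump a b n x *\<^sub>R c x $ i) = 0" for n
      using zero[OF bump_test_field[OF ab, of n "axis i 1"]] by (simp add: eq)
    ultimately show "(LINT x|?M. indicator (box a b) x *\<^sub>R c x $ i) = 0"
      by (simp add: LIMSEQ_const_iff)
  qed
  then have "AE x in ?M. \<forall>i\<in>UNIV. c x $ i = 0" by (intro AE_finite_allI) auto
  then show ?thesis by (rule eventually_mono) (simp add: vec_eq_iff)
qed

section \<open>The space of fields with vanishing tangential trace\<close>

lemma smooth_continuous: "smooth \<phi> \<Longrightarrow> continuous_on UNIV \<phi>"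
  by (metis Ck.simps(1) smooth_def)

lemma smooth_partial_continuous: "smooth \<phi> \<Longrightarrow> continuous_on UNIV (partial j \<phi>)"
  unfolding smooth_def partial_def[abs_def] by (metis Ck.simps)

lemma smooth_classical_curl_continuous:
  assumes "smooth \<phi>"
  shows "continuous_on UNIV (classical_curl \<phi>)"
proof -
  have "continuous_on UNIV (\<lambda>x. classical_curl \<phi> x $ i)" for i
    using exhaust_3[of i] smooth_partial_continuous[OF assms]
    by (elim disjE) (simp_all add: classical_curl_def continuous_on_diff continuous_on_component)
  then have "continuous_on UNIV (\<lambda>x. \<chi> i. classical_curl \<phi> x $ i)"
    by (rule continuous_on_vec_lambda)
  then show ?thesis by simp
qed

lemma continuous_L2:
  assumes "open \<Omega>" "bounded \<Omega>" and g: "continuous_on UNIV g"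
  shows "g \<in> L2 \<Omega>"
proof -
  have "compact (g ` closure \<Omega>)"
    using assms by (intro compact_continuous_image) (auto simp: compact_closure intro: continuous_on_subset)
  then obtain C where C: "\<And>x. x \<in> closure \<Omega> \<Longrightarrow> norm (g x) \<le> C"
    unfolding compact_eq_bounded_closed bounded_iff by (meson imageI)
  show ?thesis
  proof (rule L2_bounded)
    show "\<Omega> \<in> lmeasurable" using assms by (simp add: lmeasurable_open)
    show "g \<in> borel_measurable (lebesgue_on \<Omega>)"
      using assms by (auto intro!: continuous_imp_measurable_on_sets_lebesgue continuous_on_subset[OF g])
    show "AE x in lebesgue_on \<Omega>. norm (g x) \<le> C"
      using C closure_subset[of \<Omega>] by (intro AE_I2) auto
  qed
qed

lemma smooth_cnjv: "smooth \<phi> \<Longrightarrow> smooth (\<lambda>x. cnjv (\<phi> x))"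
  unfolding smooth_def by (blast intro: Ck_bounded_linear[OF bounded_linear_cnjv])

lemma partial_cnjv:
  assumes "smooth \<phi>"
  shows "partial j (\<lambda>x. cnjv (\<phi> x)) x = cnjv (partial j \<phi> x)"
proof -
  have "\<phi> differentiable (at x)" using assms unfolding smooth_def by (metis Ck.simps(2))
  then have "(\<phi> has_derivative frechet_derivative \<phi> (at x)) (at x)"
    by (simp add: frechet_derivative_works)
  from bounded_linear.has_derivative[OF bounded_linear_cnjv this]
  show ?thesis by (simp add: partial_def flip: frechet_derivative_at)
qed

lemma classical_curl_cnjv:
  assumes "smooth \<phi>"
  shows "classical_curl (\<lambda>x. cnjv (\<phi> x)) x = cnjv (classical_curl \<phi> x)"
  by (simp add: vec_eq_iff forall_3 classical_curl_def partial_cnjv[OF assms])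

lemma l2_inner_cnjv: "l2_inner \<Omega> v (\<lambda>x. cnjv (w x)) = (LINT x|lebesgue_on \<Omega>. v x \<odot> w x)"
  by (simp add: l2_inner_def)

lemma l2_inner_cnjv_cnjv: "l2_inner \<Omega> (\<lambda>x. cnjv (v x)) (\<lambda>x. cnjv (w x)) = cnj (l2_inner \<Omega> v w)"
  unfolding l2_inner_def Bochner_Integration.integral_cnj[symmetric] by (simp add: cnj_cdot)

text \<open>Makes the chosen representative \<open>curl\<close> interchangeable with any other weak
  curl inside integrals.\<close>

lemma weak_curl_unique:
  assumes \<Omega>: "open \<Omega>" "bounded \<Omega>" and c: "has_weak_curl \<Omega> v c" and d: "has_weak_curl \<Omega> v d"
  shows "AE x in lebesgue_on \<Omega>. c x = d x"
proof -
  have cd: "c \<in> L2 \<Omega>" "d \<in> L2 \<Omega>" using c d by (auto simp: has_weak_curl_def)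
  then have D: "(\<lambda>x. c x - d x) \<in> L2 \<Omega>" by (rule L2_diff)
  have "AE x in lebesgue_on \<Omega>. c x - d x = 0"
  proof (rule fundamental_lemma_test_fields[OF \<Omega>(1)])
    show "integrable (lebesgue_on \<Omega>) (\<lambda>x. c x - d x)"
      using \<Omega> by (intro L2_imp_integrable D lmeasurable_open)
    fix \<phi> assume \<phi>: "\<phi> \<in> test_fields \<Omega>"
    then have "\<phi> \<in> L2 \<Omega>" by (auto simp: test_fields_def intro: continuous_L2 \<Omega> smooth_continuous)
    then show "(LINT x|lebesgue_on \<Omega>. (c x - d x) \<odot> \<phi> x) = 0"
      using c d \<phi> by (simp add: has_weak_curl_def cdot_diff_left L2_integrable_cdot)
  qed
  then show ?thesis by simp
qed

text \<open>The pairs \<open>(v, curl v)\<close> with \<open>v\<close> in \<open>H\<^sub>0(curl)\<close>. Testing against all smooth fields,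
  not only compactly supported ones, encodes the weak curl and the vanishing trace in a single
  condition, which is visibly linear and closed.\<close>

definition H0_graph :: "(real^3) set \<Rightarrow> (field \<times> field) set" where
  "H0_graph \<Omega> = {(v, c). v \<in> L2 \<Omega> \<and> c \<in> L2 \<Omega> \<and>
     (\<forall>\<phi>. smooth \<phi> \<longrightarrow> (LINT x|lebesgue_on \<Omega>. c x \<odot> \<phi> x) =
                          (LINT x|lebesgue_on \<Omega>. v x \<odot> classical_curl \<phi> x))}"

definition graph_norm :: "(real^3) set \<Rightarrow> field \<times> field \<Rightarrow> real" where
  "graph_norm \<Omega> p = sqrt ((l2_norm \<Omega> (fst p))\<^sup>2 + (l2_norm \<Omega> (snd p))\<^sup>2)"

definition graph_inner :: "(real^3) set \<Rightarrow> field \<times> field \<Rightarrow> field \<times> field \<Rightarrow> real" where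
  "graph_inner \<Omega> p q = Re (l2_inner \<Omega> (fst p) (fst q)) + Re (l2_inner \<Omega> (snd p) (snd q))"

locale bounded_domain =
  fixes \<Omega> :: "(real^3) set"
  assumes open_domain: "open \<Omega>" and bounded_domain: "bounded \<Omega>"
begin

lemma smooth_L2: "smooth \<phi> \<Longrightarrow> \<phi> \<in> L2 \<Omega>" "smooth \<phi> \<Longrightarrow> classical_curl \<phi> \<in> L2 \<Omega>"
  using open_domain bounded_domain
  by (auto intro!: continuous_L2 smooth_continuous smooth_classical_curl_continuous)

lemma graph_L2: "p \<in> H0_graph \<Omega> \<Longrightarrow> fst p \<in> L2 \<Omega>" "p \<in> H0_graph \<Omega> \<Longrightarrow> snd p \<in> L2 \<Omega>"
  by (auto simp: H0_graph_def)

lemma graph_test: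
  "p \<in> H0_graph \<Omega> \<Longrightarrow> smooth \<phi> \<Longrightarrow> (LINT x|lebesgue_on \<Omega>. snd p x \<odot> \<phi> x) =
     (LINT x|lebesgue_on \<Omega>. fst p x \<odot> classical_curl \<phi> x)"
  by (auto simp: H0_graph_def)

lemma graphI:
  "v \<in> L2 \<Omega> \<Longrightarrow> c \<in> L2 \<Omega> \<Longrightarrow> (\<And>\<phi>. smooth \<phi> \<Longrightarrow> (LINT x|lebesgue_on \<Omega>. c x \<odot> \<phi> x) =
     (LINT x|lebesgue_on \<Omega>. v x \<odot> classical_curl \<phi> x)) \<Longrightarrow> (v, c) \<in> H0_graph \<Omega>"
  by (simp add: H0_graph_def)

lemma curl_weak: "v \<in> Hcurl \<Omega> \<Longrightarrow> has_weak_curl \<Omega> v (curl \<Omega> v)"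
  unfolding Hcurl_def curl_def mem_Collect_eq by (erule conjE, erule someI_ex)

text \<open>The trace is a single integral of a difference. Smooth fields and their curls are square
  integrable on the bounded domain, so it splits, and its vanishing becomes the defining identity of
  the graph.\<close>

lemma H0curl_graph:
  assumes "v \<in> H0curl \<Omega>"
  shows "(v, curl \<Omega> v) \<in> H0_graph \<Omega>"
proof (rule graphI)
  show v: "v \<in> L2 \<Omega>" using assms by (simp add: H0curl_def Hcurl_def)
  show c: "curl \<Omega> v \<in> L2 \<Omega>"
    using curl_weak[of v] assms by (simp add: H0curl_def has_weak_curl_def)
  fix \<phi> :: field assume \<phi>: "smooth \<phi>"
  then have "tangential_trace \<Omega> v \<phi> = 0" using assms by (simp add: H0curl_def)
  then show "(LINT x|lebesgue_on \<Omega>. curl \<Omega> v x \<odot> \<phi> x) = (LINT x|lebesgue_on \<Omega>. v x \<odot> classical_curl \<phi> x)"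
    using v c smooth_L2[OF \<phi>] by (simp add: tangential_trace_def L2_integrable_cdot)
qed

lemma graph_weak_curl: "(v, c) \<in> H0_graph \<Omega> \<Longrightarrow> has_weak_curl \<Omega> v c"
  by (auto simp: has_weak_curl_def H0_graph_def test_fields_def)

lemma graph_curl_AE:
  assumes "(v, c) \<in> H0_graph \<Omega>"
  shows "AE x in lebesgue_on \<Omega>. curl \<Omega> v x = c x"
  using graph_weak_curl[OF assms] assms
  by (intro weak_curl_unique[OF open_domain bounded_domain curl_weak]) (auto simp: Hcurl_def H0_graph_def)

text \<open>Compactly supported test fields are among the smooth ones, so \<open>c\<close> is a weak
  curl. The trace is formed with \<open>curl \<Omega> v\<close> instead, which agrees with
  \<open>c\<close> almost everywhere.\<close>

lemma graph_H0curl: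
  assumes g: "(v, c) \<in> H0_graph \<Omega>"
  shows "v \<in> H0curl \<Omega>"
proof -
  have v: "v \<in> L2 \<Omega>" and c: "c \<in> L2 \<Omega>" using g by (auto simp: H0_graph_def)
  have H: "v \<in> Hcurl \<Omega>" using graph_weak_curl[OF g] v by (auto simp: Hcurl_def)
  have d: "curl \<Omega> v \<in> L2 \<Omega>" using curl_weak[OF H] by (simp add: has_weak_curl_def)
  have "tangential_trace \<Omega> v \<phi> = 0" if \<phi>: "smooth \<phi>" for \<phi>
  proof -
    note m = L2_measurable[OF v] L2_measurable[OF c] L2_measurable[OF d] L2_measurable[OF smooth_L2(1)[OF \<phi>]]
    have "(LINT x|lebesgue_on \<Omega>. curl \<Omega> v x \<odot> \<phi> x) = (LINT x|lebesgue_on \<Omega>. c x \<odot> \<phi> x)"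
      by (rule integral_cong_AE) (use graph_curl_AE[OF g] m in auto)
    also have "\<dots> = (LINT x|lebesgue_on \<Omega>. v x \<odot> classical_curl \<phi> x)"
      using g \<phi> by (simp add: H0_graph_def)
    finally show ?thesis
      using v d smooth_L2[OF \<phi>] by (simp add: tangential_trace_def L2_integrable_cdot)
  qed
  then show ?thesis using H by (simp add: H0curl_def)
qed

lemma graph_add:
  "p \<in> H0_graph \<Omega> \<Longrightarrow> q \<in> H0_graph \<Omega> \<Longrightarrow>
   (\<lambda>x. fst p x + fst q x, \<lambda>x. snd p x + snd q x) \<in> H0_graph \<Omega>"
  by (auto simp: H0_graph_def L2_add cdot_add_left L2_integrable_cdot smooth_L2)

lemma graph_smult:
  "p \<in> H0_graph \<Omega> \<Longrightarrow> (\<lambda>x. a *s fst p x, \<lambda>x. a *s snd p x) \<in> H0_graph \<Omega>"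
  by (auto simp: H0_graph_def L2_smult cdot_scale_left)

text \<open>The smooth test fields are closed under conjugation, which can thus be moved onto the
  test field. This makes the conjugate of a state difference admissible in the adjoint
  equation.\<close>

lemma graph_cnjv:
  assumes p: "p \<in> H0_graph \<Omega>"
  shows "(\<lambda>x. cnjv (fst p x), \<lambda>x. cnjv (snd p x)) \<in> H0_graph \<Omega>"
proof (rule graphI)
  fix \<phi> :: field assume \<phi>: "smooth \<phi>"
  have "(LINT x|lebesgue_on \<Omega>. cnjv (snd p x) \<odot> \<phi> x) = cnj (LINT x|lebesgue_on \<Omega>. snd p x \<odot> cnjv (\<phi> x))"
    unfolding Bochner_Integration.integral_cnj[symmetric] by (simp add: cnj_cdot)
  also have "\<dots> = cnj (LINT x|lebesgue_on \<Omega>. fst p x \<odot> cnjv (classical_curl \<phi> x))"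
    using graph_test[OF p smooth_cnjv[OF \<phi>]] by (simp add: classical_curl_cnjv[OF \<phi>])
  also have "\<dots> = (LINT x|lebesgue_on \<Omega>. cnjv (fst p x) \<odot> classical_curl \<phi> x)"
    unfolding Bochner_Integration.integral_cnj[symmetric] by (simp add: cnj_cdot)
  finally show "(LINT x|lebesgue_on \<Omega>. cnjv (snd p x) \<odot> \<phi> x) =
      (LINT x|lebesgue_on \<Omega>. cnjv (fst p x) \<odot> classical_curl \<phi> x)" .
qed (use p in \<open>auto intro: L2_cnjv graph_L2\<close>)

lemma plus_pair: "(p :: field \<times> field) + q = (\<lambda>x. fst p x + fst q x, \<lambda>x. snd p x + snd q x)"
  by (simp add: prod_eq_iff func_plus)

lemma scaleR_pair:
  "r *\<^sub>R (p :: field \<times> field) = (\<lambda>x. complex_of_real r *s fst p x, \<lambda>x. complex_of_real r *s snd p x)"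
  by (simp add: prod_eq_iff scaleR_fun_def scaleR_eq_vector_smult)

lemma subspace_graph: "subspace (H0_graph \<Omega>)"
proof -
  have "(0, 0) \<in> H0_graph \<Omega>"
    using subspace_0[OF subspace_L2, of \<Omega>] by (simp add: H0_graph_def func_zero cdot_def)
  then show ?thesis
    by (auto simp: subspace_def zero_prod_def plus_pair scaleR_pair
        intro: graph_add[of "(_, _)" "(_, _)", simplified] graph_smult[of "(_, _)", simplified])
qed

lemma semi_inner_graph: "semi_inner (H0_graph \<Omega>) (graph_inner \<Omega>)"
proof
  show "graph_inner \<Omega> p q = graph_inner \<Omega> q p" for p q
    using l2_inner_commute[of \<Omega> "fst p" "fst q"] l2_inner_commute[of \<Omega> "snd p" "snd q"]
    by (simp add: graph_inner_def)
qed (auto simp: subspace_graph graph_inner_def plus_pair scaleR_pair l2_inner_add_left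
    graph_L2 l2_inner_smult_left l2_inner_self algebra_simps simp flip: of_real_power)

lemma nrm_graph: "semi_inner.nrm (graph_inner \<Omega>) = graph_norm \<Omega>"
  by (intro ext, subst semi_inner.nrm_def[OF semi_inner_graph])
     (simp only: graph_inner_def graph_norm_def l2_inner_self Re_complex_of_real)

lemma graph_norm_ge: "l2_norm \<Omega> (fst p) \<le> graph_norm \<Omega> p" "l2_norm \<Omega> (snd p) \<le> graph_norm \<Omega> p"
  by (auto simp: graph_norm_def intro!: real_le_rsqrt)

lemma l2_inner_tendsto:
  assumes s: "\<And>n. s n \<in> L2 \<Omega>" and l: "l \<in> L2 \<Omega>" and w: "w \<in> L2 \<Omega>"
    and lim: "(\<lambda>n. l2_norm \<Omega> (s n - l)) \<longlonglongrightarrow> 0"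
  shows "(\<lambda>n. l2_inner \<Omega> (s n) w) \<longlonglongrightarrow> l2_inner \<Omega> l w"
proof -
  have "(\<lambda>n. l2_inner \<Omega> (s n) w - l2_inner \<Omega> l w) \<longlonglongrightarrow> 0"
  proof (rule Lim_null_comparison)
    show "\<forall>\<^sub>F n in sequentially. norm (l2_inner \<Omega> (s n) w - l2_inner \<Omega> l w) \<le> l2_norm \<Omega> (s n - l) * l2_norm \<Omega> w"
      using norm_l2_inner_le[OF L2_diff[OF s l] w] l2_inner_diff_left[OF s l w]
      by (intro always_eventually allI) (simp add: fun_diff_def)
    show "(\<lambda>n. l2_norm \<Omega> (s n - l) * l2_norm \<Omega> w) \<longlonglongrightarrow> 0"
      using tendsto_mult_left_zero[OF lim] by simp
  qed
  then show ?thesis by (simp add: LIM_zero_iff)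
qed

text \<open>Both components of a Cauchy sequence converge in the square mean, and the defining
  condition survives in the limit because it compares inner products with fixed square integrable
  fields.\<close>

theorem semi_hilbert_graph: "semi_hilbert (H0_graph \<Omega>) (graph_inner \<Omega>)"
proof (intro semi_hilbert.intro semi_inner_graph semi_hilbert_axioms.intro, unfold nrm_graph)
  fix s :: "nat \<Rightarrow> field \<times> field"
  assume s: "\<And>n. s n \<in> H0_graph \<Omega>"
    and C: "\<And>e. e > 0 \<Longrightarrow> \<exists>N. \<forall>m\<ge>N. \<forall>n\<ge>N. graph_norm \<Omega> (s m - s n) < e"
  interpret L: semi_hilbert "L2 \<Omega>" "\<lambda>v w. Re (l2_inner \<Omega> v w)"
    using open_domain bounded_domain by (intro semi_hilbert_L2 lmeasurable_open)
  have "\<exists>l\<in>L2 \<Omega>. (\<lambda>n. l2_norm \<Omega> (fst (s n) - l)) \<longlonglongrightarrow> 0"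
  proof (rule L.complete_seq[unfolded nrm_L2])
    show "fst (s n) \<in> L2 \<Omega>" for n using graph_L2(1)[OF s] .
    show "\<exists>N. \<forall>m\<ge>N. \<forall>n\<ge>N. l2_norm \<Omega> (fst (s m) - fst (s n)) < e" if "e > 0" for e
      using C[OF that] graph_norm_ge(1)[of "s _ - s _"] by (simp add: fst_diff) (meson le_less_trans)
  qed
  then obtain v where v: "v \<in> L2 \<Omega>" and vlim: "(\<lambda>n. l2_norm \<Omega> (fst (s n) - v)) \<longlonglongrightarrow> 0" by blast
  have "\<exists>l\<in>L2 \<Omega>. (\<lambda>n. l2_norm \<Omega> (snd (s n) - l)) \<longlonglongrightarrow> 0"
  proof (rule L.complete_seq[unfolded nrm_L2])
    show "snd (s n) \<in> L2 \<Omega>" for n using graph_L2(2)[OF s] .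
    show "\<exists>N. \<forall>m\<ge>N. \<forall>n\<ge>N. l2_norm \<Omega> (snd (s m) - snd (s n)) < e" if "e > 0" for e
      using C[OF that] graph_norm_ge(2)[of "s _ - s _"] by (simp add: snd_diff) (meson le_less_trans)
  qed
  then obtain c where c: "c \<in> L2 \<Omega>" and clim: "(\<lambda>n. l2_norm \<Omega> (snd (s n) - c)) \<longlonglongrightarrow> 0" by blast
  have "(v, c) \<in> H0_graph \<Omega>"
  proof (rule graphI[OF v c])
    fix \<phi> :: field assume \<phi>: "smooth \<phi>"
    have "(\<lambda>n. l2_inner \<Omega> (snd (s n)) (\<lambda>x. cnjv (\<phi> x))) \<longlonglongrightarrow> l2_inner \<Omega> c (\<lambda>x. cnjv (\<phi> x))"
      by (rule l2_inner_tendsto[OF graph_L2(2)[OF s] c L2_cnjv[OF smooth_L2(1)[OF \<phi>]] clim])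
    moreover have "(\<lambda>n. l2_inner \<Omega> (fst (s n)) (\<lambda>x. cnjv (classical_curl \<phi> x)))
        \<longlonglongrightarrow> l2_inner \<Omega> v (\<lambda>x. cnjv (classical_curl \<phi> x))"
      by (rule l2_inner_tendsto[OF graph_L2(1)[OF s] v L2_cnjv[OF smooth_L2(2)[OF \<phi>]] vlim])
    moreover have "l2_inner \<Omega> (snd (s n)) (\<lambda>x. cnjv (\<phi> x)) = l2_inner \<Omega> (fst (s n)) (\<lambda>x. cnjv (classical_curl \<phi> x))" for n
      using graph_test[OF s \<phi>] by (simp add: l2_inner_cnjv)
    ultimately show "(LINT x|lebesgue_on \<Omega>. c x \<odot> \<phi> x) = (LINT x|lebesgue_on \<Omega>. v x \<odot> classical_curl \<phi> x)"
      unfolding l2_inner_cnjv by (metis (no_types, lifting) LIMSEQ_unique ext)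
  qed
  moreover have "(\<lambda>n. sqrt ((l2_norm \<Omega> (fst (s n) - v))\<^sup>2 + (l2_norm \<Omega> (snd (s n) - c))\<^sup>2)) \<longlonglongrightarrow> sqrt (0\<^sup>2 + 0\<^sup>2)"
    by (intro tendsto_intros vlim clim)
  ultimately show "\<exists>l\<in>H0_graph \<Omega>. (\<lambda>n. graph_norm \<Omega> (s n - l)) \<longlonglongrightarrow> 0"
    by (intro bexI[of _ "(v, c)"]) (simp_all add: graph_norm_def)
qed

end

section \<open>Well-posedness of the Maxwell problem\<close>

lemma l2_norm_mult_le:
  assumes \<kappa>: "\<kappa> \<in> borel_measurable (lebesgue_on \<Omega>)" and v: "v \<in> L2 \<Omega>"
    and le: "AE x in lebesgue_on \<Omega>. norm (\<kappa> x) \<le> C" and C: "0 \<le> C"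
  shows "l2_norm \<Omega> (\<lambda>x. \<kappa> x *s v x) \<le> C * l2_norm \<Omega> v"
proof (rule l2_norm_mono_AE[OF v L2_mult[OF \<kappa> v le] C])
  show "AE x in lebesgue_on \<Omega>. norm (\<kappa> x *s v x) \<le> C * norm (v x)"
    using le by eventually_elim (simp add: norm_vector_smult mult_right_mono)
qed

lemma l2_mult_coercive:
  assumes a: "a \<in> borel_measurable (lebesgue_on \<Omega>)" and v: "v \<in> L2 \<Omega>"
    and le: "AE x in lebesgue_on \<Omega>. norm (a x) \<le> C"
    and ge: "AE x in lebesgue_on \<Omega>. k \<le> Re (a x)"
  shows "k * (l2_norm \<Omega> v)\<^sup>2 \<le> Re (l2_inner \<Omega> (\<lambda>x. a x *s v x) v)"
proof -
  let ?M = "lebesgue_on \<Omega>"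
  have I: "integrable ?M (\<lambda>x. (a x *s v x) \<odot> cnjv (v x))"
    by (intro L2_integrable_cdot L2_mult[OF a v le] L2_cnjv v)
  have Re_eq: "Re ((a x *s v x) \<odot> cnjv (v x)) = Re (a x) * (norm (v x))\<^sup>2" for x
    by (simp only: cdot_scale_left cdot_cnjv_self Re_complex_of_real times_complex.simps) simp
  have "k * (l2_norm \<Omega> v)\<^sup>2 = (LINT x|?M. k * (norm (v x))\<^sup>2)"
    by (simp add: l2_norm_def integral_nonneg)
  also have "\<dots> \<le> (LINT x|?M. Re ((a x *s v x) \<odot> cnjv (v x)))"
  proof (rule integral_mono_AE)
    show "AE x in ?M. k * (norm (v x))\<^sup>2 \<le> Re ((a x *s v x) \<odot> cnjv (v x))"
      using ge by eventually_elim (simp add: Re_eq mult_right_mono)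
  qed (use I L2_integrable[OF v] in auto)
  also have "\<dots> = Re (l2_inner \<Omega> (\<lambda>x. a x *s v x) v)"
    unfolding l2_inner_def using I by (rule integral_Re)
  finally show ?thesis .
qed

text \<open>The Maxwell form with the curls supplied as separate arguments, which makes it exactly
  additive on pairs.\<close>

definition pair_form ::
    "(real^3) set \<Rightarrow> (real^3 \<Rightarrow> real) \<Rightarrow> real \<Rightarrow> (real^3 \<Rightarrow> complex) \<Rightarrow> field \<times> field \<Rightarrow> field \<times> field \<Rightarrow> complex" where
  "pair_form \<Omega> \<mu> \<omega> \<kappa> p q =
     l2_inner \<Omega> (\<lambda>x. complex_of_real (inverse (\<mu> x)) *s snd p x) (snd q)
     - complex_of_real (\<omega>\<^sup>2) * l2_inner \<Omega> (\<lambda>x. \<kappa> x *s fst p x) (fst q)"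

definition pair_inner :: "(real^3) set \<Rightarrow> field \<times> field \<Rightarrow> field \<times> field \<Rightarrow> complex" where
  "pair_inner \<Omega> p q = l2_inner \<Omega> (fst p) (fst q) + l2_inner \<Omega> (snd p) (snd q)"

lemma maxwell_form_eq: "maxwell_form \<Omega> \<mu> \<omega> \<kappa> v w = pair_form \<Omega> \<mu> \<omega> \<kappa> (v, curl \<Omega> v) (w, curl \<Omega> w)"
  by (simp add: maxwell_form_def pair_form_def scaleR_eq_vector_smult)

text \<open>Here \<kappa> stands for the controlled coefficient, and the bounds
  \<open>\<nu>lo\<close> and \<open>\<nu>hi\<close> concern the reciprocal of \<mu>. The lower bound
  \<open>m\<close> on the imaginary part is the contribution of the conductivity.\<close>

locale maxwell_coefficients = bounded_domain +
  fixes \<mu> :: "real^3 \<Rightarrow> real" and \<omega> \<nu>lo \<nu>hi K m :: real and \<kappa> :: "real^3 \<Rightarrow> complex"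
  assumes \<omega>: "\<omega> > 0" and \<nu>lo: "\<nu>lo > 0" and m: "m > 0"
    and \<mu>_meas [measurable]: "\<mu> \<in> borel_measurable (lebesgue_on \<Omega>)"
    and \<nu>_bounds: "AE x in lebesgue_on \<Omega>. \<nu>lo \<le> inverse (\<mu> x) \<and> inverse (\<mu> x) \<le> \<nu>hi"
    and \<kappa>_meas [measurable]: "\<kappa> \<in> borel_measurable (lebesgue_on \<Omega>)"
    and \<kappa>_bounds: "AE x in lebesgue_on \<Omega>. norm (\<kappa> x) \<le> K \<and> m \<le> Im (\<kappa> x)"
begin

abbreviation "B \<equiv> pair_form \<Omega> \<mu> \<omega> \<kappa>"

lemma \<nu>_meas: "(\<lambda>x. complex_of_real (inverse (\<mu> x))) \<in> borel_measurable (lebesgue_on \<Omega>)"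
  by measurable

lemma \<nu>_norm: "AE x in lebesgue_on \<Omega>. norm (complex_of_real (inverse (\<mu> x))) \<le> \<bar>\<nu>hi\<bar>"
  using \<nu>_bounds
proof eventually_elim
  case (elim x)
  then show ?case unfolding norm_of_real using \<nu>lo by linarith
qed

lemma \<kappa>_norm: "AE x in lebesgue_on \<Omega>. norm (\<kappa> x) \<le> \<bar>K\<bar>"
  using \<kappa>_bounds by (auto elim!: eventually_mono)

lemma \<nu>_L2: "v \<in> L2 \<Omega> \<Longrightarrow> (\<lambda>x. complex_of_real (inverse (\<mu> x)) *s v x) \<in> L2 \<Omega>"
  by (rule L2_mult[OF \<nu>_meas _ \<nu>_norm])

lemma \<kappa>_L2: "v \<in> L2 \<Omega> \<Longrightarrow> (\<lambda>x. \<kappa> x *s v x) \<in> L2 \<Omega>"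
  by (rule L2_mult[OF \<kappa>_meas _ \<kappa>_norm])

lemma form_add:
  assumes "p \<in> H0_graph \<Omega>" "q \<in> H0_graph \<Omega>" "r \<in> H0_graph \<Omega>"
  shows "B (p + q) r = B p r + B q r"
  using assms
  by (simp add: pair_form_def plus_pair vector_add_ldistrib l2_inner_add_left \<nu>_L2 \<kappa>_L2 graph_L2
      algebra_simps del: of_real_inverse)

lemma form_add_right:
  assumes "p \<in> H0_graph \<Omega>" "q \<in> H0_graph \<Omega>" "r \<in> H0_graph \<Omega>"
  shows "B r (p + q) = B r p + B r q"
  using assms
  by (simp add: pair_form_def plus_pair l2_inner_add_right \<nu>_L2 \<kappa>_L2 graph_L2
      algebra_simps del: of_real_inverse)

lemma form_smult_right: "B r (\<lambda>x. a *s fst p x, \<lambda>x. a *s snd p x) = cnj a * B r p"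
  by (simp add: pair_form_def l2_inner_smult_right algebra_simps)

lemma norm_form_le:
  assumes p: "p \<in> H0_graph \<Omega>" and q: "q \<in> H0_graph \<Omega>"
  shows "norm (B p q) \<le> (\<bar>\<nu>hi\<bar> + \<omega>\<^sup>2 * \<bar>K\<bar>) * graph_norm \<Omega> p * graph_norm \<Omega> q"
proof -
  have nn: "0 \<le> graph_norm \<Omega> r" for r by (simp add: graph_norm_def)
  have "norm (l2_inner \<Omega> (\<lambda>x. complex_of_real (inverse (\<mu> x)) *s snd p x) (snd q))
      \<le> l2_norm \<Omega> (\<lambda>x. complex_of_real (inverse (\<mu> x)) *s snd p x) * l2_norm \<Omega> (snd q)"
    by (intro norm_l2_inner_le \<nu>_L2 graph_L2 p q)
  also have "\<dots> \<le> (\<bar>\<nu>hi\<bar> * l2_norm \<Omega> (snd p)) * l2_norm \<Omega> (snd q)"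
    by (intro mult_right_mono l2_norm_mult_le[OF \<nu>_meas] \<nu>_norm graph_L2 p) auto
  also have "\<dots> \<le> (\<bar>\<nu>hi\<bar> * graph_norm \<Omega> p) * graph_norm \<Omega> q"
    by (intro mult_mono mult_left_mono graph_norm_ge) (auto simp: nn)
  finally have 1: "norm (l2_inner \<Omega> (\<lambda>x. complex_of_real (inverse (\<mu> x)) *s snd p x) (snd q))
      \<le> \<bar>\<nu>hi\<bar> * graph_norm \<Omega> p * graph_norm \<Omega> q" .
  have "norm (l2_inner \<Omega> (\<lambda>x. \<kappa> x *s fst p x) (fst q))
      \<le> l2_norm \<Omega> (\<lambda>x. \<kappa> x *s fst p x) * l2_norm \<Omega> (fst q)"
    by (intro norm_l2_inner_le \<kappa>_L2 graph_L2 p q)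
  also have "\<dots> \<le> (\<bar>K\<bar> * l2_norm \<Omega> (fst p)) * l2_norm \<Omega> (fst q)"
    by (intro mult_right_mono l2_norm_mult_le[OF \<kappa>_meas] \<kappa>_norm graph_L2 p) auto
  also have "\<dots> \<le> (\<bar>K\<bar> * graph_norm \<Omega> p) * graph_norm \<Omega> q"
    by (intro mult_mono mult_left_mono graph_norm_ge) (auto simp: nn)
  finally have 2: "norm (complex_of_real (\<omega>\<^sup>2) * l2_inner \<Omega> (\<lambda>x. \<kappa> x *s fst p x) (fst q))
      \<le> \<omega>\<^sup>2 * (\<bar>K\<bar> * graph_norm \<Omega> p * graph_norm \<Omega> q)"
    unfolding norm_mult norm_of_real by (simp add: mult_left_mono)
  show ?thesis
    unfolding pair_form_def using 1 2
    by (intro order_trans[OF norm_triangle_ineq4]) (simp add: algebra_simps)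
qed

text \<open>The imaginary part of \<open>\<kappa>\<close> controls the \<open>L\<^sup>2\<close> norm; multiplying the form by \<open>1 + i s\<close>
  with \<open>s\<close> large lets it absorb the indefinite term.\<close>

definition rot :: complex where "rot = Complex 1 ((\<bar>K\<bar> + 1) / m)"

text \<open>With s = (|K| + 1)/m, the real part of (1 + i s) times the real coefficient of the curl
  term is that coefficient, while the real part of -(1 + i s) \<kappa> is s Im \<kappa> - Re
  \<kappa>, at least |K| + 1 - |K| = 1. The coercivity constant is therefore the smaller of
  \<open>\<nu>lo\<close> and \<open>\<omega>\<^sup>2\<close>.\<close>

lemma rot_coercive:
  assumes p: "p \<in> H0_graph \<Omega>"
  shows "min \<nu>lo (\<omega>\<^sup>2) * (graph_norm \<Omega> p)\<^sup>2 \<le> Re (rot * B p p)"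
proof -
  have "AE x in lebesgue_on \<Omega>. norm (rot * complex_of_real (inverse (\<mu> x))) \<le> norm rot * \<bar>\<nu>hi\<bar>"
    using \<nu>_norm by eventually_elim (simp add: norm_mult mult_left_mono del: of_real_inverse)
  moreover have "AE x in lebesgue_on \<Omega>. \<nu>lo \<le> Re (rot * complex_of_real (inverse (\<mu> x)))"
    using \<nu>_bounds by eventually_elim (simp add: rot_def del: of_real_inverse)
  moreover have "(\<lambda>x. rot * complex_of_real (inverse (\<mu> x))) \<in> borel_measurable (lebesgue_on \<Omega>)"
    by measurable
  ultimately have "\<nu>lo * (l2_norm \<Omega> (snd p))\<^sup>2
      \<le> Re (l2_inner \<Omega> (\<lambda>x. (rot * complex_of_real (inverse (\<mu> x))) *s snd p x) (snd p))"
    by (intro l2_mult_coercive[OF _ graph_L2(2)[OF p]])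
  also have "\<dots> = Re (rot * l2_inner \<Omega> (\<lambda>x. complex_of_real (inverse (\<mu> x)) *s snd p x) (snd p))"
    by (simp only: vector_smult_assoc[symmetric] l2_inner_smult_left)
  finally have 1: "\<nu>lo * (l2_norm \<Omega> (snd p))\<^sup>2
      \<le> Re (rot * l2_inner \<Omega> (\<lambda>x. complex_of_real (inverse (\<mu> x)) *s snd p x) (snd p))" .
  have "AE x in lebesgue_on \<Omega>. norm (- rot * \<kappa> x) \<le> norm rot * \<bar>K\<bar>"
    using \<kappa>_norm by eventually_elim (simp add: norm_mult mult_left_mono)
  moreover have "AE x in lebesgue_on \<Omega>. 1 \<le> Re (- rot * \<kappa> x)"
    using \<kappa>_bounds
  proof eventually_elim
    case (elim x)
    have "\<bar>K\<bar> + 1 = (\<bar>K\<bar> + 1) / m * m" using m by simp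
    also have "\<dots> \<le> (\<bar>K\<bar> + 1) / m * Im (\<kappa> x)" using elim m by (intro mult_left_mono) auto
    finally show ?case using complex_Re_le_cmod[of "\<kappa> x"] elim
      by (simp add: rot_def) linarith
  qed
  moreover have "(\<lambda>x. - rot * \<kappa> x) \<in> borel_measurable (lebesgue_on \<Omega>)"
    by measurable
  ultimately have "1 * (l2_norm \<Omega> (fst p))\<^sup>2 \<le> Re (l2_inner \<Omega> (\<lambda>x. (- rot * \<kappa> x) *s fst p x) (fst p))"
    by (intro l2_mult_coercive[OF _ graph_L2(1)[OF p]])
  also have "\<dots> = - Re (rot * l2_inner \<Omega> (\<lambda>x. \<kappa> x *s fst p x) (fst p))"
    by (simp only: vector_smult_assoc[symmetric] l2_inner_smult_left) simp
  finally have "\<omega>\<^sup>2 * (l2_norm \<Omega> (fst p))\<^sup>2 \<le> \<omega>\<^sup>2 * - Re (rot * l2_inner \<Omega> (\<lambda>x. \<kappa> x *s fst p x) (fst p))"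
    by (intro mult_left_mono) auto
  with 1 have "\<nu>lo * (l2_norm \<Omega> (snd p))\<^sup>2 + \<omega>\<^sup>2 * (l2_norm \<Omega> (fst p))\<^sup>2 \<le> Re (rot * B p p)"
    by (simp add: pair_form_def algebra_simps del: of_real_inverse of_real_power)
  moreover have "min \<nu>lo (\<omega>\<^sup>2) * (l2_norm \<Omega> (snd p))\<^sup>2 \<le> \<nu>lo * (l2_norm \<Omega> (snd p))\<^sup>2"
    "min \<nu>lo (\<omega>\<^sup>2) * (l2_norm \<Omega> (fst p))\<^sup>2 \<le> \<omega>\<^sup>2 * (l2_norm \<Omega> (fst p))\<^sup>2"
    by (auto intro: mult_right_mono)
  ultimately show ?thesis by (simp add: graph_norm_def distrib_left)
qed

text \<open>In modulus the rotation costs only the factor \<open>norm rot\<close>. This version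
  yields uniqueness and the bound on state differences.\<close>

lemma form_coercive: "\<exists>k>0. \<forall>p\<in>H0_graph \<Omega>. k * (graph_norm \<Omega> p)\<^sup>2 \<le> norm (B p p)"
proof (intro exI[of _ "min \<nu>lo (\<omega>\<^sup>2) / norm rot"] conjI ballI)
  have r: "norm rot > 0" by (simp add: rot_def complex_eq_iff)
  then show "min \<nu>lo (\<omega>\<^sup>2) / norm rot > 0" using \<nu>lo \<omega> by simp
  fix p assume p: "p \<in> H0_graph \<Omega>"
  have "min \<nu>lo (\<omega>\<^sup>2) * (graph_norm \<Omega> p)\<^sup>2 \<le> norm rot * norm (B p p)"
    using rot_coercive[OF p] complex_Re_le_cmod[of "rot * B p p"] by (simp add: norm_mult)
  then show "min \<nu>lo (\<omega>\<^sup>2) / norm rot * (graph_norm \<Omega> p)\<^sup>2 \<le> norm (B p p)"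
    using r by (simp add: field_simps)
qed

lemma norm_pair_inner_le:
  assumes "G \<in> L2 \<Omega>" "H \<in> L2 \<Omega>" and q: "q \<in> H0_graph \<Omega>"
  shows "norm (pair_inner \<Omega> (G, H) q) \<le> (l2_norm \<Omega> G + l2_norm \<Omega> H) * graph_norm \<Omega> q"
proof -
  have "norm (l2_inner \<Omega> G (fst q)) \<le> l2_norm \<Omega> G * graph_norm \<Omega> q"
    using norm_l2_inner_le[OF assms(1) graph_L2(1)[OF q]]
      mult_left_mono[OF graph_norm_ge(1) l2_norm_nonneg] by (rule order_trans)
  moreover have "norm (l2_inner \<Omega> H (snd q)) \<le> l2_norm \<Omega> H * graph_norm \<Omega> q"
    using norm_l2_inner_le[OF assms(2) graph_L2(2)[OF q]]
      mult_left_mono[OF graph_norm_ge(2) l2_norm_nonneg] by (rule order_trans)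
  ultimately show ?thesis
    unfolding pair_inner_def by (intro order_trans[OF norm_triangle_ineq]) (simp add: algebra_simps)
qed

text \<open>Lax-Milgram is real, so it is applied to the real parts of the rotated form and of the
  equally rotated functional; the rotation cancels at the end because \<open>rot\<close> is
  nonzero.\<close>

theorem form_solvable:
  assumes G: "G \<in> L2 \<Omega>" and H: "H \<in> L2 \<Omega>"
  shows "\<exists>p\<in>H0_graph \<Omega>. \<forall>q\<in>H0_graph \<Omega>. B p q = pair_inner \<Omega> (G, H) q"
proof -
  interpret semi_hilbert "H0_graph \<Omega>" "graph_inner \<Omega>" by (rule semi_hilbert_graph)
  have Re_le: "\<bar>Re (rot * z)\<bar> \<le> norm rot * norm z" for z
    using abs_Re_le_cmod[of "rot * z"] by (simp add: norm_mult)
  have "\<exists>p\<in>H0_graph \<Omega>. \<forall>q\<in>H0_graph \<Omega>. Re (rot * B p q) = Re (rot * pair_inner \<Omega> (G, H) q)"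
  proof (rule lax_milgram[unfolded nrm_graph])
    fix p q r :: "field \<times> field" and t :: real
    assume p: "p \<in> H0_graph \<Omega>"
    show "min \<nu>lo (\<omega>\<^sup>2) * (graph_norm \<Omega> p)\<^sup>2 \<le> Re (rot * B p p)"
      by (rule rot_coercive[OF p])
    show "\<bar>Re (rot * pair_inner \<Omega> (G, H) p)\<bar> \<le> (norm rot * (l2_norm \<Omega> G + l2_norm \<Omega> H)) * graph_norm \<Omega> p"
      using order_trans[OF Re_le mult_left_mono[OF norm_pair_inner_le[OF G H p] norm_ge_zero]]
      by (simp only: mult.assoc)
    show "Re (rot * pair_inner \<Omega> (G, H) (t *\<^sub>R p)) = t * Re (rot * pair_inner \<Omega> (G, H) p)"
      by (simp add: pair_inner_def scaleR_pair l2_inner_smult_right algebra_simps)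
    assume q: "q \<in> H0_graph \<Omega>"
    show "Re (rot * B q (t *\<^sub>R p)) = t * Re (rot * B q p)"
      by (simp add: scaleR_pair form_smult_right algebra_simps)
    show "\<bar>Re (rot * B p q)\<bar> \<le> (norm rot * (\<bar>\<nu>hi\<bar> + \<omega>\<^sup>2 * \<bar>K\<bar>)) * graph_norm \<Omega> p * graph_norm \<Omega> q"
      using order_trans[OF Re_le mult_left_mono[OF norm_form_le[OF p q] norm_ge_zero]]
      by (simp only: mult.assoc)
    show "Re (rot * pair_inner \<Omega> (G, H) (p + q)) = Re (rot * pair_inner \<Omega> (G, H) p) + Re (rot * pair_inner \<Omega> (G, H) q)"
      using G H p q by (simp add: pair_inner_def plus_pair l2_inner_add_right graph_L2 algebra_simps)
    assume r: "r \<in> H0_graph \<Omega>"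
    show "Re (rot * B (p + q) r) = Re (rot * B p r) + Re (rot * B q r)"
      by (simp only: form_add[OF p q r] distrib_left plus_complex.simps)
    show "Re (rot * B r (p + q)) = Re (rot * B r p) + Re (rot * B r q)"
      by (simp only: form_add_right[OF p q r] distrib_left plus_complex.simps)
  qed (use \<nu>lo \<omega> in auto)
  then obtain p where p: "p \<in> H0_graph \<Omega>"
    and Re_eq: "\<And>q. q \<in> H0_graph \<Omega> \<Longrightarrow> Re (rot * B p q) = Re (rot * pair_inner \<Omega> (G, H) q)"
    by blast
  have "B p q = pair_inner \<Omega> (G, H) q" if q: "q \<in> H0_graph \<Omega>" for q
  proof -
    \<comment> \<open>both sides are antilinear in \<open>q\<close>, so testing with \<open>i q\<close> yields the imaginary parts\<close>
    let ?q = "(\<lambda>x. \<i> *s fst q x, \<lambda>x. \<i> *s snd q x)"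
    have "pair_inner \<Omega> (G, H) ?q = cnj \<i> * pair_inner \<Omega> (G, H) q"
      by (simp add: pair_inner_def l2_inner_smult_right algebra_simps)
    with Re_eq[OF graph_smult[OF q, of \<i>]]
    have "Im (rot * B p q) = Im (rot * pair_inner \<Omega> (G, H) q)"
      by (simp add: form_smult_right algebra_simps)
    with Re_eq[OF q] have "rot * B p q = rot * pair_inner \<Omega> (G, H) q"
      by (rule complex_eqI)
    moreover have "rot \<noteq> 0" by (simp add: rot_def complex_eq_iff)
    ultimately show ?thesis by simp
  qed
  with p show ?thesis by blast
qed

theorem form_unique:
  assumes p: "p \<in> H0_graph \<Omega>" and q: "q \<in> H0_graph \<Omega>"
    and eq: "\<And>r. r \<in> H0_graph \<Omega> \<Longrightarrow> B p r = B q r"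
  shows "AE x in lebesgue_on \<Omega>. fst p x = fst q x"
proof -
  interpret semi_inner "H0_graph \<Omega>" "graph_inner \<Omega>" by (rule semi_inner_graph)
  have d: "p - q \<in> H0_graph \<Omega>" using p q by blast
  have "B (p - q) (p - q) = 0"
    using form_add[OF d q d] eq[OF d] by simp
  moreover obtain k where "k > 0" "k * (graph_norm \<Omega> (p - q))\<^sup>2 \<le> norm (B (p - q) (p - q))"
    using form_coercive d by blast
  ultimately have "graph_norm \<Omega> (p - q) = 0" by (simp add: mult_le_0_iff)
  then have "l2_norm \<Omega> (fst (p - q)) = 0"
    using graph_norm_ge(1)[of "p - q"] l2_norm_nonneg[of \<Omega> "fst (p - q)"] by linarith
  from l2_norm_zero_AE[OF graph_L2(1)[OF d] this] show ?thesis
    by (simp add: fst_diff fun_diff_def)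
qed

text \<open>The bridge from arbitrary curl representatives to the ones chosen by
  \<open>curl\<close>, in terms of which the equations are stated.\<close>

lemma pair_form_cong:
  assumes "(v, c) \<in> H0_graph \<Omega>" "(w, d) \<in> H0_graph \<Omega>"
  shows "B (v, curl \<Omega> v) (w, curl \<Omega> w) = B (v, c) (w, d)"
proof -
  have L: "c \<in> L2 \<Omega>" "d \<in> L2 \<Omega>" "curl \<Omega> v \<in> L2 \<Omega>" "curl \<Omega> w \<in> L2 \<Omega>"
    using graph_L2(2)[OF assms(1)] graph_L2(2)[OF assms(2)]
      graph_L2(2)[OF H0curl_graph[OF graph_H0curl[OF assms(1)]]]
      graph_L2(2)[OF H0curl_graph[OF graph_H0curl[OF assms(2)]]] by auto
  have "l2_inner \<Omega> (\<lambda>x. complex_of_real (inverse (\<mu> x)) *s curl \<Omega> v x) (curl \<Omega> w)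
      = l2_inner \<Omega> (\<lambda>x. complex_of_real (inverse (\<mu> x)) *s c x) d"
    by (rule l2_inner_cong_AE)
       (use graph_curl_AE[OF assms(1)] graph_curl_AE[OF assms(2)] L in
          \<open>auto simp del: of_real_inverse intro: L2_measurable \<nu>_L2\<close>)
  then show ?thesis by (simp add: pair_form_def)
qed

lemma pair_inner_cong:
  assumes "H \<in> L2 \<Omega>" "(w, d) \<in> H0_graph \<Omega>"
  shows "l2_inner \<Omega> H (curl \<Omega> w) = l2_inner \<Omega> H d"
proof -
  have L: "d \<in> L2 \<Omega>" "curl \<Omega> w \<in> L2 \<Omega>"
    using graph_L2(2)[OF assms(2)] graph_L2(2)[OF H0curl_graph[OF graph_H0curl[OF assms(2)]]] by auto
  show ?thesis
    by (rule l2_inner_cong_AE) (use graph_curl_AE[OF assms(2)] L assms(1) in \<open>auto intro: L2_measurable\<close>)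
qed

text \<open>Common shape of both equations: the state equation has \<open>H = 0\<close>, the adjoint
  equation has the conjugated residuals of the field and of its curl as \<open>G\<close> and
  \<open>H\<close>.\<close>

definition solves :: "field \<Rightarrow> field \<Rightarrow> field \<Rightarrow> bool" where
  "solves G H y \<longleftrightarrow> y \<in> H0curl \<Omega> \<and>
     (\<forall>w\<in>H0curl \<Omega>. maxwell_form \<Omega> \<mu> \<omega> \<kappa> y w = l2_inner \<Omega> G w + l2_inner \<Omega> H (curl \<Omega> w))"

lemma solves_graph:
  assumes "solves G H y" "H \<in> L2 \<Omega>" "q \<in> H0_graph \<Omega>"
  shows "B (y, curl \<Omega> y) q = pair_inner \<Omega> (G, H) q"
proof -
  obtain w d where q: "q = (w, d)" by (cases q)
  have y: "y \<in> H0curl \<Omega>" and w: "w \<in> H0curl \<Omega>"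
    using assms graph_H0curl by (auto simp: solves_def q)
  have "B (y, curl \<Omega> y) (w, d) = B (y, curl \<Omega> y) (w, curl \<Omega> w)"
    using pair_form_cong[OF H0curl_graph[OF y]] assms(3) by (simp add: q)
  also have "\<dots> = l2_inner \<Omega> G w + l2_inner \<Omega> H (curl \<Omega> w)"
    using assms(1) w by (simp add: solves_def flip: maxwell_form_eq)
  also have "\<dots> = pair_inner \<Omega> (G, H) (w, d)"
    using pair_inner_cong[OF assms(2)] assms(3) by (simp add: pair_inner_def q)
  finally show ?thesis by (simp add: q)
qed

theorem solves_unique_ae:
  assumes G: "G \<in> L2 \<Omega>" and H: "H \<in> L2 \<Omega>"
  shows "\<exists>y. unique_ae \<Omega> (solves G H) y"
proof -
  obtain v c where p: "(v, c) \<in> H0_graph \<Omega>"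
    and eq: "\<And>q. q \<in> H0_graph \<Omega> \<Longrightarrow> B (v, c) q = pair_inner \<Omega> (G, H) q"
    using form_solvable[OF G H] by force
  have "solves G H v"
    unfolding solves_def
  proof (intro conjI ballI)
    show "v \<in> H0curl \<Omega>" by (rule graph_H0curl[OF p])
    fix w assume w: "w \<in> H0curl \<Omega>"
    note g = H0curl_graph[OF w]
    show "maxwell_form \<Omega> \<mu> \<omega> \<kappa> v w = l2_inner \<Omega> G w + l2_inner \<Omega> H (curl \<Omega> w)"
      unfolding maxwell_form_eq pair_form_cong[OF p g] eq[OF g] by (simp add: pair_inner_def)
  qed
  moreover have "AE x in lebesgue_on \<Omega>. y x = v x" if y: "solves G H y" for y
  proof -
    have yg: "(y, curl \<Omega> y) \<in> H0_graph \<Omega>" using y by (intro H0curl_graph) (simp add: solves_def)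
    have "AE x in lebesgue_on \<Omega>. fst (y, curl \<Omega> y) x = fst (v, c) x"
      by (rule form_unique[OF yg p]) (simp add: solves_graph[OF y H] eq)
    then show ?thesis by simp
  qed
  ultimately show ?thesis by (auto simp: unique_ae_def)
qed

end

section \<open>Expansion of the reduced cost\<close>

lemma ctrl_mult_perturb:
  "ctrl_mult P e (u + t *\<^sub>R h) x = ctrl_mult P e u x + complex_of_real t * ctrl_mult P e h x"
  by (auto simp: ctrl_mult_def sum_distrib_left algebra_simps simp flip: sum.distrib intro!: sum.cong)

lemma ctrl_mult_on:
  assumes "domain_partition \<Omega> P" "x \<in> P k"
  shows "ctrl_mult P e u x = complex_of_real (u $ k) * e x"
proof -
  have "x \<in> P j \<longleftrightarrow> j = k" for j using assms unfolding domain_partition_def by blast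
  then show ?thesis by (simp add: ctrl_mult_def)
qed

lemma norm_ctrl_mult_le: "norm (ctrl_mult P e u x) \<le> (\<Sum>k\<in>UNIV. \<bar>u $ k\<bar>) * norm (e x)"
  unfolding ctrl_mult_def sum_distrib_right
  by (rule order_trans[OF norm_sum], rule sum_mono) (auto simp: norm_mult)

text \<open>Outside all subdomains \<open>ctrl_mult\<close> is 0 and its imaginary part has no
  positive lower bound; the null set condition of the partition makes this exceptional set
  harmless.\<close>

lemma domain_partition_AE:
  assumes "open \<Omega>" "domain_partition \<Omega> P"
  shows "AE x in lebesgue_on \<Omega>. \<exists>k. x \<in> P k"
proof -
  have "AE x in lebesgue. x \<notin> \<Omega> - (\<Union>k. P k)"
    using assms(2) by (intro AE_not_in) (simp add: domain_partition_def negligible_iff_null_sets)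
  then show ?thesis using assms(1) by (subst AE_restrict_space_iff) (auto elim: eventually_mono)
qed

text \<open>The control enters only the term without derivatives, and does so linearly, so a
  perturbation adds one inner product and leaves the curl term alone.\<close>

lemma pair_form_perturb:
  assumes "open \<Omega>" and p: "fst p \<in> L2 \<Omega>" and q: "fst q \<in> L2 \<Omega>"
    and \<kappa>: "(\<lambda>x. \<kappa> x *s fst p x) \<in> L2 \<Omega>" and \<eta>: "(\<lambda>x. \<eta> x *s fst p x) \<in> L2 \<Omega>"
  shows "pair_form \<Omega> \<mu> \<omega> (\<lambda>x. \<kappa> x + complex_of_real t * \<eta> x) p q =
    pair_form \<Omega> \<mu> \<omega> \<kappa> p q - complex_of_real (\<omega>\<^sup>2 * t) * l2_inner \<Omega> (\<lambda>x. \<eta> x *s fst p x) (fst q)"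
proof -
  have "l2_inner \<Omega> (\<lambda>x. (\<kappa> x + complex_of_real t * \<eta> x) *s fst p x) (fst q)
      = l2_inner \<Omega> (\<lambda>x. \<kappa> x *s fst p x + complex_of_real t *s (\<eta> x *s fst p x)) (fst q)"
    by (simp add: vector_sadd_rdistrib vector_smult_assoc)
  also have "\<dots> = l2_inner \<Omega> (\<lambda>x. \<kappa> x *s fst p x) (fst q)
      + complex_of_real t * l2_inner \<Omega> (\<lambda>x. \<eta> x *s fst p x) (fst q)"
    unfolding l2_inner_add_left[OF \<kappa> L2_smult[OF \<eta>] q] l2_inner_smult_left ..
  finally show ?thesis by (simp add: pair_form_def algebra_simps)
qed

text \<open>A conjugate in the second slot cancels the conjugation of the inner product. What
  remains is bilinear with scalar coefficients, hence symmetric.\<close>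

lemma pair_form_symmetric:
  "pair_form \<Omega> \<mu> \<omega> \<kappa> p (\<lambda>x. cnjv (fst q x), \<lambda>x. cnjv (snd q x)) =
   pair_form \<Omega> \<mu> \<omega> \<kappa> q (\<lambda>x. cnjv (fst p x), \<lambda>x. cnjv (snd p x))"
  by (simp add: pair_form_def l2_inner_cnjv cdot_scale_left cdot_commute[of "fst p _"] cdot_commute[of "snd p _"])

lemma l2_norm_add_sq:
  assumes "v \<in> L2 \<Omega>" "w \<in> L2 \<Omega>"
  shows "(l2_norm \<Omega> (\<lambda>x. v x + w x))\<^sup>2 = (l2_norm \<Omega> v)\<^sup>2 + 2 * Re (l2_inner \<Omega> v w) + (l2_norm \<Omega> w)\<^sup>2"
proof -
  have "(l2_norm \<Omega> (v + w))\<^sup>2 = Re (l2_inner \<Omega> (v + w) (v + w))"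
    using assms by (intro l2.nrm_sq) auto
  also have "\<dots> = Re (l2_inner \<Omega> v v) + 2 * Re (l2_inner \<Omega> v w) + Re (l2_inner \<Omega> w w)"
    using assms l2.ip_commute[of w \<Omega> v] by (simp add: l2.ip_add l2.ip_add_right)
  finally show ?thesis by (simp only: l2_inner_self Re_complex_of_real func_plus)
qed

locale maxwell_control = bounded_domain +
  fixes P :: "'l::finite \<Rightarrow> (real^3) set" and \<mu> :: "real^3 \<Rightarrow> real"
    and \<omega> \<nu>lo \<nu>hi E elo :: real and e :: "real^3 \<Rightarrow> complex"
  assumes part: "domain_partition \<Omega> P"
    and \<omega>: "\<omega> > 0" and \<nu>lo: "\<nu>lo > 0" and elo: "elo > 0"
    and \<mu>_meas: "\<mu> \<in> borel_measurable (lebesgue_on \<Omega>)"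
    and \<nu>_bounds: "AE x in lebesgue_on \<Omega>. \<nu>lo \<le> inverse (\<mu> x) \<and> inverse (\<mu> x) \<le> \<nu>hi"
    and e_meas: "e \<in> borel_measurable (lebesgue_on \<Omega>)"
    and e_bounds: "AE x in lebesgue_on \<Omega>. norm (e x) \<le> E \<and> elo \<le> Im (e x)"
begin

lemma P_open: "open (P k)" and P_subset: "P k \<subseteq> \<Omega>"
  using part by (auto simp: domain_partition_def)

lemma ctrl_mult_meas: "ctrl_mult P e u \<in> borel_measurable (lebesgue_on \<Omega>)"
proof -
  have "{x \<in> space (lebesgue_on \<Omega>). x \<in> P k} \<in> sets (lebesgue_on \<Omega>)" for k
  proof -
    have "{x \<in> space (lebesgue_on \<Omega>). x \<in> P k} = P k" using P_subset[of k] by auto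
    then show ?thesis
      using P_open[of k] P_subset[of k] open_domain by (simp add: sets_restrict_space_iff)
  qed
  then show ?thesis
    unfolding ctrl_mult_def[abs_def]
    by (intro borel_measurable_sum measurable_If borel_measurable_times borel_measurable_const e_meas)
qed

lemma ctrl_mult_bound:
  "AE x in lebesgue_on \<Omega>. norm (ctrl_mult P e u x) \<le> (\<Sum>k\<in>UNIV. \<bar>u $ k\<bar>) * E"
  using e_bounds
proof eventually_elim
  case (elim x)
  have "norm (ctrl_mult P e u x) \<le> (\<Sum>k\<in>UNIV. \<bar>u $ k\<bar>) * norm (e x)"
    by (rule norm_ctrl_mult_le)
  also have "\<dots> \<le> (\<Sum>k\<in>UNIV. \<bar>u $ k\<bar>) * E"
    using elim by (intro mult_left_mono sum_nonneg) auto
  finally show ?case .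
qed

lemma ctrl_mult_L2: "v \<in> L2 \<Omega> \<Longrightarrow> (\<lambda>x. ctrl_mult P e u x *s v x) \<in> L2 \<Omega>"
  by (rule L2_mult[OF ctrl_mult_meas _ ctrl_mult_bound])

text \<open>On the subdomain with index \<open>k\<close> the imaginary part is
  \<open>u $ k * Im (e x)\<close>, so a positive lower bound on all components of the control
  suffices for well-posedness.\<close>

lemma coefficients:
  assumes a0: "a0 > 0" "\<And>k. a0 \<le> u $ k"
  shows "maxwell_coefficients \<Omega> \<mu> \<omega> \<nu>lo \<nu>hi ((\<Sum>k\<in>UNIV. \<bar>u $ k\<bar>) * E) (a0 * elo) (ctrl_mult P e u)"
proof
  show "AE x in lebesgue_on \<Omega>. norm (ctrl_mult P e u x) \<le> (\<Sum>k\<in>UNIV. \<bar>u $ k\<bar>) * E \<and>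
      a0 * elo \<le> Im (ctrl_mult P e u x)"
    using ctrl_mult_bound[of u] e_bounds domain_partition_AE[OF open_domain part]
  proof eventually_elim
    case (elim x)
    then obtain k where k: "x \<in> P k" by blast
    have "a0 * elo \<le> u $ k * Im (e x)"
      using elim a0(1) a0(2)[of k] elo by (intro mult_mono) auto
    then show ?case using elim by (simp add: ctrl_mult_on[OF part k])
  qed
qed (use \<omega> \<nu>lo \<nu>_bounds \<mu>_meas elo a0 ctrl_mult_meas in auto)

lemma state_map_solves:
  assumes "a0 > 0" "\<And>k. a0 \<le> u $ k" "f \<in> L2 \<Omega>"
  shows "solves_state \<Omega> \<mu> \<omega> (ctrl_mult P e u) f (state_map \<Omega> P \<mu> \<omega> e f u)"
proof -
  interpret C: maxwell_coefficients \<Omega> \<mu> \<omega> \<nu>lo \<nu>hi "(\<Sum>k\<in>UNIV. \<bar>u $ k\<bar>) * E" "a0 * elo" "ctrl_mult P e u"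
    using assms by (intro coefficients)
  have "(\<lambda>x. 0) \<in> L2 \<Omega>" by (simp add: L2_def)
  from C.solves_unique_ae[OF assms(3) this]
  have "\<exists>y. unique_ae \<Omega> (solves_state \<Omega> \<mu> \<omega> (ctrl_mult P e u) f) y"
    by (simp add: C.solves_def[abs_def] solves_state_def[abs_def] l2_inner_def cdot_def)
  then have "unique_ae \<Omega> (solves_state \<Omega> \<mu> \<omega> (ctrl_mult P e u) f) (state_map \<Omega> P \<mu> \<omega> e f u)"
    unfolding state_map_def by (rule someI_ex)
  then show ?thesis by (simp add: unique_ae_def)
qed

lemma state_graph:
  assumes a0: "a0 > 0" "\<And>k. a0 \<le> u $ k" and y: "solves_state \<Omega> \<mu> \<omega> (ctrl_mult P e u) f y"
    and q: "q \<in> H0_graph \<Omega>"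
  shows "pair_form \<Omega> \<mu> \<omega> (ctrl_mult P e u) (y, curl \<Omega> y) q = l2_inner \<Omega> f (fst q)"
proof -
  interpret C: maxwell_coefficients \<Omega> \<mu> \<omega> \<nu>lo \<nu>hi "(\<Sum>k\<in>UNIV. \<bar>u $ k\<bar>) * E" "a0 * elo" "ctrl_mult P e u"
    using a0 by (intro coefficients)
  have z: "(\<lambda>x. 0) \<in> L2 \<Omega>" by (simp add: L2_def)
  have "C.solves f (\<lambda>x. 0) y"
    using y by (simp add: C.solves_def solves_state_def l2_inner_def cdot_def)
  from C.solves_graph[OF this z q] show ?thesis by (simp add: pair_inner_def l2_inner_def cdot_def)
qed

text \<open>Converts the derivative, naturally an integral over the whole domain, into the subdomain
  integrals of the variational inequality.\<close>

lemma l2_inner_ctrl_mult: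
  assumes y: "y \<in> L2 \<Omega>" and p: "p \<in> L2 \<Omega>"
  shows "l2_inner \<Omega> (\<lambda>x. ctrl_mult P e h x *s y x) (\<lambda>x. cnjv (p x)) =
    (\<Sum>k\<in>UNIV. complex_of_real (h $ k) * (LINT x|lebesgue_on (P k). e x * (y x \<odot> p x)))"
proof -
  have S: "P k \<in> sets lebesgue" "\<Omega> \<in> sets lebesgue" for k using P_open open_domain by auto
  have I: "integrable (lebesgue_on \<Omega>) (\<lambda>x. if x \<in> P k then complex_of_real (h $ k) * (e x * (y x \<odot> p x)) else 0)" for k
  proof -
    have "AE x in lebesgue_on \<Omega>. norm (e x) \<le> E" using e_bounds by eventually_elim simp
    from L2_integrable_cdot[OF L2_mult[OF e_meas y this] p]
    have "integrable (lebesgue_on \<Omega>) (\<lambda>x. complex_of_real (h $ k) * (e x * (y x \<odot> p x)))"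
      by (simp add: cdot_scale_left)
    then have "integrable lebesgue (\<lambda>x. if x \<in> \<Omega> then complex_of_real (h $ k) * (e x * (y x \<odot> p x)) else 0)"
      by (simp add: Lebesgue_Measure.integrable_restrict_UNIV S)
    then have "integrable lebesgue (\<lambda>x. indicator (P k) x *\<^sub>R (if x \<in> \<Omega> then complex_of_real (h $ k) * (e x * (y x \<odot> p x)) else 0))"
      by (intro integrable_mult_indicator S)
    also have "(\<lambda>x. indicator (P k) x *\<^sub>R (if x \<in> \<Omega> then complex_of_real (h $ k) * (e x * (y x \<odot> p x)) else 0))
        = (\<lambda>x. if x \<in> \<Omega> then (if x \<in> P k then complex_of_real (h $ k) * (e x * (y x \<odot> p x)) else 0) else 0)"
      by (auto simp: fun_eq_iff indicator_def)
    finally show ?thesis by (simp add: Lebesgue_Measure.integrable_restrict_UNIV S)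
  qed
  have "l2_inner \<Omega> (\<lambda>x. ctrl_mult P e h x *s y x) (\<lambda>x. cnjv (p x)) =
      (LINT x|lebesgue_on \<Omega>. (\<Sum>k\<in>UNIV. if x \<in> P k then complex_of_real (h $ k) * (e x * (y x \<odot> p x)) else 0))"
    unfolding l2_inner_cnjv cdot_scale_left ctrl_mult_def sum_distrib_right
    by (intro Bochner_Integration.integral_cong sum.cong refl) (simp add: mult.assoc)
  also have "\<dots> = (\<Sum>k\<in>UNIV. LINT x|lebesgue_on \<Omega>. (if x \<in> P k then complex_of_real (h $ k) * (e x * (y x \<odot> p x)) else 0))"
    by (rule Bochner_Integration.integral_sum) (rule I)
  also have "\<dots> = (\<Sum>k\<in>UNIV. LINT x|lebesgue_on (P k). complex_of_real (h $ k) * (e x * (y x \<odot> p x)))"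
    by (intro sum.cong refl integral_restrict P_subset S)
  finally show ?thesis by simp
qed

text \<open>Only an upper bound on the change in cost is proved, because optimality supplies the
  opposite inequality. The constant \<open>C\<close> may depend on \<open>h\<close> but not on
  \<open>t\<close>.\<close>

theorem cost_expansion:
  assumes a0: "a0 > 0" and u: "\<And>k. a0 \<le> u $ k" and uh: "\<And>k. a0 \<le> u $ k + h $ k"
    and L2: "f \<in> L2 \<Omega>" "yd \<in> L2 \<Omega>" "Ed \<in> L2 \<Omega>"
    and S: "S = state_map \<Omega> P \<mu> \<omega> e f"
    and p: "solves_adjoint \<Omega> \<mu> \<omega> (ctrl_mult P e u) yd Ed (S u) p"
  shows "\<exists>C \<tau>. \<tau> > 0 \<and> (\<forall>t. 0 < t \<and> t \<le> \<tau> \<longrightarrow>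
    cost \<Omega> \<alpha> yd Ed (S (u + t *\<^sub>R h)) (u + t *\<^sub>R h) - cost \<Omega> \<alpha> yd Ed (S u) u
      \<le> t * (\<omega>\<^sup>2 * Re (l2_inner \<Omega> (\<lambda>x. ctrl_mult P e h x *s S u x) (\<lambda>x. cnjv (p x))) + \<alpha> * (u \<bullet> h))
        + C * t\<^sup>2)"
proof -
  define \<kappa> \<eta> where "\<kappa> = ctrl_mult P e u" and "\<eta> = ctrl_mult P e h"
  interpret C: maxwell_coefficients \<Omega> \<mu> \<omega> \<nu>lo \<nu>hi "(\<Sum>k\<in>UNIV. \<bar>u $ k\<bar>) * E" "a0 * elo" \<kappa>
    unfolding \<kappa>_def using a0 u by (intro coefficients)
  interpret G: semi_inner "H0_graph \<Omega>" "graph_inner \<Omega>" by (rule semi_inner_graph)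
  define y where "y = S u"
  have y: "solves_state \<Omega> \<mu> \<omega> \<kappa> f y"
    unfolding y_def S \<kappa>_def using a0 u L2(1) by (rule state_map_solves)
  define Y where "Y = (y, curl \<Omega> y)"
  have Y: "Y \<in> H0_graph \<Omega>" using y by (simp add: Y_def H0curl_graph solves_state_def)
  define Q where "Q = (p, curl \<Omega> p)"
  have Q: "Q \<in> H0_graph \<Omega>" using p by (simp add: Q_def H0curl_graph solves_adjoint_def)
  define r1 r2 where "r1 x = y x - yd x" and "r2 x = curl \<Omega> y x - Ed x" for x
  have r: "r1 \<in> L2 \<Omega>" "r2 \<in> L2 \<Omega>"
    using L2_diff[OF graph_L2(1)[OF Y] L2(2)] L2_diff[OF graph_L2(2)[OF Y] L2(3)]
    by (simp_all add: r1_def[abs_def] r2_def[abs_def] Y_def)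
  have adj: "C.B Q q = pair_inner \<Omega> (\<lambda>x. cnjv (r1 x), \<lambda>x. cnjv (r2 x)) q" if "q \<in> H0_graph \<Omega>" for q
    unfolding Q_def
    by (rule C.solves_graph[OF _ L2_cnjv[OF r(2)] that])
       (unfold C.solves_def, use p in \<open>simp add: solves_adjoint_def \<kappa>_def y_def r1_def r2_def\<close>)
  obtain k where k: "k > 0" "\<And>q. q \<in> H0_graph \<Omega> \<Longrightarrow> k * (graph_norm \<Omega> q)\<^sup>2 \<le> norm (C.B q q)"
    using C.form_coercive by blast
  \<comment> \<open>A bound for the perturbing coefficient; the absolute value makes it nonnegative
    whatever the sign of \<open>E\<close>.\<close>
  define H where "H = \<bar>(\<Sum>k\<in>UNIV. \<bar>h $ k\<bar>) * E\<bar>"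
  have H: "AE x in lebesgue_on \<Omega>. norm (\<eta> x) \<le> H" "0 \<le> H"
    unfolding \<eta>_def H_def using ctrl_mult_bound[of h] by (auto elim!: eventually_mono)
  have \<eta>_L2: "(\<lambda>x. \<eta> x *s v x) \<in> L2 \<Omega>" if "v \<in> L2 \<Omega>" for v
    unfolding \<eta>_def by (rule ctrl_mult_L2[OF that])
  have \<eta>_le: "norm (l2_inner \<Omega> (\<lambda>x. \<eta> x *s v x) w) \<le> H * l2_norm \<Omega> v * l2_norm \<Omega> w"
    if "v \<in> L2 \<Omega>" "w \<in> L2 \<Omega>" for v w
  proof -
    have "l2_norm \<Omega> (\<lambda>x. \<eta> x *s v x) \<le> H * l2_norm \<Omega> v"
      using ctrl_mult_meas[of h] that H by (intro l2_norm_mult_le) (auto simp: \<eta>_def)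
    from order_trans[OF norm_l2_inner_le[OF \<eta>_L2[OF that(1)] that(2)] mult_right_mono[OF this l2_norm_nonneg]]
    show ?thesis .
  qed
  define N where "N = graph_norm \<Omega> Y"
  have N: "0 \<le> N" by (simp add: N_def graph_norm_def)
  \<comment> \<open>The constant in the bound \<open>M * t\<close> on the graph norm of the state
    difference; the factor 2 remains after half of the coercivity term has absorbed the unknown
    norm.\<close>
  define M where "M = 2 * (\<omega>\<^sup>2 * H * N) / k"
  define D where "D = \<omega>\<^sup>2 * Re (l2_inner \<Omega> (\<lambda>x. \<eta> x *s y x) (\<lambda>x. cnjv (p x))) + \<alpha> * (u \<bullet> h)"
  \<comment> \<open>The second entry ensures \<open>\<omega>\<^sup>2 * t * H \<le> k / 2\<close>, as
    the absorption requires, with the 1 covering \<open>H = 0\<close>. The first keeps the control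
    on the segment from \<open>u\<close> to \<open>u + h\<close>, where the lower bound
    \<open>a0\<close> persists by convexity.\<close>
  define \<tau> where "\<tau> = min 1 (k / (2 * (\<omega>\<^sup>2 * H + 1)))"
  have den: "0 < 2 * (\<omega>\<^sup>2 * H + 1)" using H by (simp add: add_nonneg_pos)
  have \<tau>: "\<tau> > 0" using k den by (simp add: \<tau>_def)
  \<comment> \<open>Three sources of second order terms: replacing the perturbed state by
    \<open>y\<close> in the adjoint term, half the squared graph norm of the state difference, and
    the control penalty.\<close>
  define Cst where "Cst = \<omega>\<^sup>2 * (H * M * l2_norm \<Omega> p) + M\<^sup>2 / 2 + \<alpha> / 2 * (norm h)\<^sup>2"
  have "cost \<Omega> \<alpha> yd Ed (S (u + t *\<^sub>R h)) (u + t *\<^sub>R h) - cost \<Omega> \<alpha> yd Ed (S u) u \<le> t * D + Cst * t\<^sup>2"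
    if t: "0 < t" "t \<le> \<tau>" for t
  proof -
    have t1: "t \<le> 1" and "t \<le> k / (2 * (\<omega>\<^sup>2 * H + 1))" using t by (auto simp: \<tau>_def)
    then have "t * (2 * (\<omega>\<^sup>2 * H + 1)) \<le> k" using den by (simp add: pos_le_divide_eq)
    then have t2: "\<omega>\<^sup>2 * t * H \<le> k / 2" using t by (simp add: algebra_simps)
    define yt where "yt = S (u + t *\<^sub>R h)"
    have ut: "a0 \<le> (u + t *\<^sub>R h) $ j" for j
    proof -
      have "a0 = (1 - t) * a0 + t * a0" by (simp add: algebra_simps)
      also have "\<dots> \<le> (1 - t) * u $ j + t * (u $ j + h $ j)"
        using t t1 u uh by (intro add_mono mult_left_mono) auto
      finally show ?thesis by (simp add: algebra_simps)
    qed
    have yt: "solves_state \<Omega> \<mu> \<omega> (ctrl_mult P e (u + t *\<^sub>R h)) f yt"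
      unfolding yt_def S using a0 ut L2(1) by (rule state_map_solves)
    define Yt where "Yt = (yt, curl \<Omega> yt)"
    have Yt: "Yt \<in> H0_graph \<Omega>" using yt by (simp add: Yt_def H0curl_graph solves_state_def)
    define Z where "Z = Yt - Y"
    have Z: "Z \<in> H0_graph \<Omega>" using Y Yt by (simp add: Z_def)
    have YtZ: "Yt = Y + Z" by (simp add: Z_def)
    \<comment> \<open>The unperturbed form is kept on the left, so that its coercivity and symmetry
      apply; the price is the perturbed state \<open>yt\<close> on the right.\<close>
    have BZ: "C.B Z q = complex_of_real (\<omega>\<^sup>2 * t) * l2_inner \<Omega> (\<lambda>x. \<eta> x *s yt x) (fst q)"
      if q: "q \<in> H0_graph \<Omega>" for q
    proof -
      have "C.B Y q + C.B Z q = C.B Yt q" using C.form_add[OF Y Z q] by (simp add: YtZ)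
      also have "\<dots> = pair_form \<Omega> \<mu> \<omega> (ctrl_mult P e (u + t *\<^sub>R h)) Yt q
          + complex_of_real (\<omega>\<^sup>2 * t) * l2_inner \<Omega> (\<lambda>x. \<eta> x *s fst Yt x) (fst q)"
      proof -
        have "ctrl_mult P e (u + t *\<^sub>R h) = (\<lambda>x. \<kappa> x + complex_of_real t * \<eta> x)"
          by (simp add: fun_eq_iff ctrl_mult_perturb \<kappa>_def \<eta>_def)
        then show ?thesis
          using pair_form_perturb[OF open_domain graph_L2(1)[OF Yt] graph_L2(1)[OF q]
              C.\<kappa>_L2[OF graph_L2(1)[OF Yt]] \<eta>_L2[OF graph_L2(1)[OF Yt]]] by simp
      qed
      also have "pair_form \<Omega> \<mu> \<omega> (ctrl_mult P e (u + t *\<^sub>R h)) Yt q = l2_inner \<Omega> f (fst q)"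
        unfolding Yt_def using a0 ut yt q by (rule state_graph)
      also have "l2_inner \<Omega> f (fst q) = C.B Y q"
        unfolding Y_def \<kappa>_def using a0 u y[unfolded \<kappa>_def] q by (rule state_graph[symmetric])
      finally show ?thesis by (simp add: Yt_def)
    qed
    have Yt_le: "l2_norm \<Omega> yt \<le> N + graph_norm \<Omega> Z"
    proof -
      have "l2_norm \<Omega> yt \<le> graph_norm \<Omega> Yt" using graph_norm_ge(1)[of Yt] by (simp add: Yt_def)
      also have "\<dots> \<le> N + graph_norm \<Omega> Z"
        using G.nrm_triangle[OF Y Z] by (simp add: nrm_graph YtZ N_def)
      finally show ?thesis .
    qed
    have gZ: "0 \<le> graph_norm \<Omega> Z" by (simp add: graph_norm_def)
    have "k * (graph_norm \<Omega> Z)\<^sup>2 \<le> \<omega>\<^sup>2 * t * norm (l2_inner \<Omega> (\<lambda>x. \<eta> x *s yt x) (fst Z))"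
      using k(2)[OF Z] t unfolding BZ[OF Z] norm_mult norm_of_real by simp
    also have "\<dots> \<le> \<omega>\<^sup>2 * t * (H * l2_norm \<Omega> yt * l2_norm \<Omega> (fst Z))"
      using \<eta>_le[of yt "fst Z"] graph_L2(1)[OF Yt] graph_L2(1)[OF Z] t
      by (intro mult_left_mono) (auto simp: Yt_def)
    also have "\<dots> \<le> \<omega>\<^sup>2 * t * (H * (N + graph_norm \<Omega> Z) * graph_norm \<Omega> Z)"
      using t H N gZ Yt_le graph_norm_ge(1)[of Z]
      by (intro mult_left_mono mult_mono) auto
    finally have "(k * graph_norm \<Omega> Z) * graph_norm \<Omega> Z
        \<le> (\<omega>\<^sup>2 * t * H * (N + graph_norm \<Omega> Z)) * graph_norm \<Omega> Z"
      by (simp add: power2_eq_square algebra_simps)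
    \<comment> \<open>One factor \<open>graph_norm \<Omega> Z\<close> is cancelled; if it is 0 the
      left side vanishes.\<close>
    then have "k * graph_norm \<Omega> Z \<le> \<omega>\<^sup>2 * t * H * (N + graph_norm \<Omega> Z)"
      using gZ N H t by (cases "graph_norm \<Omega> Z = 0") auto
    also have "\<dots> \<le> \<omega>\<^sup>2 * t * H * N + k / 2 * graph_norm \<Omega> Z"
      using mult_right_mono[OF t2 gZ] by (simp add: algebra_simps)
    finally have "k * graph_norm \<Omega> Z \<le> 2 * (\<omega>\<^sup>2 * t * H * N)" by simp
    then have Zt: "graph_norm \<Omega> Z \<le> M * t" using k by (simp add: M_def field_simps)

    \<comment> \<open>The first order part of the cost is computed without estimates: conjugating
      both residuals and the difference gives the right side of the adjoint equation, symmetry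
      exchanges the arguments, and \<open>BZ\<close> evaluates the result. Conjugation does not
      affect the real part.\<close>
    have sd: "Re (l2_inner \<Omega> r1 (fst Z)) + Re (l2_inner \<Omega> r2 (snd Z))
        = \<omega>\<^sup>2 * t * Re (l2_inner \<Omega> (\<lambda>x. \<eta> x *s yt x) (\<lambda>x. cnjv (p x)))"
    proof -
      let ?Zc = "(\<lambda>x. cnjv (fst Z x), \<lambda>x. cnjv (snd Z x))"
      have "cnj (l2_inner \<Omega> r1 (fst Z) + l2_inner \<Omega> r2 (snd Z))
          = pair_inner \<Omega> (\<lambda>x. cnjv (r1 x), \<lambda>x. cnjv (r2 x)) ?Zc"
        by (simp add: pair_inner_def l2_inner_cnjv_cnjv)
      also have "\<dots> = C.B Q ?Zc" by (rule adj[OF graph_cnjv[OF Z], symmetric])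
      also have "\<dots> = C.B Z (\<lambda>x. cnjv (fst Q x), \<lambda>x. cnjv (snd Q x))" by (rule pair_form_symmetric)
      also have "\<dots> = complex_of_real (\<omega>\<^sup>2 * t) * l2_inner \<Omega> (\<lambda>x. \<eta> x *s yt x) (\<lambda>x. cnjv (p x))"
        using BZ[OF graph_cnjv[OF Q]] by (simp add: Q_def)
      finally have "Re (cnj (l2_inner \<Omega> r1 (fst Z) + l2_inner \<Omega> r2 (snd Z)))
          = Re (complex_of_real (\<omega>\<^sup>2 * t) * l2_inner \<Omega> (\<lambda>x. \<eta> x *s yt x) (\<lambda>x. cnjv (p x)))"
        by (rule arg_cong)
      then show ?thesis by (simp del: of_real_mult of_real_power)
    qed
    \<comment> \<open>Splitting off the difference \<open>fst Z\<close>, which is of order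
      \<open>t\<close>, leaves the unperturbed state and a remainder that becomes quadratic after
      multiplication by \<open>t\<close>.\<close>
    have "l2_inner \<Omega> (\<lambda>x. \<eta> x *s yt x) (\<lambda>x. cnjv (p x))
        = l2_inner \<Omega> (\<lambda>x. \<eta> x *s y x) (\<lambda>x. cnjv (p x)) + l2_inner \<Omega> (\<lambda>x. \<eta> x *s fst Z x) (\<lambda>x. cnjv (p x))"
    proof -
      have "yt x = y x + fst Z x" for x
        by (simp add: Z_def Yt_def Y_def fst_diff)
      then show ?thesis
        using l2_inner_add_left[OF \<eta>_L2 \<eta>_L2 L2_cnjv, OF graph_L2(1)[OF Y] graph_L2(1)[OF Z] graph_L2(1)[OF Q]]
        by (simp add: vector_add_ldistrib Y_def Q_def)
    qed
    moreover have "Re (l2_inner \<Omega> (\<lambda>x. \<eta> x *s fst Z x) (\<lambda>x. cnjv (p x))) \<le> H * (M * t) * l2_norm \<Omega> p"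
    proof -
      have pc: "l2_norm \<Omega> (\<lambda>x. cnjv (p x)) = l2_norm \<Omega> p" by (simp add: l2_norm_def)
      have "Re (l2_inner \<Omega> (\<lambda>x. \<eta> x *s fst Z x) (\<lambda>x. cnjv (p x))) \<le> H * l2_norm \<Omega> (fst Z) * l2_norm \<Omega> p"
        using \<eta>_le[OF graph_L2(1)[OF Z] L2_cnjv[OF graph_L2(1)[OF Q]]]
        by (intro order_trans[OF complex_Re_le_cmod]) (simp add: Q_def pc)
      also have "\<dots> \<le> H * (M * t) * l2_norm \<Omega> p"
        using H Zt graph_norm_ge(1)[of Z] by (intro mult_right_mono mult_left_mono) auto
      finally show ?thesis .
    qed
    ultimately have "\<omega>\<^sup>2 * t * Re (l2_inner \<Omega> (\<lambda>x. \<eta> x *s yt x) (\<lambda>x. cnjv (p x)))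
        \<le> \<omega>\<^sup>2 * t * (Re (l2_inner \<Omega> (\<lambda>x. \<eta> x *s y x) (\<lambda>x. cnjv (p x))) + H * (M * t) * l2_norm \<Omega> p)"
      using t by (intro mult_left_mono) auto
    note main = this[folded sd]

    \<comment> \<open>An identity, since the cost is quadratic in the state, its curl and the
      control.\<close>
    have "cost \<Omega> \<alpha> yd Ed yt (u + t *\<^sub>R h) = cost \<Omega> \<alpha> yd Ed y u
        + (Re (l2_inner \<Omega> r1 (fst Z)) + Re (l2_inner \<Omega> r2 (snd Z))) + 1/2 * (graph_norm \<Omega> Z)\<^sup>2
        + \<alpha> * t * (u \<bullet> h) + \<alpha> / 2 * t\<^sup>2 * (norm h)\<^sup>2"
    proof -
      have e1: "(\<lambda>x. yt x - yd x) = (\<lambda>x. r1 x + fst Z x)"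
        by (simp add: fun_eq_iff r1_def Z_def Yt_def Y_def fst_diff)
      have e2: "(\<lambda>x. curl \<Omega> yt x - Ed x) = (\<lambda>x. r2 x + snd Z x)"
        by (simp add: fun_eq_iff r2_def Z_def Yt_def Y_def snd_diff)
      have e3: "(\<lambda>x. y x - yd x) = r1" "(\<lambda>x. curl \<Omega> y x - Ed x) = r2"
        by (simp_all add: fun_eq_iff r1_def r2_def)
      have e4: "(norm (u + t *\<^sub>R h))\<^sup>2 = (norm u)\<^sup>2 + 2 * t * (u \<bullet> h) + t\<^sup>2 * (norm h)\<^sup>2"
        unfolding power2_norm_eq_inner
        by (simp add: inner_simps inner_commute[of h u] power2_eq_square algebra_simps)
      have e5: "(graph_norm \<Omega> Z)\<^sup>2 = (l2_norm \<Omega> (fst Z))\<^sup>2 + (l2_norm \<Omega> (snd Z))\<^sup>2"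
        by (simp add: graph_norm_def)
      show ?thesis
        unfolding cost_def e1 e2 e3 e4 e5 l2_norm_add_sq[OF r(1) graph_L2(1)[OF Z]]
          l2_norm_add_sq[OF r(2) graph_L2(2)[OF Z]]
        by (simp add: algebra_simps)
    qed
    moreover have "(graph_norm \<Omega> Z)\<^sup>2 \<le> (M * t)\<^sup>2"
      using Zt gZ by (intro power_mono)
    ultimately show ?thesis
      using main unfolding yt_def y_def[symmetric]
      by (simp add: D_def Cst_def algebra_simps power2_eq_square)
  qed
  with \<tau> show ?thesis unfolding D_def \<eta>_def y_def by blast
qed

end

section \<open>The variational inequality\<close>

lemma eps_sigma_bounds:
  assumes "\<omega> > 0" "\<epsilon>lo > 0" "\<epsilon>lo \<le> \<epsilon> x \<and> \<epsilon> x \<le> \<epsilon>hi" "\<sigma>lo > 0" "\<sigma>lo \<le> \<sigma> x \<and> \<sigma> x \<le> \<sigma>hi"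
  shows "norm (eps_sigma \<omega> \<epsilon> \<sigma> x) \<le> \<epsilon>hi + \<sigma>hi / \<omega> \<and> \<sigma>lo / \<omega> \<le> Im (eps_sigma \<omega> \<epsilon> \<sigma> x)"
proof
  have e: "eps_sigma \<omega> \<epsilon> \<sigma> x = Complex (\<epsilon> x) (\<sigma> x / \<omega>)"
    by (simp add: eps_sigma_def complex_eq_iff)
  have "norm (eps_sigma \<omega> \<epsilon> \<sigma> x) \<le> \<bar>\<epsilon> x\<bar> + \<bar>\<sigma> x / \<omega>\<bar>"
    unfolding e using cmod_le[of "Complex (\<epsilon> x) (\<sigma> x / \<omega>)"] by simp
  also have "\<dots> \<le> \<epsilon>hi + \<sigma>hi / \<omega>"
    using assms by (intro add_mono) (auto simp: divide_right_mono)
  finally show "norm (eps_sigma \<omega> \<epsilon> \<sigma> x) \<le> \<epsilon>hi + \<sigma>hi / \<omega>" .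
  show "\<sigma>lo / \<omega> \<le> Im (eps_sigma \<omega> \<epsilon> \<sigma> x)"
    unfolding e using assms by (simp add: divide_right_mono)
qed

lemma linear_term_nonneg:
  fixes D C \<tau> :: real
  assumes "\<tau> > 0" and le: "\<And>t. 0 < t \<Longrightarrow> t \<le> \<tau> \<Longrightarrow> 0 \<le> t * D + C * t\<^sup>2"
  shows "0 \<le> D"
proof (rule tendsto_lowerbound)
  show "((\<lambda>t. D + C * t) \<longlongrightarrow> D) (at_right 0)"
    by (auto intro!: tendsto_eq_intros)
  have "\<forall>\<^sub>F t in at_right 0. t \<in> {0<..<\<tau>}"
    using assms(1) by (rule eventually_at_right_real)
  then show "\<forall>\<^sub>F t in at_right 0. 0 \<le> D + C * t"
  proof eventually_elim
    case (elim t)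
    then have "0 \<le> t * (D + C * t)" using le[of t] by (simp add: power2_eq_square algebra_simps)
    then show ?case using elim by (simp add: zero_le_mult_iff)
  qed
qed simp

theorem theorem4p5:
  fixes \<Omega> :: "(real^3) set"
    and P :: "'l::finite \<Rightarrow> (real^3) set"
    and \<mu> \<epsilon> \<sigma> :: "real^3 \<Rightarrow> real"
    and \<omega> \<alpha> \<mu>0 \<epsilon>lo \<epsilon>hi \<sigma>lo \<sigma>hi :: real
    and f y\<^sub>\<Omega> E\<^sub>\<Omega> :: field
    and a b us :: "real^'l"
  assumes "lipschitz_polyhedral_domain \<Omega>"
    and "domain_partition \<Omega> P"
    and "\<omega> > 0" and "\<alpha> > 0"
    and "\<mu> \<in> Linf \<Omega>" and "\<mu>0 > 0" and "AE x in lebesgue_on \<Omega>. \<mu>0 \<le> \<mu> x"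
    and "\<epsilon> \<in> Linf \<Omega>" and "\<epsilon>lo > 0"
    and "AE x in lebesgue_on \<Omega>. \<epsilon>lo \<le> \<epsilon> x \<and> \<epsilon> x \<le> \<epsilon>hi"
    and "\<sigma> \<in> Linf \<Omega>" and "\<sigma>lo > 0"
    and "AE x in lebesgue_on \<Omega>. \<sigma>lo \<le> \<sigma> x \<and> \<sigma> x \<le> \<sigma>hi"
    and "f \<in> L2 \<Omega>" and "y\<^sub>\<Omega> \<in> L2 \<Omega>" and "E\<^sub>\<Omega> \<in> L2 \<Omega>"
    and "\<forall>k. 0 < a $ k \<and> a $ k < b $ k"
  defines "e \<equiv> eps_sigma \<omega> \<epsilon> \<sigma>"
  defines "S \<equiv> state_map \<Omega> P \<mu> \<omega> e f"
  assumes "locally_optimal (Uad a b) (\<lambda>u. cost \<Omega> \<alpha> y\<^sub>\<Omega> E\<^sub>\<Omega> (S u) u) us"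
  shows "\<exists>p. unique_ae \<Omega> (solves_adjoint \<Omega> \<mu> \<omega> (ctrl_mult P e us) y\<^sub>\<Omega> E\<^sub>\<Omega> (S us)) p \<and>
           (\<forall>u\<in>Uad a b.
              0 \<le> (\<Sum>k\<in>UNIV.
                    (\<alpha> * us $ k
                     + \<omega>\<^sup>2 * Re (LINT x|lebesgue_on (P k). e x * (S us x \<odot> p x)))
                    * (u $ k - us $ k)))"
proof -
  note as = assms
  have \<Omega>: "open \<Omega>" "bounded \<Omega>"
    using as(1) by (auto simp: lipschitz_polyhedral_domain_def)
  obtain C where C: "AE x in lebesgue_on \<Omega>. \<bar>\<mu> x\<bar> \<le> C" using as(5) by (auto simp: Linf_def)
  have meas [measurable]: "\<mu> \<in> borel_measurable (lebesgue_on \<Omega>)" "\<epsilon> \<in> borel_measurable (lebesgue_on \<Omega>)"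
    "\<sigma> \<in> borel_measurable (lebesgue_on \<Omega>)"
    using as(5,8,11) by (auto simp: Linf_def)
  \<comment> \<open>The upper bound \<open>C\<close> on \<mu> is replaced by \<open>max C 1\<close>
    so that its reciprocal is positive without further knowledge of \<open>C\<close>. The
    conductivity enters through the lower bound \<open>\<sigma>lo / \<omega>\<close> on the
    imaginary part.\<close>
  interpret maxwell_control \<Omega> P \<mu> \<omega> "inverse (max C 1)" "inverse \<mu>0" "\<epsilon>hi + \<sigma>hi / \<omega>" "\<sigma>lo / \<omega>" e
  proof
    show "AE x in lebesgue_on \<Omega>. inverse (max C 1) \<le> inverse (\<mu> x) \<and> inverse (\<mu> x) \<le> inverse \<mu>0"
      using C as(7)
    proof eventually_elim
      case (elim x)
      then have "0 < \<mu> x" "\<mu> x \<le> max C 1" using as(6) by auto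
      then show ?case using elim as(6) by (simp add: le_imp_inverse_le)
    qed
    show "e \<in> borel_measurable (lebesgue_on \<Omega>)"
      unfolding e_def eps_sigma_def[abs_def] by measurable
    show "AE x in lebesgue_on \<Omega>. norm (e x) \<le> \<epsilon>hi + \<sigma>hi / \<omega> \<and> \<sigma>lo / \<omega> \<le> Im (e x)"
      using as(10,13) unfolding e_def
      by eventually_elim (rule eps_sigma_bounds[OF as(3,9) _ as(12)])
  qed (use \<Omega> as in auto)
  \<comment> \<open>A single positive bound below all components of all admissible controls; it
    exists because there are finitely many subdomains.\<close>
  define a0 where "a0 = Min (range (\<lambda>k. a $ k))"
  have "a0 \<in> range (\<lambda>k. a $ k)" unfolding a0_def by (intro Min_in) auto
  then have a0: "a0 > 0" using as(17) by auto
  have a0_le: "a0 \<le> a $ k" for k unfolding a0_def by (intro Min_le) auto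
  have Uad_ge: "a0 \<le> v $ k" if "v \<in> Uad a b" for v k
    using that a0_le[of k] order_trans by (fastforce simp: Uad_def)
  obtain \<delta> where us: "us \<in> Uad a b" and \<delta>: "\<delta> > 0"
    and opt: "\<And>v. v \<in> Uad a b \<Longrightarrow> norm (v - us) \<le> \<delta> \<Longrightarrow>
      cost \<Omega> \<alpha> y\<^sub>\<Omega> E\<^sub>\<Omega> (S us) us \<le> cost \<Omega> \<alpha> y\<^sub>\<Omega> E\<^sub>\<Omega> (S v) v"
    using as(20) unfolding locally_optimal_def by blast
  note us_ge = Uad_ge[OF us]
  have "solves_state \<Omega> \<mu> \<omega> (ctrl_mult P e us) f (S us)"
    unfolding S_def by (rule state_map_solves[OF a0 us_ge as(14)])
  then have g: "(S us, curl \<Omega> (S us)) \<in> H0_graph \<Omega>" by (simp add: H0curl_graph solves_state_def)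
  interpret M: maxwell_coefficients \<Omega> \<mu> \<omega> "inverse (max C 1)" "inverse \<mu>0"
    "(\<Sum>k\<in>UNIV. \<bar>us $ k\<bar>) * (\<epsilon>hi + \<sigma>hi / \<omega>)" "a0 * (\<sigma>lo / \<omega>)" "ctrl_mult P e us"
    by (rule coefficients[OF a0 us_ge])
  have "(\<lambda>x. cnjv (S us x - y\<^sub>\<Omega> x)) \<in> L2 \<Omega>" "(\<lambda>x. cnjv (curl \<Omega> (S us) x - E\<^sub>\<Omega> x)) \<in> L2 \<Omega>"
    using graph_L2[OF g] as(15,16) by (auto intro: L2_cnjv L2_diff)
  from M.solves_unique_ae[OF this] obtain p
    where p: "unique_ae \<Omega> (solves_adjoint \<Omega> \<mu> \<omega> (ctrl_mult P e us) y\<^sub>\<Omega> E\<^sub>\<Omega> (S us)) p"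
    by (auto simp: M.solves_def[abs_def] solves_adjoint_def[abs_def])
  have adj: "solves_adjoint \<Omega> \<mu> \<omega> (ctrl_mult P e us) y\<^sub>\<Omega> E\<^sub>\<Omega> (S us) p"
    using p by (simp add: unique_ae_def)
  then have pL2: "p \<in> L2 \<Omega>"
    using graph_L2(1)[OF H0curl_graph[of p]] by (simp add: solves_adjoint_def)
  show ?thesis
  proof (intro exI[of _ p] conjI ballI p)
    fix u assume u: "u \<in> Uad a b"
    define h where "h = u - us"
    define D where "D = \<omega>\<^sup>2 * Re (l2_inner \<Omega> (\<lambda>x. ctrl_mult P e h x *s S us x) (\<lambda>x. cnjv (p x))) + \<alpha> * (us \<bullet> h)"
    have uh: "a0 \<le> us $ k + h $ k" for k using Uad_ge[OF u, of k] by (simp add: h_def)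
    obtain Q \<tau> where \<tau>: "\<tau> > 0" and expand: "\<And>t. 0 < t \<Longrightarrow> t \<le> \<tau> \<Longrightarrow>
        cost \<Omega> \<alpha> y\<^sub>\<Omega> E\<^sub>\<Omega> (S (us + t *\<^sub>R h)) (us + t *\<^sub>R h) - cost \<Omega> \<alpha> y\<^sub>\<Omega> E\<^sub>\<Omega> (S us) us \<le> t * D + Q * t\<^sup>2"
      using cost_expansion[OF a0 us_ge uh as(14-16) S_def[THEN meta_eq_to_obj_eq] adj, of \<alpha>]
      unfolding D_def by blast
    \<comment> \<open>Three restrictions on \<open>t\<close>: validity of the expansion, staying
      between \<open>us\<close> and \<open>u\<close>, and staying within \<delta> of
      \<open>us\<close>. The 1 added to the norm covers \<open>h = 0\<close>.\<close>
    define \<tau>' where "\<tau>' = min \<tau> (min 1 (\<delta> / (norm h + 1)))"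
    have h1: "norm h + 1 > 0" by (simp add: add_nonneg_pos)
    have "0 \<le> D"
    proof (rule linear_term_nonneg)
      show "\<tau>' > 0" using \<tau> \<delta> h1 by (simp add: \<tau>'_def)
      fix t assume t: "0 < t" "t \<le> \<tau>'"
      then have t': "t \<le> \<tau>" "t \<le> 1" "t * (norm h + 1) \<le> \<delta>"
        using h1 by (auto simp: \<tau>'_def pos_le_divide_eq)
      \<comment> \<open>Convexity of the box: each component is a convex combination of components
        of \<open>us\<close> and \<open>u\<close>.\<close>
      have "us + t *\<^sub>R h \<in> Uad a b"
      proof -
        have "a $ k \<le> (us + t *\<^sub>R h) $ k \<and> (us + t *\<^sub>R h) $ k \<le> b $ k" for k
        proof -
          have eq: "(us + t *\<^sub>R h) $ k = (1 - t) * us $ k + t * u $ k"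
            by (simp add: h_def algebra_simps)
          have "(1 - t) * a $ k + t * a $ k \<le> (us + t *\<^sub>R h) $ k"
            "(us + t *\<^sub>R h) $ k \<le> (1 - t) * b $ k + t * b $ k"
            unfolding eq using us u t t' by (auto simp: Uad_def intro!: add_mono mult_left_mono)
          then show ?thesis by (simp add: algebra_simps)
        qed
        then show ?thesis by (simp add: Uad_def)
      qed
      moreover have "norm (us + t *\<^sub>R h - us) \<le> \<delta>"
        using t t' by (simp add: algebra_simps)
      ultimately show "0 \<le> t * D + Q * t\<^sup>2"
        using opt expand[OF t(1) t'(1)] by force
    qed
    \<comment> \<open>The inner product over the domain and the penalty term are both linear in
      \<open>h\<close>, so they can be collected component by component.\<close>
    also have "D = (\<Sum>k\<in>UNIV. (\<alpha> * us $ k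
        + \<omega>\<^sup>2 * Re (LINT x|lebesgue_on (P k). e x * (S us x \<odot> p x))) * (u $ k - us $ k))"
      unfolding D_def l2_inner_ctrl_mult[OF graph_L2(1)[OF g, simplified] pL2]
      by (simp add: inner_vec_def h_def sum_distrib_left sum.distrib[symmetric] algebra_simps)
    finally show "0 \<le> (\<Sum>k\<in>UNIV. (\<alpha> * us $ k
        + \<omega>\<^sup>2 * Re (LINT x|lebesgue_on (P k). e x * (S us x \<odot> p x))) * (u $ k - us $ k))" .
  qed
qed

end
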